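(* Let $d\in\{2,4,8\}$, $N=dn$ with $n>1$ an integer, and $i=N-d$, with $G$ as defined in the context. In each of the following cases: (a) $N=4$, $d=2$, $i=2$; (b) $N=6$, $d=2$, $i=4$; (c) $N=8$, $d=4$, $i=4$; (e) $N=16$, $d=8$, $i=8$; the lower dimensional Busemann--Petty problem for $i$-dimensional sections of $N$-dimensional $G$-invariant convex bodies has an affirmative answer; that is, if $K$ and $L$ are $G$-invariant convex bodies in $\mathbb{R}^N$ such that $\mathrm{vol}_i(K\cap\xi)\le \mathrm{vol}_i(L\cap\xi)$ for every $i$-dimensional linear subspace $\xi$ of $\mathbb{R}^N$, then $\mathrm{vol}_N(K)\le \mathrm{vol}_N(L)$.
   Context: Fix real $d\times d$ matrices $A_1,\dots,A_{d-1}$ such that for every $\sigma\in S^{d-1}$ the vectors $\sigma, A_1\sigma,\dots,A_{d-1}\sigma$ form an orthonormal basis of $\mathbb{R}^d$ (a complete orthonormal system of linear tangent vector fields on $S^{d-1}$). Put $A_0=I_d$, let $\mathcal{A}_j=\mathrm{diag}(A_j,\dots,A_j)$ be the $N\times N$ block diagonal matrix with $n$ equal blocks, and define $$G=\Big\{\sum_{j=0}^{d-1}\lambda_j\mathcal{A}_j:\ (\lambda_0,\dots,\lambda_{d-1})\in S^{d-1}\Big\}\subset O(N).$$ A body $K$ is $G$-invariant if $gK=K$ for all $g\in G$; since $-I_N\in G$, such bodies are origin-symmetric. A convex body is a compact convex set with nonempty interior. *)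

theory Defs
  imports "HOL-Analysis.Analysis"
begin

definition convex_body :: "'a::euclidean_space set \<Rightarrow> bool" where
  "convex_body K \<longleftrightarrow> compact K \<and> convex K \<and> interior K \<noteq> {}"

definition orthonormal_basis_of :: "'a::euclidean_space set \<Rightarrow> 'a set \<Rightarrow> bool" where
  "orthonormal_basis_of \<xi> B \<longleftrightarrow>
     B \<subseteq> \<xi> \<and> pairwise orthogonal B \<and> (\<forall>b\<in>B. norm b = 1) \<and> span B = \<xi>"

(* Lebesgue measure of dimension dim \<xi> on a linear subspace \<xi>, regarded as a Borel measure on
   the ambient space. This is the definition of lborel with Basis replaced by an orthonormal
   basis of \<xi>. Such a basis exists by orthonormal_basis_subspace, and since Lebesgue measure is
   invariant under orthogonal maps the result does not depend on which one is chosen. *)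
definition subspace_lborel :: "'a::euclidean_space set \<Rightarrow> 'a measure" where
  "subspace_lborel \<xi> =
     (let B = (SOME B. orthonormal_basis_of \<xi> B)
      in distr (\<Pi>\<^sub>M b\<in>B. (lborel :: real measure)) borel (\<lambda>f. \<Sum>b\<in>B. f b *\<^sub>R b))"

(* A 0 = mat 1 is the convention A_0 = I_d. Orthonormality is stated for the family indexed
   by j < d, so that the d vectors are in particular distinct. *)
definition complete_tangent_system :: "(nat \<Rightarrow> real^'d^'d) \<Rightarrow> bool" where
  "complete_tangent_system A \<longleftrightarrow>
     A 0 = mat 1 \<and>
     (\<forall>\<sigma>\<in>sphere 0 1.
        (\<forall>j<CARD('d). \<forall>k<CARD('d). (A j *v \<sigma>) \<bullet> (A k *v \<sigma>) = (if j = k then 1 else 0)) \<and>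
        span ((\<lambda>j. A j *v \<sigma>) ` {..<CARD('d)}) = UNIV)"

(* diag(M, ..., M) with CARD('n) blocks: a coordinate of R^N is a pair
   (number of the block, position within the block). *)
definition block_diag :: "real^'d^'d \<Rightarrow> real^('n::finite \<times> 'd)^('n \<times> 'd)" where
  "block_diag M = (\<chi> p q. if fst p = fst q then M $ snd p $ snd q else 0)"

definition tangent_group :: "(nat \<Rightarrow> real^'d^'d) \<Rightarrow> (real^('n::finite \<times> 'd)^('n \<times> 'd)) set" where
  "tangent_group A =
     {(\<Sum>j<CARD('d). c j *\<^sub>R block_diag (A j)) |c. (\<Sum>j<CARD('d). (c j)\<^sup>2) = 1}"

definition invariant_under :: "(real^'m^'m) set \<Rightarrow> (real^'m) set \<Rightarrow> bool" where
  "invariant_under G K \<longleftrightarrow> (\<forall>g\<in>G. (\<lambda>x. g *v x) ` K = K)"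

end

theory Submission
  imports Defs "HOL-Probability.Distributions"
begin

text \<open>Write \<open>H x\<close> for the span of \<open>x, A 1 x, ..., A (d - 1) x\<close>, with the matrices acting blockwise. An invariant
convex body meets \<open>H x\<close> in a round ball about the origin: the vectors \<open>A j x\<close> are orthogonal of length
\<open>norm x\<close>, so the orbit of \<open>x\<close> is the whole sphere of radius \<open>norm x\<close> in \<open>H x\<close>.

If there are two blocks, then \<open>i = d\<close> and \<open>H x\<close> is itself one of the subspaces in the hypothesis.
Comparing the volumes of two round balls compares their radii, so \<open>K \<subseteq> L\<close>
(\<open>section_comparison_imp_subset\<close>).

The other case is \<open>d = 2\<close> with three blocks. There \<open>J = block_diag (A 1)\<close> is a complex structure, the
space is \<open>\<complex>\<^sup>3\<close>, and invariance means invariance under multiplication by complex numbers of modulus one.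
The sections that enter are those by complex hyperplanes, and the claim is the affirmative answer to the complex
Busemann-Petty problem in dimension three. Known proofs show that the function \<open>y \<mapsto> \<parallel>y\<parallel>\<^sub>K\<close> to the power \<open>-2\<close> is
a positive definite distribution. The proof below replaces this by integrals of Gaussians over the whole
space, as follows.

Let \<open>q \<xi> x\<close> be the modulus of the Hermitian product of \<open>x\<close> and \<open>\<xi>\<close>. Brunn's theorem
(\<open>fiber_volume_halfway\<close>) says that the volume of the section of \<open>K\<close> at complex height \<open>u\<close> over the
hyperplane orthogonal to \<open>\<xi>\<close> does not decrease when \<open>u\<close> is replaced by \<open>u / 2\<close>. Hence, for every
\<open>\<xi>\<close> and \<open>a > 0\<close>, the integral \<open>D \<xi>\<close> of \<open>4 exp (- 4 a (q \<xi> x)\<^sup>2) - exp (- a (q \<xi> x)\<^sup>2)\<close> over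
\<open>x \<in> K\<close> is nonnegative. After an arbitrarily small dilation of \<open>L\<close>, the hypothesis on sections also
gives that the slab \<open>{y. q \<xi> y \<le> \<delta>}\<close> cuts out of \<open>L\<close> at least as much volume as out of \<open>K\<close>, provided
\<open>\<delta>\<close> is small compared with \<open>\<xi>\<close>; let \<open>E \<xi>\<close> be the difference of the two volumes. The product
\<open>D \<xi> E \<xi>\<close>, multiplied by a positive radial weight and integrated over \<open>\<xi>\<close>, is therefore nonnegative.
Now exchange the order of integration, integrating over \<open>\<xi>\<close> first, divide by \<open>\<delta>\<^sup>2\<close> and let \<open>\<delta>\<close>
tend to zero. What remains (\<open>slab_kernel_limit\<close>) is an explicit positive kernel
\<open>radial_kernel (a t\<^sup>2) / (norm y)\<^sup>2\<close>, where \<open>t\<close> is the distance of \<open>x\<close> from the complex line through \<open>y\<close>.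
As \<open>a\<close> tends to infinity this kernel, multiplied by \<open>a\<^sup>2\<close>, concentrates on that line (\<open>tube_limit\<close>).
With \<open>\<Gamma> y\<close> the area of the intersection of \<open>K\<close> with the complex line through \<open>y\<close>, the limit states
that the integral of \<open>(indicator L y - indicator K y) * \<Gamma> y / (norm y)\<^sup>2\<close> over \<open>y\<close> is nonnegative. This
intersection is a disc, so \<open>\<Gamma> y \<ge> \<pi> (norm y)\<^sup>2\<close> on \<open>K\<close> and \<open>\<Gamma> y \<le> \<pi> (norm y)\<^sup>2\<close> off \<open>K\<close>. Replacing
\<open>\<Gamma> y / (norm y)\<^sup>2\<close> by \<open>\<pi>\<close> can only increase the integral, whose value is then \<open>\<pi>\<close> times the difference
of the volumes of \<open>L\<close> and \<open>K\<close>.\<close>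

section \<open>Prekopa-Leindler inequality and central sections\<close>

text \<open>If \<open>A\<close> has no maximum, the pieces of \<open>A\<close> below points of \<open>A\<close> exhaust \<open>A\<close>; if it has one, they miss at
most that single point, which is a null set.\<close>
lemma exhaust_from_left:
  fixes A :: "real set"
  assumes [measurable]: "A \<in> sets borel" and ne: "A \<noteq> {}"
  obtains a where "\<And>n::nat. a n \<in> A"
    "(\<lambda>n. emeasure lborel (A \<inter> {..<a n})) \<longlonglongrightarrow> emeasure lborel A"
proof -
  obtain e :: "nat \<Rightarrow> ereal" where e: "incseq e" "range e \<subseteq> ereal ` A"
    "Sup (ereal ` A) = (SUP i. e i)"
    using Sup_countable_SUP[of "ereal ` A"] ne by auto
  define a where "a = (\<lambda>n. real_of_ereal (e n))"
  have ea: "e n = ereal (a n) \<and> a n \<in> A" for n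
  proof -
    have "e n \<in> ereal ` A" using e(2) by auto
    then show ?thesis by (auto simp: a_def)
  qed
  have inc: "incseq a"
    using e(1) ea unfolding incseq_def by (metis ereal_less_eq(3))
  define s where "s = real_of_ereal (Sup (ereal ` A))"
  have cover: "A - {s} \<subseteq> (\<Union>n. A \<inter> {..<a n})"
  proof
    fix x assume x: "x \<in> A - {s}"
    then have "ereal x \<le> Sup (ereal ` A)" by (auto intro: SUP_upper)
    moreover have "ereal x \<noteq> Sup (ereal ` A)" using x unfolding s_def by (metis DiffD2 insertI1 real_of_ereal.simps(1))
    ultimately have "ereal x < (SUP i. e i)" using e(3) by auto
    then obtain n where "ereal x < e n" by (auto simp: less_SUP_iff)
    then show "x \<in> (\<Union>n. A \<inter> {..<a n})" using ea[of n] x by auto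
  qed
  have "(\<lambda>n. emeasure lborel (A \<inter> {..<a n})) \<longlonglongrightarrow> emeasure lborel (\<Union>n. A \<inter> {..<a n})"
  proof (rule Lim_emeasure_incseq)
    show "incseq (\<lambda>n. A \<inter> {..<a n})"
      using inc unfolding incseq_def by (fastforce intro: order_less_le_trans)
  qed auto
  moreover have "emeasure lborel (\<Union>n. A \<inter> {..<a n}) = emeasure lborel A"
  proof (rule antisym)
    show "emeasure lborel (\<Union>n. A \<inter> {..<a n}) \<le> emeasure lborel A"
      by (intro emeasure_mono) auto
    have "emeasure lborel A \<le> emeasure lborel ((A - {s}) \<union> {s})"
      by (intro emeasure_mono) auto
    also have "\<dots> \<le> emeasure lborel (A - {s}) + emeasure lborel {s}"
      by (intro emeasure_subadditive) auto
    also have "\<dots> = emeasure lborel (A - {s})" by simp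
    also have "\<dots> \<le> emeasure lborel (\<Union>n. A \<inter> {..<a n})"
      by (intro emeasure_mono cover) auto
    finally show "emeasure lborel A \<le> emeasure lborel (\<Union>n. A \<inter> {..<a n})" .
  qed
  ultimately show ?thesis using that[of a] ea by auto
qed

lemma emeasure_lborel_uminus:
  fixes A :: "real set"
  assumes [measurable]: "A \<in> sets borel"
  shows "emeasure lborel {x. - x \<in> A} = emeasure lborel A"
proof -
  have "emeasure lborel A = emeasure (distr lborel borel uminus) A"
    by (simp add: lborel_distr_uminus)
  also have "\<dots> = emeasure lborel {x. - x \<in> A}"
    by (subst emeasure_distr) (auto simp: vimage_def)
  finally show ?thesis by simp
qed

lemma exhaust_from_right:
  fixes B :: "real set"
  assumes [measurable]: "B \<in> sets borel" and ne: "B \<noteq> {}"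
  obtains b where "\<And>n::nat. b n \<in> B"
    "(\<lambda>n. emeasure lborel (B \<inter> {b n<..})) \<longlonglongrightarrow> emeasure lborel B"
proof -
  let ?A = "{x. - x \<in> B}"
  have "?A \<noteq> {}" using ne by (metis (mono_tags, lifting) empty_iff equals0I mem_Collect_eq minus_minus)
  then obtain a where a: "\<And>n::nat. a n \<in> ?A"
    "(\<lambda>n. emeasure lborel (?A \<inter> {..<a n})) \<longlonglongrightarrow> emeasure lborel ?A"
    by (rule exhaust_from_left[of ?A, rotated]) auto
  have "emeasure lborel (?A \<inter> {..<a n}) = emeasure lborel (B \<inter> {- a n<..})" for n
  proof -
    have "?A \<inter> {..<a n} = {x. - x \<in> B \<inter> {- a n<..}}" by auto
    then show ?thesis using emeasure_lborel_uminus[of "B \<inter> {- a n<..}"] by simp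
  qed
  then show ?thesis using that[of "\<lambda>n. - a n"] a emeasure_lborel_uminus[of B] by auto
qed

lemma emeasure_lborel_double:
  fixes A :: "real set"
  assumes [measurable]: "A \<in> sets borel"
  shows "emeasure lborel A = 2 * emeasure lborel {x. t + 2 * x \<in> A}"
proof -
  have "emeasure lborel A = (\<integral>\<^sup>+x. indicator A x \<partial>lborel)" by simp
  also have "\<dots> = 2 * (\<integral>\<^sup>+x. indicator A (t + 2 * x) \<partial>lborel)"
    by (subst nn_integral_real_affine[of _ 2 t]) auto
  also have "(\<integral>\<^sup>+x. indicator A (t + 2 * x) \<partial>lborel) = (\<integral>\<^sup>+x. indicator {x. t + 2 * x \<in> A} x \<partial>lborel)"
    by (intro nn_integral_cong) (auto simp: indicator_def)
  also have "\<dots> = emeasure lborel {x. t + 2 * x \<in> A}" by simp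
  finally show ?thesis .
qed

text \<open>For \<open>a \<in> A\<close> and \<open>b \<in> B\<close>, the midpoints of \<open>b\<close> with the points of \<open>A\<close> below \<open>a\<close> lie to the left of
\<open>(a + b) / 2\<close>, and the midpoints of \<open>a\<close> with the points of \<open>B\<close> above \<open>b\<close> lie to the right of it. These are
disjoint half-size copies of the two pieces inside \<open>C\<close>. Pushing \<open>a\<close> to the right and \<open>b\<close> to the left
exhausts \<open>A\<close> and \<open>B\<close>.\<close>
lemma midpoint_Brunn_Minkowski_real:
  fixes A B C :: "real set"
  assumes [measurable]: "A \<in> sets borel" "B \<in> sets borel" "C \<in> sets borel"
    and "A \<noteq> {}" "B \<noteq> {}" and mid: "\<And>s t. s \<in> A \<Longrightarrow> t \<in> B \<Longrightarrow> (s + t) / 2 \<in> C"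
  shows "emeasure lborel A + emeasure lborel B \<le> 2 * emeasure lborel C"
proof -
  obtain a where a: "\<And>n::nat. a n \<in> A"
    "(\<lambda>n. emeasure lborel (A \<inter> {..<a n})) \<longlonglongrightarrow> emeasure lborel A"
    by (rule exhaust_from_left[of A]) (use assms in auto)
  obtain b where b: "\<And>n::nat. b n \<in> B"
    "(\<lambda>n. emeasure lborel (B \<inter> {b n<..})) \<longlonglongrightarrow> emeasure lborel B"
    by (rule exhaust_from_right[of B]) (use assms in auto)
  have "emeasure lborel (A \<inter> {..<a n}) + emeasure lborel (B \<inter> {b n<..}) \<le> 2 * emeasure lborel C" for n
  proof -
    let ?X = "{x. - b n + 2 * x \<in> A \<inter> {..<a n}}" and ?Y = "{x. - a n + 2 * x \<in> B \<inter> {b n<..}}"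
    have XC: "?X \<subseteq> C"
    proof
      fix x assume "x \<in> ?X"
      then have "((- b n + 2 * x) + b n) / 2 \<in> C" using mid b by blast
      then show "x \<in> C" by simp
    qed
    have YC: "?Y \<subseteq> C"
    proof
      fix x assume "x \<in> ?Y"
      then have "(a n + (- a n + 2 * x)) / 2 \<in> C" using mid a by blast
      then show "x \<in> C" by simp
    qed
    have disj: "?X \<inter> ?Y = {}" by auto
    have "emeasure lborel (A \<inter> {..<a n}) + emeasure lborel (B \<inter> {b n<..}) = 2 * emeasure lborel ?X + 2 * emeasure lborel ?Y"
      using emeasure_lborel_double[of "A \<inter> {..<a n}" "- b n"] emeasure_lborel_double[of "B \<inter> {b n<..}" "- a n"] by simp
    also have "\<dots> = 2 * (emeasure lborel ?X + emeasure lborel ?Y)" by (simp add: distrib_left)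
    also have "\<dots> = 2 * emeasure lborel (?X \<union> ?Y)"
      using disj by (subst plus_emeasure) auto
    also have "\<dots> \<le> 2 * emeasure lborel C"
      using XC YC by (intro mult_left_mono emeasure_mono) auto
    finally show ?thesis .
  qed
  then show ?thesis
    by (intro LIMSEQ_le_const2[OF tendsto_add[OF a(2) b(2)]]) auto
qed

lemma nn_integral_layer_cake:
  fixes f :: "real \<Rightarrow> real"
  assumes [measurable]: "f \<in> borel_measurable borel" and nn: "\<And>x. 0 \<le> f x"
  shows "(\<integral>\<^sup>+x. f x \<partial>lborel) = (\<integral>\<^sup>+l. indicator {0<..} l * emeasure lborel {x. l < f x} \<partial>lborel)"
proof -
  have "(\<integral>\<^sup>+x. f x \<partial>lborel) = (\<integral>\<^sup>+x. (\<integral>\<^sup>+l. indicator {0<..} l * indicator {l. l < f x} l \<partial>lborel) \<partial>lborel)"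
  proof (intro nn_integral_cong)
    fix x
    have "ennreal (f x) = emeasure lborel {0<..<f x}" using nn[of x] by simp
    also have "\<dots> = (\<integral>\<^sup>+l. indicator {0<..<f x} l \<partial>lborel)" by simp
    also have "\<dots> = (\<integral>\<^sup>+l. indicator {0<..} l * indicator {l. l < f x} l \<partial>lborel)"
      by (intro nn_integral_cong) (auto simp: indicator_def)
    finally show "ennreal (f x) = (\<integral>\<^sup>+l. indicator {0<..} l * indicator {l. l < f x} l \<partial>lborel)" .
  qed
  also have "\<dots> = (\<integral>\<^sup>+x. (\<integral>\<^sup>+l. (indicator {0<..} l * indicator {p. snd p < f (fst p)} (x, l) :: ennreal) \<partial>lborel) \<partial>lborel)"
    by (intro nn_integral_cong) (auto simp: indicator_def)
  also have "\<dots> = (\<integral>\<^sup>+l. (\<integral>\<^sup>+x. (indicator {0<..} l * indicator {p. snd p < f (fst p)} (x, l) :: ennreal) \<partial>lborel) \<partial>lborel)"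
    by (rule lborel_pair.Fubini'[symmetric]) measurable
  also have "\<dots> = (\<integral>\<^sup>+l. (\<integral>\<^sup>+x. (indicator {0<..} l * indicator {x. l < f x} x :: ennreal) \<partial>lborel) \<partial>lborel)"
    by (intro nn_integral_cong) (auto simp: indicator_def)
  also have "\<dots> = (\<integral>\<^sup>+l. indicator {0<..} l * emeasure lborel {x. l < f x} \<partial>lborel)"
    by (intro nn_integral_cong) (simp add: nn_integral_cmult)
  finally show ?thesis .
qed

text \<open>When both suprema are \<open>1\<close>, the superlevel sets \<open>{f > l}\<close> and \<open>{g > l}\<close> are nonempty for exactly the same
levels \<open>0 < l < 1\<close>, and their midpoints lie in \<open>{h > l}\<close>. So the one-dimensional Brunn-Minkowski inequality
applies at each level, and integrating over \<open>l\<close> gives the claim.\<close>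
lemma Prekopa_Leindler_normalized:
  fixes f g h :: "real \<Rightarrow> real"
  assumes [measurable]: "f \<in> borel_measurable borel" "g \<in> borel_measurable borel" "h \<in> borel_measurable borel"
    and f: "\<And>x. 0 \<le> f x" "\<And>x. f x \<le> 1" "\<And>l. l < 1 \<Longrightarrow> \<exists>x. l < f x"
    and g: "\<And>x. 0 \<le> g x" "\<And>x. g x \<le> 1" "\<And>l. l < 1 \<Longrightarrow> \<exists>x. l < g x"
    and h: "\<And>x. 0 \<le> h x" and mid: "\<And>s t. f s * g t \<le> (h ((s + t) / 2))\<^sup>2"
  shows "(\<integral>\<^sup>+x. f x \<partial>lborel) + (\<integral>\<^sup>+x. g x \<partial>lborel) \<le> 2 * (\<integral>\<^sup>+x. h x \<partial>lborel)"
proof -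
  have mf: "(\<lambda>l. emeasure lborel {x. l < u x}) \<in> borel_measurable borel"
    if [measurable]: "u \<in> borel_measurable borel" for u :: "real \<Rightarrow> real"
  proof -
    have "(\<lambda>l. \<integral>\<^sup>+x. indicator {p. fst p < u (snd p)} (l, x) \<partial>lborel) \<in> borel_measurable borel"
      by measurable
    moreover have "(\<integral>\<^sup>+x. indicator {p. fst p < u (snd p)} (l, x) \<partial>lborel) = emeasure lborel {x. l < u x}" for l
    proof -
      have "(\<integral>\<^sup>+x. indicator {p. fst p < u (snd p)} (l, x) \<partial>lborel) = (\<integral>\<^sup>+x. indicator {x. l < u x} x \<partial>lborel)"
        by (intro nn_integral_cong) (simp add: indicator_def)
      then show ?thesis by simp
    qed
    ultimately show ?thesis by simp
  qed
  note [measurable] = mf[OF assms(1)] mf[OF assms(2)] mf[OF assms(3)]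
  have "(\<integral>\<^sup>+x. f x \<partial>lborel) + (\<integral>\<^sup>+x. g x \<partial>lborel)
     = (\<integral>\<^sup>+l. indicator {0<..} l * (emeasure lborel {x. l < f x} + emeasure lborel {x. l < g x}) \<partial>lborel)"
    using f g by (simp add: nn_integral_layer_cake distrib_left nn_integral_add)
  also have "\<dots> \<le> (\<integral>\<^sup>+l. 2 * (indicator {0<..} l * emeasure lborel {x. l < h x}) \<partial>lborel)"
  proof (rule nn_integral_mono)
    fix l :: real
    have "emeasure lborel {x. l < f x} + emeasure lborel {x. l < g x} \<le> 2 * emeasure lborel {x. l < h x}" if l: "0 < l"
    proof (cases "l < 1")
      case True
      show ?thesis
      proof (rule midpoint_Brunn_Minkowski_real)
        show "{x. l < f x} \<noteq> {}" "{x. l < g x} \<noteq> {}" using f(3) g(3) True by auto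
        fix s t assume "s \<in> {x. l < f x}" "t \<in> {x. l < g x}"
        then have "l * l < f s * g t" using l by (intro mult_strict_mono) auto
        also have "\<dots> \<le> (h ((s + t) / 2))\<^sup>2" by (rule mid)
        finally have "l\<^sup>2 < (h ((s + t) / 2))\<^sup>2" by (simp add: power2_eq_square)
        then show "(s + t) / 2 \<in> {x. l < h x}" using h by (auto intro: power_less_imp_less_base)
      qed auto
    next
      case False
      then have "{x. l < f x} = {}" "{x. l < g x} = {}" using f(2) g(2) by (smt (verit) Collect_empty_eq)+
      then show ?thesis by simp
    qed
    then show "indicator {0<..} l * (emeasure lborel {x. l < f x} + emeasure lborel {x. l < g x})
       \<le> 2 * (indicator {0<..} l * emeasure lborel {x. l < h x})"
      by (auto simp: indicator_def)
  qed
  also have "\<dots> = 2 * (\<integral>\<^sup>+x. h x \<partial>lborel)"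
    using h by (simp add: nn_integral_layer_cake nn_integral_cmult)
  finally show ?thesis .
qed

text \<open>Dividing \<open>f\<close> and \<open>g\<close> by their suprema \<open>a\<close> and \<open>c\<close>, and \<open>h\<close> by \<open>sqrt (a * c)\<close>, preserves the hypothesis
and makes the normalized inequality available; the arithmetic-geometric mean inequality then turns its sum
into a product in which \<open>a\<close> and \<open>c\<close> cancel.\<close>
lemma Prekopa_Leindler_bounded:
  fixes f g h :: "real \<Rightarrow> real"
  assumes [measurable]: "f \<in> borel_measurable borel" "g \<in> borel_measurable borel" "h \<in> borel_measurable borel"
    and f: "\<And>x. 0 \<le> f x" "\<And>x. f x \<le> C" and g: "\<And>x. 0 \<le> g x" "\<And>x. g x \<le> C"
    and h: "\<And>x. 0 \<le> h x" and mid: "\<And>s t. f s * g t \<le> (h ((s + t) / 2))\<^sup>2"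
  shows "(\<integral>\<^sup>+x. f x \<partial>lborel) * (\<integral>\<^sup>+x. g x \<partial>lborel) \<le> (\<integral>\<^sup>+x. h x \<partial>lborel)\<^sup>2"
proof (cases "(\<forall>x. f x = 0) \<or> (\<forall>x. g x = 0)")
  case True
  then show ?thesis by auto
next
  case False
  define a where "a = Sup (range f)"
  define c where "c = Sup (range g)"
  have bf: "bdd_above (range f)" and bg: "bdd_above (range g)" using f g by (auto intro!: bdd_aboveI)
  have fa: "f x \<le> a" for x unfolding a_def by (rule cSUP_upper[OF _ bf]) auto
  have gc: "g x \<le> c" for x unfolding c_def by (rule cSUP_upper[OF _ bg]) auto
  have a: "a > 0" and c: "c > 0" using False f(1) g(1) fa gc by (metis dual_order.strict_trans1 order_le_less)+
  define X where "X = (\<integral>\<^sup>+x. f x \<partial>lborel)"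
  define Y where "Y = (\<integral>\<^sup>+x. g x \<partial>lborel)"
  define Z where "Z = (\<integral>\<^sup>+x. h x \<partial>lborel)"
  have sc: "(\<integral>\<^sup>+x. ennreal (u x / k) \<partial>lborel) = ennreal (1/k) * (\<integral>\<^sup>+x. u x \<partial>lborel)"
    if [measurable]: "u \<in> borel_measurable borel" and "k > 0" for u :: "real \<Rightarrow> real" and k
    using that by (subst nn_integral_cmult[symmetric]) (auto simp: ennreal_mult'[symmetric] intro!: nn_integral_cong)
  have main: "(\<integral>\<^sup>+x. f x / a \<partial>lborel) + (\<integral>\<^sup>+x. g x / c \<partial>lborel) \<le> 2 * (\<integral>\<^sup>+x. h x / sqrt (a * c) \<partial>lborel)"
  proof (rule Prekopa_Leindler_normalized)
    fix l :: real assume l: "l < 1"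
    have "l * a < a" using l a by auto
    then obtain x where "l * a < f x" using less_cSUP_iff[of UNIV f "l * a"] bf unfolding a_def by auto
    then show "\<exists>x. l < f x / a" using a by (auto simp: field_simps)
    have "l * c < c" using l c by auto
    then obtain x where "l * c < g x" using less_cSUP_iff[of UNIV g "l * c"] bg unfolding c_def by auto
    then show "\<exists>x. l < g x / c" using c by (auto simp: field_simps)
  next
    fix s t
    show "f s / a * (g t / c) \<le> (h ((s + t) / 2) / sqrt (a * c))\<^sup>2"
      using mid[of s t] a c by (simp add: power_divide divide_right_mono)
  qed (use f g h fa gc a c in auto)
  show ?thesis
  proof (cases "Z = \<infinity>")
    case True then show ?thesis by (simp add: Z_def[symmetric])
  next
    case False
    have main': "ennreal (1/a) * X + ennreal (1/c) * Y \<le> 2 * (ennreal (1 / sqrt (a*c)) * Z)"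
      using main a c by (simp add: sc X_def Y_def Z_def)
    have fin: "2 * (ennreal (1 / sqrt (a*c)) * Z) < \<infinity>" using False by (auto simp: ennreal_mult_less_top less_top)
    obtain z where z: "Z = ennreal z" "0 \<le> z" using False by (cases Z) auto
    have "ennreal (1/a) * X < \<infinity>" "ennreal (1/c) * Y < \<infinity>" using main' fin
      by (metis add_top_left_ennreal add.commute infinity_ennreal_def less_top linorder_not_le)+
    then have "X < \<infinity>" "Y < \<infinity>" using a c by (auto simp: ennreal_mult_less_top ennreal_eq_0_iff)
    then obtain x y where x: "X = ennreal x" "0 \<le> x" and y: "Y = ennreal y" "0 \<le> y"
      by (metis less_top_ennreal infinity_ennreal_def)
    have "ennreal (x / a + y / c) \<le> ennreal (2 * (z / sqrt (a * c)))"
      using main' x y z a c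
      by (simp add: ennreal_mult'[symmetric] ennreal_plus[symmetric] ennreal_numeral[symmetric] del: ennreal_numeral ennreal_plus)
    then have r: "x / a + y / c \<le> 2 * (z / sqrt (a * c))" using z a c by (simp add: ennreal_le_iff)
    have amgm: "4 * p * q \<le> (p + q)\<^sup>2" for p q :: real
      using zero_le_power2[of "p - q"] by (simp add: power2_eq_square algebra_simps)
    have "4 * (x / a) * (y / c) \<le> (x / a + y / c)\<^sup>2" by (rule amgm)
    also have "\<dots> \<le> (2 * (z / sqrt (a * c)))\<^sup>2" using r x y a c by (intro power_mono) auto
    also have "\<dots> = 4 * (z\<^sup>2 / (a * c))" using a c by (simp add: power_divide power_mult_distrib)
    finally have "x * y \<le> z\<^sup>2" using a c by (simp add: field_simps)
    then show ?thesis unfolding X_def[symmetric] Y_def[symmetric] Z_def[symmetric] x(1) y(1) z(1)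
      using x y z by (simp add: ennreal_mult'[symmetric] ennreal_power)
  qed
qed

text \<open>Cutting all three functions off at the same height \<open>n\<close> preserves the hypothesis, so this follows from the
bounded case by monotone convergence.\<close>
lemma Prekopa_Leindler_midpoint:
  fixes f g h :: "real \<Rightarrow> ennreal"
  assumes [measurable]: "f \<in> borel_measurable borel" "g \<in> borel_measurable borel" "h \<in> borel_measurable borel"
    and mid: "\<And>s t. f s * g t \<le> (h ((s + t) / 2))\<^sup>2"
  shows "(\<integral>\<^sup>+x. f x \<partial>lborel) * (\<integral>\<^sup>+x. g x \<partial>lborel) \<le> (\<integral>\<^sup>+x. h x \<partial>lborel)\<^sup>2"
proof (cases "(\<integral>\<^sup>+x. f x \<partial>lborel) = 0 \<or> (\<integral>\<^sup>+x. g x \<partial>lborel) = 0")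
  case True
  then show ?thesis by auto
next
  case False
  define cut where "cut = (\<lambda>(u::real\<Rightarrow>ennreal) (n::nat) x. min (u x) (of_nat n))"
  have mcut[measurable]: "cut u n \<in> borel_measurable borel" if [measurable]: "u \<in> borel_measurable borel" for u n
    unfolding cut_def by measurable
  have cut_real: "cut u n x = ennreal (enn2real (cut u n x))" for u n x
  proof -
    have "cut u n x \<le> of_nat n" by (simp add: cut_def)
    also have "\<dots> < top" by (simp add: of_nat_less_top)
    finally show ?thesis by (simp add: ennreal_enn2real less_top)
  qed
  have cut_le: "enn2real (cut u n x) \<le> real n" for u n x
    unfolding cut_def by (metis cut_def cut_real enn2real_leI ennreal_of_nat_eq_real_of_nat min.cobounded2 of_nat_0_le_iff)
  have lim: "(\<lambda>n. \<integral>\<^sup>+x. cut u n x \<partial>lborel) \<longlonglongrightarrow> (\<integral>\<^sup>+x. u x \<partial>lborel)"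
    if [measurable]: "u \<in> borel_measurable borel" for u
  proof (rule nn_integral_LIMSEQ)
    show "incseq (cut u)" unfolding incseq_def cut_def le_fun_def
      by (metis ennreal_leI ennreal_of_nat_eq_real_of_nat min.mono of_nat_mono order_refl)
    show "(\<lambda>n. cut u n x) \<longlonglongrightarrow> u x" for x
    proof -
      have "(\<lambda>n. min (u x) (of_nat n)) \<longlonglongrightarrow> min (u x) top"
        by (intro tendsto_min tendsto_const of_nat_tendsto_top_ennreal)
      then show ?thesis by (simp add: cut_def min_def)
    qed
  qed measurable
  have fin: "(\<integral>\<^sup>+x. cut f n x \<partial>lborel) * (\<integral>\<^sup>+x. cut g n x \<partial>lborel) \<le> (\<integral>\<^sup>+x. h x \<partial>lborel)\<^sup>2" for n
  proof -
    have "(\<integral>\<^sup>+x. enn2real (cut f n x) \<partial>lborel) * (\<integral>\<^sup>+x. enn2real (cut g n x) \<partial>lborel) \<le> (\<integral>\<^sup>+x. enn2real (cut h n x) \<partial>lborel)\<^sup>2"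
    proof (rule Prekopa_Leindler_bounded[where C = "real n"])
      fix s t
      have "cut f n s * cut g n t \<le> (cut h n ((s + t) / 2))\<^sup>2"
      proof (cases "h ((s + t) / 2) \<le> of_nat n")
        case True
        have "cut f n s * cut g n t \<le> f s * g t" unfolding cut_def by (intro mult_mono) auto
        also have "\<dots> \<le> (h ((s + t) / 2))\<^sup>2" by (rule mid)
        finally show ?thesis using True by (simp add: cut_def)
      next
        case False
        have "cut f n s * cut g n t \<le> of_nat n * of_nat n" unfolding cut_def by (intro mult_mono) auto
        then show ?thesis using False by (simp add: cut_def power2_eq_square min_absorb2)
      qed
      then have "ennreal (enn2real (cut f n s)) * ennreal (enn2real (cut g n t)) \<le> (ennreal (enn2real (cut h n ((s + t) / 2))))\<^sup>2"
        by (simp only: cut_real[symmetric])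
      then show "enn2real (cut f n s) * enn2real (cut g n t) \<le> (enn2real (cut h n ((s + t) / 2)))\<^sup>2"
        by (simp add: ennreal_mult'[symmetric] ennreal_power)
    qed (use cut_le in auto)
    then have "(\<integral>\<^sup>+x. cut f n x \<partial>lborel) * (\<integral>\<^sup>+x. cut g n x \<partial>lborel) \<le> (\<integral>\<^sup>+x. cut h n x \<partial>lborel)\<^sup>2"
      by (simp only: cut_real[symmetric])
    also have "\<dots> \<le> (\<integral>\<^sup>+x. h x \<partial>lborel)\<^sup>2"
      by (intro power_mono nn_integral_mono) (auto simp: cut_def)
    finally show ?thesis .
  qed
  have "(\<lambda>n. (\<integral>\<^sup>+x. cut f n x \<partial>lborel) * (\<integral>\<^sup>+x. cut g n x \<partial>lborel)) \<longlonglongrightarrow> (\<integral>\<^sup>+x. f x \<partial>lborel) * (\<integral>\<^sup>+x. g x \<partial>lborel)"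
    using False by (intro tendsto_mult_ennreal lim) auto
  then show ?thesis using fin by (intro LIMSEQ_le_const2) auto
qed

lemma ennreal_power2_leD:
  fixes x y :: ennreal
  assumes "x\<^sup>2 \<le> y\<^sup>2" shows "x \<le> y"
  using assms by (cases x; cases y) (auto simp: ennreal_power top_unique power_eq_top_ennreal)

text \<open>For an orthonormal set \<open>B\<close> this is the volume of the section of \<open>K\<close> by the affine subspace \<open>w + span B\<close>.
The integral over coordinates, rather than over the subspace, allows induction on \<open>B\<close>.\<close>
definition fiber_volume :: "'e::euclidean_space set \<Rightarrow> 'e set \<Rightarrow> 'e \<Rightarrow> ennreal" where
  "fiber_volume B K w = (\<integral>\<^sup>+t. indicator K (w + (\<Sum>b\<in>B. t b *\<^sub>R b)) \<partial>(\<Pi>\<^sub>M b\<in>B. lborel))"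

lemma fiber_measurable:
  fixes K :: "'e::euclidean_space set"
  assumes "finite B" and [measurable]: "K \<in> sets borel"
  shows "(\<lambda>(w, t). indicator K (w + (\<Sum>b\<in>B. t b *\<^sub>R b)) :: ennreal) \<in> borel_measurable (borel \<Otimes>\<^sub>M (\<Pi>\<^sub>M b\<in>B. lborel))"
  by measurable

lemma fiber_volume_measurable:
  fixes K :: "'e::euclidean_space set"
  assumes "finite B" and K[measurable]: "K \<in> sets borel"
  shows "fiber_volume B K \<in> borel_measurable borel"
proof -
  interpret product_sigma_finite "\<lambda>_. lborel :: real measure" by standard
  interpret sigma_finite_measure "\<Pi>\<^sub>M b\<in>B. (lborel :: real measure)" by (rule sigma_finite[OF assms(1)])
  have "(\<lambda>w. \<integral>\<^sup>+t. indicator K (w + (\<Sum>b\<in>B. t b *\<^sub>R b)) \<partial>(\<Pi>\<^sub>M b\<in>B. lborel)) \<in> borel_measurable borel"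
    by (rule borel_measurable_nn_integral[OF fiber_measurable[OF assms]])
  then show ?thesis by (simp add: fiber_volume_def[abs_def])
qed

lemma fiber_volume_insert:
  fixes K :: "'e::euclidean_space set"
  assumes fin: "finite B" and b: "b \<notin> B" and K[measurable]: "K \<in> sets borel"
  shows "fiber_volume (insert b B) K w = (\<integral>\<^sup>+s. fiber_volume B K (w + s *\<^sub>R b) \<partial>lborel)"
proof -
  interpret product_sigma_finite "\<lambda>_. lborel :: real measure" by standard
  have m: "(\<lambda>t. indicator K (w + (\<Sum>b\<in>insert b B. t b *\<^sub>R b)) :: ennreal) \<in> borel_measurable (\<Pi>\<^sub>M b\<in>insert b B. lborel)"
    by measurable
  have s: "(\<Sum>x\<in>B. (if x = b then s else t x) *\<^sub>R x) = (\<Sum>x\<in>B. t x *\<^sub>R x)" for s and t :: "'e \<Rightarrow> real"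
    using b by (intro sum.cong) auto
  show ?thesis
    unfolding fiber_volume_def
    by (subst product_nn_integral_insert_rev[OF fin b m])
       (use fin b in \<open>simp add: fun_upd_def s add.assoc\<close>)
qed

text \<open>Integration along one more direction preserves the inequality, by the Prekopa-Leindler inequality; for
\<open>B = {}\<close> it is convexity of \<open>K\<close>.\<close>
lemma fiber_volume_midpoint:
  fixes K :: "'e::euclidean_space set"
  assumes "finite B" and K[measurable]: "K \<in> sets borel" and conv: "convex K"
  shows "fiber_volume B K x * fiber_volume B K y \<le> (fiber_volume B K ((1/2) *\<^sub>R (x + y)))\<^sup>2"
  using assms(1)
proof (induction B arbitrary: x y rule: finite_induct)
  case empty
  have "(1/2) *\<^sub>R (x + y) \<in> K" if "x \<in> K" "y \<in> K"
    using convexD[OF conv that, of "1/2" "1/2"] by (simp add: scaleR_add_right)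
  then show ?case
    by (auto simp: fiber_volume_def indicator_def PiM_empty nn_integral_count_space_finite)
next
  case (insert b B)
  note fm[measurable] = fiber_volume_measurable[OF insert.hyps(1) K]
  have "fiber_volume B K (x + s *\<^sub>R b) * fiber_volume B K (y + t *\<^sub>R b)
     \<le> (fiber_volume B K ((1/2) *\<^sub>R (x + y) + ((s + t) / 2) *\<^sub>R b))\<^sup>2" for s t
    using insert.IH[of "x + s *\<^sub>R b" "y + t *\<^sub>R b"] by (simp add: algebra_simps add_divide_distrib)
  then show ?case
    unfolding fiber_volume_insert[OF insert.hyps K]
    by (intro Prekopa_Leindler_midpoint) auto
qed

lemma nn_integral_lborel_reflect:
  fixes f :: "real \<Rightarrow> ennreal"
  assumes [measurable]: "f \<in> borel_measurable borel"
  shows "(\<integral>\<^sup>+s. f (- s) \<partial>lborel) = (\<integral>\<^sup>+s. f s \<partial>lborel)"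
  using nn_integral_real_affine[of f "-1" 0] by simp

lemma fiber_volume_even:
  fixes K :: "'e::euclidean_space set"
  assumes "finite B" and K[measurable]: "K \<in> sets borel" and sym: "\<And>x. x \<in> K \<Longrightarrow> - x \<in> K"
  shows "fiber_volume B K (- w) = fiber_volume B K w"
  using assms(1)
proof (induction B arbitrary: w rule: finite_induct)
  case empty
  have "- w \<in> K \<longleftrightarrow> w \<in> K" using sym[of w] sym[of "- w"] by auto
  then show ?case by (simp add: fiber_volume_def indicator_def)
next
  case (insert b B)
  note fm[measurable] = fiber_volume_measurable[OF insert.hyps(1) K]
  have "fiber_volume (insert b B) K (- w) = (\<integral>\<^sup>+s. fiber_volume B K (- (w + (- s) *\<^sub>R b)) \<partial>lborel)"
    unfolding fiber_volume_insert[OF insert.hyps K] by (simp add: algebra_simps)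
  also have "\<dots> = (\<integral>\<^sup>+s. fiber_volume B K (w + (- s) *\<^sub>R b) \<partial>lborel)"
    by (simp only: insert.IH)
  also have "\<dots> = fiber_volume (insert b B) K w"
    unfolding fiber_volume_insert[OF insert.hyps K]
    by (rule nn_integral_lborel_reflect[where f = "\<lambda>s. fiber_volume B K (w + s *\<^sub>R b)"]) measurable
  finally show ?case .
qed

text \<open>Brunn's theorem for symmetric bodies: the points \<open>w\<close> and \<open>- w\<close> have sections of equal volume and
midpoint \<open>0\<close>.\<close>
lemma fiber_volume_central_max:
  fixes K :: "'e::euclidean_space set"
  assumes "finite B" and "K \<in> sets borel" and "convex K" and "\<And>x. x \<in> K \<Longrightarrow> - x \<in> K"
  shows "fiber_volume B K w \<le> fiber_volume B K 0"
proof -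
  have "(fiber_volume B K w)\<^sup>2 = fiber_volume B K w * fiber_volume B K (- w)"
    using fiber_volume_even[of B K w] assms by (simp add: power2_eq_square)
  also have "\<dots> \<le> (fiber_volume B K 0)\<^sup>2"
    using fiber_volume_midpoint[of B K w "- w"] assms by simp
  finally show ?thesis by (rule ennreal_power2_leD)
qed

text \<open>Monotonicity of the section volume along a ray, in the form suited to Gaussians: \<open>w / 2\<close> is the midpoint of
\<open>w\<close> and \<open>0\<close>, and \<open>0\<close> has the larger section.\<close>
lemma fiber_volume_halfway:
  fixes K :: "'e::euclidean_space set"
  assumes "finite B" and "K \<in> sets borel" and "convex K" and "\<And>x. x \<in> K \<Longrightarrow> - x \<in> K"
  shows "fiber_volume B K w \<le> fiber_volume B K ((1/2) *\<^sub>R w)"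
proof -
  have "(fiber_volume B K w)\<^sup>2 \<le> fiber_volume B K w * fiber_volume B K 0"
    using fiber_volume_central_max[of B K w] assms by (simp add: power2_eq_square mult_left_mono)
  also have "\<dots> \<le> (fiber_volume B K ((1/2) *\<^sub>R w))\<^sup>2"
    using fiber_volume_midpoint[of B K w 0] assms by simp
  finally show ?thesis by (rule ennreal_power2_leD)
qed

section \<open>Lebesgue measure in orthonormal coordinates\<close>

lemma linear_continuous:
  fixes T :: "'a::euclidean_space \<Rightarrow> 'b::euclidean_space"
  assumes "linear T"
  shows "continuous_on X T" and "T \<in> borel_measurable borel"
proof -
  show *: "continuous_on X T" for X
    using assms by (simp add: linear_continuous_on linear_conv_bounded_linear)
  show "T \<in> borel_measurable borel" by (rule borel_measurable_continuous_onI[OF *])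
qed

lemma nn_integral_lborel_translate:
  fixes f :: "'a::euclidean_space \<Rightarrow> ennreal"
  assumes [measurable]: "f \<in> borel_measurable borel"
  shows "(\<integral>\<^sup>+x. f (x + c) \<partial>lborel) = (\<integral>\<^sup>+x. f x \<partial>lborel)"
proof -
  have "(\<integral>\<^sup>+x. f x \<partial>lborel) = (\<integral>\<^sup>+x. f x \<partial>distr lborel borel ((+) c))"
    by (simp add: lborel_distr_plus)
  also have "\<dots> = (\<integral>\<^sup>+x. f (x + c) \<partial>lborel)"
    by (subst nn_integral_distr) (auto simp: add.commute)
  finally show ?thesis by simp
qed

text \<open>The image measure is invariant under translations, and it agrees with Lebesgue measure on the unit ball
\<open>B\<close>. Uniqueness of such a measure is shown by the usual computation: the double integral of
\<open>indicator A (T x) * indicator B y\<close> is transformed by \<open>y \<mapsto> y - T x\<close> and then by \<open>T x \<mapsto> T x + y\<close>, which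
exchanges the roles of the two measures.\<close>
lemma lborel_linear_isometry:
  fixes T :: "'a::euclidean_space \<Rightarrow> 'b::euclidean_space"
  assumes lin: "linear T" and iso: "\<And>x. norm (T x) = norm x" and dim: "DIM('a) = DIM('b)"
  shows "distr lborel borel T = lborel"
proof (rule measure_eqI)
  have cont: "continuous_on UNIV T" using lin by (rule linear_continuous)
  then have [measurable]: "T \<in> borel_measurable borel" by (rule borel_measurable_continuous_onI)
  have "inj T" using lin iso by (simp add: linear_injective_0) (metis norm_eq_zero)
  then have "dim (range T) = DIM('b)"
    using dim_image_eq[OF lin, of UNIV] dim by simp
  moreover have "span (range T) = range T"
    using linear_subspace_image[OF lin subspace_UNIV] by (simp add: span_eq_iff)
  ultimately have surj: "surj T" by (simp add: dim_eq_full)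
  fix A assume "A \<in> sets (distr lborel borel T)"
  then have A[measurable]: "A \<in> sets borel" by simp
  define B where "B = (ball 0 1 :: 'b set)"
  have B[measurable]: "B \<in> sets borel" by (simp add: B_def)
  have Bsym: "- x \<in> B \<longleftrightarrow> x \<in> B" for x by (simp add: B_def)
  have TB: "T x \<in> B \<longleftrightarrow> x \<in> ball 0 1" for x by (simp add: B_def iso)
  have mB: "emeasure lborel (ball 0 1 :: 'a set) = emeasure lborel B"
    unfolding B_def by (simp add: emeasure_ball dim)
  have B0: "emeasure lborel B \<noteq> 0" "emeasure lborel B \<noteq> \<infinity>"
  proof -
    have "unit_ball_vol (real DIM('b)) > 0" by (intro unit_ball_vol_pos) simp
    then have nz: "unit_ball_vol (real DIM('b)) \<noteq> 0" by (metis less_irrefl)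
    show "emeasure lborel B \<noteq> 0" "emeasure lborel B \<noteq> \<infinity>"
      unfolding B_def using nz by (simp_all add: emeasure_ball ennreal_eq_0_iff not_le order_less_le)
  qed
  have dA: "emeasure (distr lborel borel T) A = (\<integral>\<^sup>+x. indicator A (T x) \<partial>lborel)"
  proof -
    have "emeasure (distr lborel borel T) A = (\<integral>\<^sup>+x. indicator A x \<partial>distr lborel borel T)" by simp
    then show ?thesis by (subst (asm) nn_integral_distr) auto
  qed
  have "(\<integral>\<^sup>+x. indicator A (T x) \<partial>lborel) * emeasure lborel B
      = (\<integral>\<^sup>+x. (\<integral>\<^sup>+y. indicator A (T x) * indicator B y \<partial>lborel) \<partial>lborel)"
    by (simp add: nn_integral_cmult nn_integral_multc)
  also have "\<dots> = (\<integral>\<^sup>+x. (\<integral>\<^sup>+y. indicator A (T x) * indicator B (y + (- T x)) \<partial>lborel) \<partial>lborel)"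
  proof (rule nn_integral_cong)
    fix x
    show "(\<integral>\<^sup>+y. indicator A (T x) * indicator B y \<partial>lborel) = (\<integral>\<^sup>+y. indicator A (T x) * indicator B (y + (- T x)) \<partial>lborel)"
      by (rule nn_integral_lborel_translate[where f = "\<lambda>y. indicator A (T x) * indicator B y" and c = "- T x", symmetric]) measurable
  qed
  also have "\<dots> = (\<integral>\<^sup>+y. (\<integral>\<^sup>+x. indicator A (T x) * indicator B (y + (- T x)) \<partial>lborel) \<partial>lborel)"
    by (rule lborel_pair.Fubini') measurable
  also have "\<dots> = (\<integral>\<^sup>+y. (\<integral>\<^sup>+x. indicator A (T x + y) * indicator B (T x) \<partial>lborel) \<partial>lborel)"
  proof (rule nn_integral_cong)
    fix y :: 'b
    obtain z where z: "T z = y" using surj by (metis surj_def)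
    have "(\<integral>\<^sup>+x. indicator A (T x) * indicator B (y + (- T x)) \<partial>lborel)
       = (\<integral>\<^sup>+x. indicator A (T (x + z)) * indicator B (y + (- T (x + z))) \<partial>lborel)"
      by (rule nn_integral_lborel_translate[symmetric]) measurable
    also have "\<dots> = (\<integral>\<^sup>+x. indicator A (T x + y) * indicator B (T x) \<partial>lborel)"
      using lin z Bsym by (simp add: linear_add indicator_def)
    finally show "(\<integral>\<^sup>+x. indicator A (T x) * indicator B (y + (- T x)) \<partial>lborel)
       = (\<integral>\<^sup>+x. indicator A (T x + y) * indicator B (T x) \<partial>lborel)" .
  qed
  also have "\<dots> = (\<integral>\<^sup>+x. (\<integral>\<^sup>+y. indicator A (T x + y) * indicator B (T x) \<partial>lborel) \<partial>lborel)"
    by (rule lborel_pair.Fubini') measurable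
  also have "\<dots> = (\<integral>\<^sup>+x. (\<integral>\<^sup>+y. indicator A y \<partial>lborel) * indicator B (T x) \<partial>lborel)"
  proof (rule nn_integral_cong)
    fix x
    show "(\<integral>\<^sup>+y. indicator A (T x + y) * indicator B (T x) \<partial>lborel) = (\<integral>\<^sup>+y. indicator A y \<partial>lborel) * indicator B (T x)"
      using nn_integral_lborel_translate[of "indicator A" "T x"]
      by (subst nn_integral_multc) (simp_all add: add.commute)
  qed
  also have "\<dots> = emeasure lborel A * (\<integral>\<^sup>+x. indicator (ball 0 1 :: 'a set) x \<partial>lborel)"
  proof -
    have "indicator B (T x) = (indicator (ball 0 1) x :: ennreal)" for x
      using TB[of x] by (simp add: indicator_def)
    then show ?thesis by (simp add: nn_integral_cmult_indicator)
  qed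
  also have "\<dots> = emeasure lborel A * emeasure lborel B" by (simp add: mB)
  finally show "emeasure (distr lborel borel T) A = emeasure lborel A"
    unfolding dA using B0 by (metis ennreal_mult_cancel_left mult.commute infinity_ennreal_def)
qed simp

lemma nn_integral_linear_isometry:
  fixes T :: "'a::euclidean_space \<Rightarrow> 'b::euclidean_space"
  assumes "linear T" and "\<And>x. norm (T x) = norm x" and "DIM('a) = DIM('b)"
    and [measurable]: "f \<in> borel_measurable borel"
  shows "(\<integral>\<^sup>+x. f x \<partial>lborel) = (\<integral>\<^sup>+x. f (T x) \<partial>lborel)"
proof -
  have [measurable]: "T \<in> borel_measurable borel"
    using assms(1) by (rule linear_continuous)
  have "(\<integral>\<^sup>+x. f x \<partial>lborel) = (\<integral>\<^sup>+x. f x \<partial>distr lborel borel T)"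
    by (simp add: lborel_linear_isometry assms)
  also have "\<dots> = (\<integral>\<^sup>+x. f (T x) \<partial>lborel)" by (subst nn_integral_distr) auto
  finally show ?thesis .
qed

lemma integral_linear_isometry:
  fixes T :: "'a::euclidean_space \<Rightarrow> 'b::euclidean_space" and f :: "'b \<Rightarrow> real"
  assumes "linear T" and "\<And>x. norm (T x) = norm x" and "DIM('a) = DIM('b)"
    and [measurable]: "f \<in> borel_measurable borel"
  shows "(\<integral>x. f x \<partial>lborel) = (\<integral>x. f (T x) \<partial>lborel)"
proof -
  have [measurable]: "T \<in> borel_measurable borel"
    using assms(1) by (rule linear_continuous)
  have "(\<integral>x. f x \<partial>lborel) = (\<integral>x. f x \<partial>distr lborel borel T)"
    by (simp add: lborel_linear_isometry assms)
  also have "\<dots> = (\<integral>x. f (T x) \<partial>lborel)" by (subst integral_distr) auto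
  finally show ?thesis .
qed

text \<open>Lebesgue measure on the coordinates with respect to \<open>B\<close> is carried by the type \<open>'c\<close>. This trades product
measures over a chosen basis for \<open>lborel\<close> on a concrete Euclidean space of the same dimension.\<close>
lemma PiM_lborel_eq_distr:
  fixes \<beta> :: "'c::euclidean_space \<Rightarrow> 'i"
  assumes \<beta>: "bij_betw \<beta> Basis B"
  shows "(\<Pi>\<^sub>M b\<in>B. (lborel :: real measure)) = distr lborel (\<Pi>\<^sub>M b\<in>B. lborel) (\<lambda>x. \<lambda>c\<in>B. x \<bullet> inv_into Basis \<beta> c)"
proof -
  interpret product_sigma_finite "\<lambda>_. lborel :: real measure" by standard
  have fin: "finite B" using bij_betw_finite[OF \<beta>] by simp
  let ?g = "inv_into Basis \<beta>"
  have g: "?g c \<in> Basis" if "c \<in> B" for c using \<beta> that by (metis bij_betw_imp_surj_on inv_into_into)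
  have m[measurable]: "(\<lambda>x. \<lambda>c\<in>B. x \<bullet> ?g c) \<in> lborel \<rightarrow>\<^sub>M (\<Pi>\<^sub>M b\<in>B. (lborel :: real measure))"
    by (rule measurable_restrict) simp
  have "distr lborel (\<Pi>\<^sub>M b\<in>B. lborel) (\<lambda>x. \<lambda>c\<in>B. x \<bullet> ?g c) = (\<Pi>\<^sub>M b\<in>B. (lborel :: real measure))"
  proof (rule PiM_eqI[OF fin])
    fix A assume A: "\<And>i. i \<in> B \<Longrightarrow> A i \<in> sets (lborel :: real measure)"
    then have A'[measurable]: "\<And>i. i \<in> B \<Longrightarrow> A i \<in> sets borel" by simp
    have A2: "b \<in> Basis \<Longrightarrow> A (\<beta> b) \<in> sets borel" for b using \<beta> A' by (auto dest: bij_betwE)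
    have "emeasure (distr lborel (\<Pi>\<^sub>M b\<in>B. lborel) (\<lambda>x. \<lambda>c\<in>B. x \<bullet> ?g c)) (Pi\<^sub>E B A)
       = emeasure lborel ((\<lambda>x. \<lambda>c\<in>B. x \<bullet> ?g c) -` (Pi\<^sub>E B A) \<inter> space lborel)"
      using A fin by (intro emeasure_distr m sets_PiM_I_finite) auto
    also have "(\<lambda>x. \<lambda>c\<in>B. x \<bullet> ?g c) -` (Pi\<^sub>E B A) \<inter> space lborel = {x. \<forall>b\<in>Basis. x \<bullet> b \<in> A (\<beta> b)}"
    proof -
      have "(\<forall>c\<in>B. x \<bullet> ?g c \<in> A c) \<longleftrightarrow> (\<forall>b\<in>Basis. x \<bullet> b \<in> A (\<beta> b))"
        for x unfolding bij_betw_imp_surj_on[OF \<beta>, symmetric]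
        by (simp add: bij_betw_inv_into_left[OF \<beta>])
      then show ?thesis by (auto simp: PiE_iff)
    qed
    also have "emeasure lborel \<dots> = (\<integral>\<^sup>+x. (\<Prod>b\<in>Basis. indicator (A (\<beta> b)) (x \<bullet> b)) \<partial>lborel)"
    proof -
      have eq: "(\<Prod>b\<in>Basis. indicator (A (\<beta> b)) (x \<bullet> b) :: ennreal) = indicator {x. \<forall>b\<in>Basis. x \<bullet> b \<in> A (\<beta> b)} x" for x
        by (auto simp: indicator_def intro!: prod.neutral)
      have "{x. \<forall>b\<in>Basis. x \<bullet> b \<in> A (\<beta> b)} = (\<Inter>b\<in>Basis. (\<lambda>x. x \<bullet> b) -` A (\<beta> b) \<inter> space borel)" by auto
      also have "\<dots> \<in> sets (borel :: 'c measure)"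
        by (intro sets.finite_INT measurable_sets[where A="borel"]) (use A2 in auto)
      finally show ?thesis unfolding eq by simp
    qed
    also have "\<dots> = (\<Prod>b\<in>Basis. \<integral>\<^sup>+x. indicator (A (\<beta> b)) x \<partial>lborel)"
      by (rule nn_integral_lborel_prod) (use A2 in auto)
    also have "\<dots> = (\<Prod>b\<in>Basis. emeasure lborel (A (\<beta> b)))" using A2 by (intro prod.cong) auto
    also have "\<dots> = (\<Prod>c\<in>B. emeasure lborel (A c))"
      by (rule prod.reindex_bij_betw[OF \<beta>])
    finally show "emeasure (distr lborel (\<Pi>\<^sub>M b\<in>B. lborel) (\<lambda>x. \<lambda>c\<in>B. x \<bullet> ?g c)) (Pi\<^sub>E B A) = (\<Prod>c\<in>B. emeasure lborel (A c))" .
  qed simp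
  then show ?thesis by simp
qed

lemma nn_integral_PiM_lborel:
  fixes \<beta> :: "'c::euclidean_space \<Rightarrow> 'e::euclidean_space"
  assumes \<beta>: "bij_betw \<beta> Basis B" and [measurable]: "f \<in> borel_measurable borel"
  shows "(\<integral>\<^sup>+t. f (\<Sum>b\<in>B. t b *\<^sub>R b) \<partial>(\<Pi>\<^sub>M b\<in>B. lborel))
       = (\<integral>\<^sup>+x. f (\<Sum>b\<in>Basis. (x \<bullet> b) *\<^sub>R \<beta> b) \<partial>lborel)"
proof -
  have [measurable]: "(\<lambda>x. \<lambda>c\<in>B. x \<bullet> inv_into Basis \<beta> c) \<in> lborel \<rightarrow>\<^sub>M (\<Pi>\<^sub>M b\<in>B. (lborel :: real measure))"
    by (rule measurable_restrict) simp
  have fin: "finite B" using bij_betw_finite[OF \<beta>] by simp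
  have s: "(\<Sum>b\<in>B. (x \<bullet> inv_into Basis \<beta> b) *\<^sub>R b) = (\<Sum>b\<in>Basis. (x \<bullet> b) *\<^sub>R \<beta> b)" for x
    using sum.reindex_bij_betw[OF \<beta>, of "\<lambda>b. (x \<bullet> inv_into Basis \<beta> b) *\<^sub>R b"]
    by (simp add: bij_betw_inv_into_left[OF \<beta>])
  show ?thesis
    by (subst PiM_lborel_eq_distr[OF \<beta>], subst nn_integral_distr) (auto simp: s)
qed
text \<open>Measuring in a subspace amounts to integrating over any Euclidean space of the same dimension, such as
\<open>complex \<times> complex\<close> for a complex hyperplane, through a linear isometry. The set \<open>B\<close> is the basis chosen in
the definition of \<open>subspace_lborel\<close>, so that the results on \<open>fiber_volume\<close> apply to sections parallel to \<open>S\<close>.\<close>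
lemma subspace_lborel_coordinates:
  fixes S :: "'e::euclidean_space set"
  assumes sub: "subspace S" and dimS: "dim S = DIM('c::euclidean_space)"
  obtains B and U :: "'c::euclidean_space \<Rightarrow> 'e" where "finite B" "linear U" "\<And>c. norm (U c) = norm c" "range U = S"
    "subspace_lborel S = distr lborel borel U"
    "\<And>K w. K \<in> sets borel \<Longrightarrow> fiber_volume B K w = (\<integral>\<^sup>+c. indicator K (w + U c) \<partial>lborel)"
proof -
  define B where "B = (SOME B. orthonormal_basis_of S B)"
  have "\<exists>B. orthonormal_basis_of S B"
    using orthonormal_basis_subspace[OF sub] unfolding orthonormal_basis_of_def by metis
  then have B: "orthonormal_basis_of S B" unfolding B_def by (rule someI_ex)
  then have po: "pairwise orthogonal B" and n1: "\<And>b. b \<in> B \<Longrightarrow> norm b = 1" and sp: "span B = S"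
    by (auto simp: orthonormal_basis_of_def)
  have ind: "independent B" by (rule pairwise_orthogonal_independent[OF po]) (use n1 in force)
  have fin: "finite B" using ind by (rule independent_imp_finite)
  have "card (Basis :: 'c set) = card B" using dim_eq_card_independent[OF ind] dim_span[of B] sp dimS by simp
  then obtain \<beta> :: "'c \<Rightarrow> 'e" where \<beta>: "bij_betw \<beta> Basis B"
    using finite_same_card_bij[OF finite_Basis fin] by blast
  define U where "U = (\<lambda>c :: 'c. \<Sum>b\<in>Basis. (c \<bullet> b) *\<^sub>R \<beta> b)"
  have linU: "linear U"
    unfolding U_def by (rule linearI) (simp_all add: inner_add_left scaleR_add_left sum.distrib scaleR_sum_right)
  have normU: "norm (U c) = norm c" for c
  proof -
    have "pairwise (\<lambda>i j. orthogonal ((c \<bullet> i) *\<^sub>R \<beta> i) ((c \<bullet> j) *\<^sub>R \<beta> j)) Basis"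
      unfolding pairwise_def
    proof (intro ballI impI)
      fix i j :: 'c assume ij: "i \<in> Basis" "j \<in> Basis" "i \<noteq> j"
      then have "\<beta> i \<in> B" "\<beta> j \<in> B" "\<beta> i \<noteq> \<beta> j" using \<beta> by (auto simp: bij_betw_def inj_on_def)
      then have "orthogonal (\<beta> i) (\<beta> j)" using po by (auto simp: pairwise_def)
      then show "orthogonal ((c \<bullet> i) *\<^sub>R \<beta> i) ((c \<bullet> j) *\<^sub>R \<beta> j)" by (simp add: orthogonal_def)
    qed
    then have "(norm (U c))\<^sup>2 = (\<Sum>b\<in>Basis. (norm ((c \<bullet> b) *\<^sub>R \<beta> b))\<^sup>2)"
      unfolding U_def by (rule norm_sum_Pythagorean[OF finite_Basis])
    also have "\<dots> = (\<Sum>b\<in>Basis. (c \<bullet> b) * (c \<bullet> b))"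
      using \<beta> n1 by (intro sum.cong) (auto simp: power2_eq_square dest: bij_betwE)
    also have "\<dots> = (norm c)\<^sup>2" by (simp add: power2_norm_eq_inner euclidean_inner[of c c])
    finally show ?thesis by (simp add: power2_eq_iff_nonneg)
  qed
  \<comment> \<open>The basis vectors span \<open>S\<close> and are themselves values of \<open>U\<close>.\<close>
  have rangeU: "range U = S"
  proof
    show "range U \<subseteq> S"
      unfolding U_def using \<beta> sub sp by (auto intro!: subspace_sum subspace_scale dest: bij_betwE span_base)
    have "b \<in> range U" if "b \<in> B" for b
    proof -
      have "b \<in> \<beta> ` Basis" using that bij_betw_imp_surj_on[OF \<beta>] by simp
      then obtain i where i: "i \<in> Basis" "\<beta> i = b" by auto
      have "U i = (\<Sum>j\<in>Basis. if j = i then \<beta> j else 0)"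
        unfolding U_def using i(1) by (intro sum.cong) (auto simp: inner_Basis)
      then show ?thesis using i by (metis finite_Basis rangeI sum.delta)
    qed
    then show "S \<subseteq> range U"
      unfolding sp[symmetric] using linear_subspace_image[OF linU subspace_UNIV] by (intro span_minimal) auto
  qed
  have [measurable]: "U \<in> borel_measurable borel"
    using linU by (auto intro: linear_continuous)
  show ?thesis
  proof (rule that[OF fin linU normU rangeU])
    show "fiber_volume B K w = (\<integral>\<^sup>+c. indicator K (w + U c) \<partial>lborel)" if [measurable]: "K \<in> sets borel" for K w
      unfolding fiber_volume_def U_def by (rule nn_integral_PiM_lborel[OF \<beta>, of "\<lambda>v. indicator K (w + v)"]) measurable
    show "subspace_lborel S = distr lborel borel U"
    proof (rule measure_eqI)
      fix X assume "X \<in> sets (subspace_lborel S)"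
      then have [measurable]: "X \<in> sets borel" by (simp add: subspace_lborel_def Let_def)
      have "emeasure (subspace_lborel S) X = (\<integral>\<^sup>+x. indicator X x \<partial>subspace_lborel S)"
        by (subst nn_integral_indicator) (auto simp: subspace_lborel_def Let_def)
      also have "\<dots> = (\<integral>\<^sup>+t. indicator X (\<Sum>b\<in>B. t b *\<^sub>R b) \<partial>(\<Pi>\<^sub>M b\<in>B. lborel))"
        unfolding subspace_lborel_def Let_def B_def[symmetric] by (subst nn_integral_distr) auto
      also have "\<dots> = (\<integral>\<^sup>+c. indicator X (U c) \<partial>lborel)"
        unfolding U_def by (rule nn_integral_PiM_lborel[OF \<beta>]) measurable
      also have "\<dots> = (\<integral>\<^sup>+x. indicator X x \<partial>distr lborel borel U)" by (subst nn_integral_distr) auto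
      finally show "emeasure (subspace_lborel S) X = emeasure (distr lborel borel U) X" by simp
    qed (simp add: subspace_lborel_def Let_def)
  qed
qed

lemma section_of_compact:
  fixes S :: "'e::euclidean_space set" and U :: "'c::euclidean_space \<Rightarrow> 'e"
  assumes U: "linear U" "\<And>c. norm (U c) = norm c" "range U = S" "subspace_lborel S = distr lborel borel U"
    and X: "compact X"
  shows "compact {c. U c \<in> X}"
    and "emeasure (subspace_lborel S) (X \<inter> S) = emeasure lborel {c. U c \<in> X}"
proof -
  have Ucont: "continuous_on UNIV U" using U(1) by (rule linear_continuous)
  then have [measurable]: "U \<in> borel_measurable borel" by (rule borel_measurable_continuous_onI)
  have "closed {c. U c \<in> X}" using closed_vimage[OF compact_imp_closed[OF X] Ucont] by (simp add: vimage_def)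
  moreover obtain a where "\<And>x. x \<in> X \<Longrightarrow> norm x \<le> a"
    using compact_imp_bounded[OF X] unfolding bounded_iff by blast
  then have "bounded {c. U c \<in> X}" using U(2) by (intro boundedI[of _ a]) fastforce
  ultimately show "compact {c. U c \<in> X}" by (simp add: compact_eq_bounded_closed)
  have "subspace S" using linear_subspace_image[OF U(1) subspace_UNIV] U(3) by simp
  then have "closed S" by (rule closed_subspace)
  then have "X \<inter> S \<in> sets borel" using compact_imp_closed[OF X] by auto
  moreover have "U c \<in> S" for c using U(3) by auto
  ultimately show "emeasure (subspace_lborel S) (X \<inter> S) = emeasure lborel {c. U c \<in> X}"
    unfolding U(4) by (simp add: emeasure_distr vimage_def)
qed

lemma nn_integral_lborel_pair:
  fixes f :: "'a::euclidean_space \<times> 'b::euclidean_space \<Rightarrow> ennreal"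
  assumes [measurable]: "f \<in> borel_measurable borel"
  shows "(\<integral>\<^sup>+z. f z \<partial>lborel) = (\<integral>\<^sup>+x. \<integral>\<^sup>+y. f (x, y) \<partial>lborel \<partial>lborel)"
proof -
  have "f \<in> borel_measurable (lborel \<Otimes>\<^sub>M lborel)" by (simp add: lborel_prod)
  then show ?thesis
    by (subst lborel_prod[symmetric]) (rule lborel.nn_integral_fst[symmetric])
qed

lemma nn_integral_lborel_scale:
  fixes f :: "'a::euclidean_space \<Rightarrow> ennreal"
  assumes [measurable]: "f \<in> borel_measurable borel" and c: "c > 0"
  shows "(\<integral>\<^sup>+x. f x \<partial>lborel) = ennreal (c ^ DIM('a)) * (\<integral>\<^sup>+x. f (c *\<^sub>R x) \<partial>lborel)"
proof -
  have "(\<integral>\<^sup>+x. f x \<partial>lborel) = (\<integral>\<^sup>+x. f x \<partial>density (distr lborel borel (\<lambda>x. 0 + c *\<^sub>R x)) (\<lambda>_. \<bar>c\<bar>^DIM('a)))"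
    using lborel_affine[of c "0::'a"] c by simp
  also have "\<dots> = ennreal (c ^ DIM('a)) * (\<integral>\<^sup>+x. f (c *\<^sub>R x) \<partial>lborel)"
    using c by (subst nn_integral_density, simp, simp, subst nn_integral_distr) (auto simp: nn_integral_cmult)
  finally show ?thesis .
qed

text \<open>Scaling one factor of a product. Each of the two limits below rescales only those coordinates in which its
integrand degenerates.\<close>
lemma lborel_scale_fst:
  fixes c :: real
  assumes c: "c > 0"
  shows "(lborel :: ('a::euclidean_space \<times> 'b::euclidean_space) measure)
    = density (distr lborel borel (\<lambda>z. (c *\<^sub>R fst z, snd z))) (\<lambda>_. ennreal (c ^ DIM('a)))" (is "_ = ?D")
proof (rule measure_eqI)
  fix A :: "('a \<times> 'b) set" assume "A \<in> sets lborel"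
  then have A[measurable]: "A \<in> sets borel" by simp
  have [measurable]: "(\<lambda>z::'a \<times> 'b. (c *\<^sub>R fst z, snd z)) \<in> borel_measurable borel"
    by (intro borel_measurable_continuous_onI continuous_intros)
  then have [measurable]: "(\<lambda>z. indicator A (c *\<^sub>R fst z, snd z) :: ennreal) \<in> borel_measurable borel"
    by (rule measurable_compose) simp
  have "emeasure lborel A = (\<integral>\<^sup>+z. indicator A z \<partial>lborel)" by simp
  also have "\<dots> = (\<integral>\<^sup>+x. \<integral>\<^sup>+y. indicator A (x, y) \<partial>lborel \<partial>lborel)"
    by (rule nn_integral_lborel_pair) simp
  also have "\<dots> = ennreal (c ^ DIM('a)) * (\<integral>\<^sup>+x. \<integral>\<^sup>+y. indicator A (c *\<^sub>R x, y) \<partial>lborel \<partial>lborel)"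
    by (rule nn_integral_lborel_scale[OF _ c]) measurable
  also have "(\<integral>\<^sup>+x. \<integral>\<^sup>+y. indicator A (c *\<^sub>R x, y) \<partial>lborel \<partial>lborel) = (\<integral>\<^sup>+z. indicator A (c *\<^sub>R fst z, snd z) \<partial>lborel)"
    by (subst nn_integral_lborel_pair) auto
  also have "(\<integral>\<^sup>+z. indicator A (c *\<^sub>R fst z, snd z) \<partial>lborel)
      = (\<integral>\<^sup>+z. indicator A z \<partial>distr lborel borel (\<lambda>z. (c *\<^sub>R fst z, snd z)))"
    by (subst nn_integral_distr) auto
  also have "\<dots> = emeasure (distr lborel borel (\<lambda>z. (c *\<^sub>R fst z, snd z))) A" by simp
  also have "ennreal (c ^ DIM('a)) * \<dots> = emeasure ?D A"
    by (subst emeasure_density) (auto simp: nn_integral_cmult)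
  finally show "emeasure lborel A = emeasure ?D A" .
qed simp

lemma integral_lborel_scale_fst:
  fixes f :: "'a::euclidean_space \<times> 'b::euclidean_space \<Rightarrow> real"
  assumes [measurable]: "f \<in> borel_measurable borel" and c: "c > 0"
  shows "(\<integral>z. f z \<partial>lborel) = c ^ DIM('a) * (\<integral>z. f (c *\<^sub>R fst z, snd z) \<partial>lborel)"
proof -
  have [measurable]: "(\<lambda>z::'a \<times> 'b. (c *\<^sub>R fst z, snd z)) \<in> borel_measurable borel"
    by (intro borel_measurable_continuous_onI continuous_intros)
  have "(\<integral>z. f z \<partial>lborel) = (\<integral>z. f z \<partial>density (distr lborel borel (\<lambda>z. (c *\<^sub>R fst z, snd z))) (\<lambda>_. ennreal (c ^ DIM('a))))"
    using lborel_scale_fst[OF c] by metis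
  also have "\<dots> = c ^ DIM('a) * (\<integral>z. f (c *\<^sub>R fst z, snd z) \<partial>lborel)"
    using c by (subst integral_density, simp, simp, simp, subst integral_distr) auto
  finally show ?thesis .
qed

lemma integral_lborel_swap:
  fixes f :: "'a::euclidean_space \<times> 'b::euclidean_space \<Rightarrow> real"
  assumes [measurable]: "f \<in> borel_measurable borel"
  shows "(\<integral>z. f z \<partial>lborel) = (\<integral>z. f (snd z, fst z) \<partial>lborel)"
  by (rule integral_linear_isometry[where T = "\<lambda>z. (snd z, fst z)"])
     (auto simp: linear_iff norm_prod_def add.commute)

lemma integral_lborel_scale_snd:
  fixes f :: "'a::euclidean_space \<times> 'b::euclidean_space \<Rightarrow> real"
  assumes [measurable]: "f \<in> borel_measurable borel" and c: "c > 0"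
  shows "(\<integral>z. f z \<partial>lborel) = c ^ DIM('b) * (\<integral>z. f (fst z, c *\<^sub>R snd z) \<partial>lborel)"
proof -
  have [measurable]: "(\<lambda>z::'b \<times> 'a. f (snd z, fst z)) \<in> borel_measurable borel"
    by (rule measurable_compose[OF _ assms(1)]) (intro borel_measurable_continuous_onI continuous_intros)
  have [measurable]: "(\<lambda>z::'a \<times> 'b. f (fst z, c *\<^sub>R snd z)) \<in> borel_measurable borel"
    by (rule measurable_compose[OF _ assms(1)]) (intro borel_measurable_continuous_onI continuous_intros)
  have "(\<integral>z. f z \<partial>lborel) = (\<integral>z. f (snd z, fst z) \<partial>lborel)" by (rule integral_lborel_swap) simp
  also have "\<dots> = c ^ DIM('b) * (\<integral>z. f (snd z, c *\<^sub>R fst z) \<partial>lborel)"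
    by (subst integral_lborel_scale_fst[OF _ c]) simp_all
  also have "(\<integral>z. f (snd z, c *\<^sub>R fst z) \<partial>lborel) = (\<integral>z. f (fst z, c *\<^sub>R snd z) \<partial>lborel)"
    by (subst integral_lborel_swap[where f = "\<lambda>z. f (fst z, c *\<^sub>R snd z)"]) simp_all
  finally show ?thesis .
qed

lemma integrable_lborel_product:
  fixes f :: "'a::euclidean_space \<Rightarrow> real" and g :: "'b::euclidean_space \<Rightarrow> real"
  assumes f: "integrable lborel f" and g: "integrable lborel g"
  shows "integrable lborel (\<lambda>z. f (fst z) * g (snd z))"
    and "(\<integral>z. f (fst z) * g (snd z) \<partial>lborel) = (\<integral>x. f x \<partial>lborel) * (\<integral>y. g y \<partial>lborel)"
proof -
  have [measurable]: "f \<in> borel_measurable borel" "g \<in> borel_measurable borel" using f g by auto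
  have m: "(\<lambda>z. f (fst z) * g (snd z)) \<in> borel_measurable (lborel \<Otimes>\<^sub>M lborel)" by measurable
  have int: "integrable (lborel \<Otimes>\<^sub>M lborel) (\<lambda>z. f (fst z) * g (snd z))"
  proof (rule lborel_pair.Fubini_integrable[OF m])
    show "integrable lborel (\<lambda>x. \<integral>y. norm (f (fst (x, y)) * g (snd (x, y))) \<partial>lborel)"
      using f g by (simp add: abs_mult)
    show "AE x in lborel. integrable lborel (\<lambda>y. f (fst (x, y)) * g (snd (x, y)))"
      using g by simp
  qed
  then show "integrable lborel (\<lambda>z. f (fst z) * g (snd z))" by (simp add: lborel_prod)
  have "(\<integral>x. (\<integral>y. f (fst (x, y)) * g (snd (x, y)) \<partial>lborel) \<partial>lborel) = (\<integral>z. f (fst z) * g (snd z) \<partial>(lborel \<Otimes>\<^sub>M lborel))"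
    by (rule lborel_pair.integral_fst'[OF int])
  then show "(\<integral>z. f (fst z) * g (snd z) \<partial>lborel) = (\<integral>x. f x \<partial>lborel) * (\<integral>y. g y \<partial>lborel)"
    by (simp add: lborel_prod)
qed

lemma integral_le_of_nn_integral_le:
  fixes u v :: "'a \<Rightarrow> real"
  assumes "integrable M u" "integrable M v" "\<And>x. 0 \<le> u x" "\<And>x. 0 \<le> v x"
    and "(\<integral>\<^sup>+x. ennreal (u x) \<partial>M) \<le> (\<integral>\<^sup>+x. ennreal (v x) \<partial>M)"
  shows "(\<integral>x. u x \<partial>M) \<le> (\<integral>x. v x \<partial>M)"
proof -
  have "ennreal (\<integral>x. u x \<partial>M) \<le> ennreal (\<integral>x. v x \<partial>M)"
    using assms by (simp add: nn_integral_eq_integral)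
  moreover have "0 \<le> (\<integral>x. v x \<partial>M)" using assms by simp
  ultimately show ?thesis by (simp add: ennreal_le_iff)
qed

lemma integrable_indicator_bounded:
  fixes K :: "'a::euclidean_space set" and f :: "'a \<Rightarrow> real"
  assumes K[measurable]: "K \<in> sets borel" and "bounded K"
    and [measurable]: "f \<in> borel_measurable borel" and f: "\<And>x. \<bar>f x\<bar> \<le> c"
  shows "integrable lborel (\<lambda>x. indicator K x * f x)"
proof (rule Bochner_Integration.integrable_bound)
  have "emeasure lborel K < \<infinity>" by (rule emeasure_bounded_finite) fact
  then show "integrable lborel (\<lambda>x. indicator K x * c)" by (intro integrable_mult_left integrable_real_indicator) auto
  show "AE x in lborel. norm (indicator K x * f x) \<le> norm (indicator K x * c)"
  proof (intro always_eventually allI)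
    fix x
    have "\<bar>f x\<bar> \<le> \<bar>c\<bar>" using f[of x] by linarith
    then show "norm (indicator K x * f x) \<le> norm (indicator K x * c)"
      by (simp add: abs_mult mult_left_mono)
  qed
qed measurable

lemma measure_cball_complex: "r \<ge> 0 \<Longrightarrow> measure lborel (cball (0::complex) r) = pi * r\<^sup>2"
  by (simp add: content_cball unit_ball_vol_2)

lemma integrable_indicator_cball: "integrable lborel (indicator (cball (0::'a::euclidean_space) r) :: 'a \<Rightarrow> real)"
  using emeasure_lborel_cball_finite[of "0::'a" r] by (intro integrable_real_indicator) simp_all

section \<open>Gaussian integrals and the radial kernel\<close>

type_synonym complex2 = "complex \<times> complex"
type_synonym complex3 = "complex \<times> complex \<times> complex"

lemma Gaussian_real:
  fixes a :: real
  assumes a: "a > 0"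
  shows "(\<integral>\<^sup>+x. exp (- a * x\<^sup>2) \<partial>lborel) = ennreal (sqrt (pi / a))"
proof -
  define \<sigma> where "\<sigma> = sqrt (1 / (2 * a))"
  have \<sigma>: "\<sigma> > 0" "\<sigma>\<^sup>2 = 1 / (2 * a)" using a by (simp_all add: \<sigma>_def)
  have eq: "exp (- a * x\<^sup>2) = sqrt (pi / a) * normal_density 0 \<sigma> x" for x
  proof -
    have "2 * pi * (1 / (2 * a)) = pi / a" "- (x - 0)\<^sup>2 / (2 * (1 / (2 * a))) = - a * x\<^sup>2" using a by simp_all
    then show ?thesis unfolding normal_density_def \<sigma>(2) using a by simp
  qed
  have "(\<integral>\<^sup>+x. exp (- a * x\<^sup>2) \<partial>lborel) = ennreal (\<integral>x. sqrt (pi / a) * normal_density 0 \<sigma> x \<partial>lborel)"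
    unfolding eq using \<sigma> a by (intro nn_integral_eq_integral integrable_mult_right) auto
  also have "\<dots> = ennreal (sqrt (pi / a))" using \<sigma> by simp
  finally show ?thesis .
qed

lemma Gaussian_euclidean:
  fixes a :: real
  assumes a: "a > 0"
  shows "integrable lborel (\<lambda>v::'a::euclidean_space. exp (- a * (norm v)\<^sup>2))"
    and "(\<integral>v. exp (- a * (norm (v::'a))\<^sup>2) \<partial>lborel) = sqrt (pi / a) ^ DIM('a)"
proof -
  have "has_bochner_integral lborel (\<lambda>v::'a. exp (- a * (norm v)\<^sup>2)) (sqrt (pi / a) ^ DIM('a))"
  proof (rule has_bochner_integral_nn_integral)
    have eq: "ennreal (exp (- a * (norm v)\<^sup>2)) = (\<Prod>b\<in>Basis. ennreal (exp (- a * (v \<bullet> b)\<^sup>2)))" for v :: 'a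
    proof -
      have "- a * (norm v)\<^sup>2 = (\<Sum>b\<in>Basis. - a * (v \<bullet> b)\<^sup>2)"
        by (subst power2_norm_eq_inner, subst euclidean_inner) (simp only: sum_distrib_left power2_eq_square)
      then show ?thesis by (simp add: exp_sum prod_ennreal)
    qed
    have "(\<integral>\<^sup>+v. ennreal (exp (- a * (norm (v::'a))\<^sup>2)) \<partial>lborel) = (\<Prod>b\<in>(Basis :: 'a set). \<integral>\<^sup>+x. ennreal (exp (- a * x\<^sup>2)) \<partial>lborel)"
      unfolding eq by (rule nn_integral_lborel_prod) auto
    also have "\<dots> = ennreal (sqrt (pi / a) ^ DIM('a))"
      unfolding Gaussian_real[OF a] using a by (simp add: ennreal_power)
    finally show "(\<integral>\<^sup>+v. ennreal (exp (- a * (norm (v::'a))\<^sup>2)) \<partial>lborel) = ennreal (sqrt (pi / a) ^ DIM('a))" .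
  qed (use a in auto)
  then show "integrable lborel (\<lambda>v::'a. exp (- a * (norm v)\<^sup>2))"
    and "(\<integral>v. exp (- a * (norm (v::'a))\<^sup>2) \<partial>lborel) = sqrt (pi / a) ^ DIM('a)"
    by (auto simp: has_bochner_integral_iff)
qed

lemma Gaussian_complex:
  fixes a :: real
  assumes a: "a > 0"
  shows "integrable lborel (\<lambda>v::complex. exp (- a * (norm v)\<^sup>2))"
    and "(\<integral>v. exp (- a * (norm (v::complex))\<^sup>2) \<partial>lborel) = pi / a"
  using Gaussian_euclidean(1)[OF a, where 'a = complex] Gaussian_euclidean(2)[OF a, where 'a = complex] a by simp_all

text \<open>The factor \<open>\<pi>\<^sup>2\<close> aside, this is the Gaussian integral computed in \<open>kernel_integral\<close>. The closed form
shows that it is positive and decays like the inverse cube.\<close>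
definition radial_kernel :: "real \<Rightarrow> real" where
  "radial_kernel r = 45 / (4 * ((1 + 4 * r) * (1 + r) * (4 + r)))"

text \<open>As a function of \<open>norm u\<close> for a complex number \<open>u\<close> this has integral zero, since multiplying the argument
by \<open>2\<close> divides the integral by \<open>4\<close>. For the same reason its integral against a function \<open>F\<close> is that of
\<open>F (u / 2) - F u\<close> against a Gaussian, hence nonnegative if \<open>F\<close> does not decrease under halving of \<open>u\<close>.\<close>
definition profile :: "real \<Rightarrow> real \<Rightarrow> real" where
  "profile a t = 4 * exp (- 4 * a * t\<^sup>2) - exp (- a * t\<^sup>2)"

text \<open>The vanishing at the origin matters: with \<open>exp (- t\<^sup>2)\<close> alone the resulting kernel on \<open>\<complex>\<^sup>2\<close> would decay
like \<open>norm z\<close> to the power \<open>-4\<close>, which is just not integrable. Subtracting the second Gaussian cancels this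
leading term, because after one complex coordinate is integrated out the remaining density has no
second-order term at the origin.\<close>
definition weight :: "real \<Rightarrow> real" where
  "weight t = exp (- t\<^sup>2) - exp (- 4 * t\<^sup>2)"

lemma weight_bounds: "0 \<le> weight t" "weight t \<le> exp (- t\<^sup>2)"
  by (simp_all add: weight_def)

lemma profile_bound: "0 \<le> a \<Longrightarrow> \<bar>profile a t\<bar> \<le> 5"
proof -
  assume a: "0 \<le> a"
  then have "exp (- 4 * a * t\<^sup>2) \<le> 1" "exp (- a * t\<^sup>2) \<le> 1" "0 < exp (- 4 * a * t\<^sup>2)" "0 < exp (- a * t\<^sup>2)" by auto
  then show ?thesis unfolding profile_def by linarith
qed

text \<open>Expanding both differences gives four products of one-dimensional complex Gaussians, with integral
\<open>\<pi>\<^sup>2 / (b * c)\<close> each.\<close>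
lemma kernel_integral:
  assumes a: "a > 0"
  shows "(\<integral>z. weight (norm (z :: complex2)) * profile a (q * norm (fst z)) \<partial>lborel) = pi\<^sup>2 * radial_kernel (a * q\<^sup>2)"
proof -
  define r where "r = a * q\<^sup>2"
  have r: "r \<ge> 0" using a by (simp add: r_def)
  define E where "E = (\<lambda>b c (z :: complex2). exp (- b * (norm (fst z))\<^sup>2) * exp (- c * (norm (snd z))\<^sup>2))"
  have E: "integrable lborel (E b c)" "(\<integral>z. E b c z \<partial>lborel) = pi\<^sup>2 / (b * c)" if "b > 0" "c > 0" for b c
    using integrable_lborel_product[OF Gaussian_complex(1)[OF that(1)] Gaussian_complex(1)[OF that(2)]]
      Gaussian_complex(2)[OF that(1)] Gaussian_complex(2)[OF that(2)]
    by (simp_all add: E_def power2_eq_square)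
  have eq: "weight (norm z) * profile a (q * norm (fst z))
     = 4 * E (1 + 4 * r) 1 z - E (1 + r) 1 z - 4 * E (4 + 4 * r) 4 z + E (4 + r) 4 z" for z
  proof -
    define s where "s = (norm (fst z))\<^sup>2"
    define t where "t = (norm (snd z))\<^sup>2"
    have nz: "(norm z)\<^sup>2 = s + t" by (simp add: s_def t_def norm_prod_def)
    have qz: "a * (q * norm (fst z))\<^sup>2 = r * s" by (simp add: r_def s_def power_mult_distrib)
    have p: "profile a (q * norm (fst z)) = 4 * exp (- 4 * (r * s)) - exp (- (r * s))"
      unfolding profile_def qz[symmetric] by (simp add: algebra_simps)
    show ?thesis unfolding weight_def p nz E_def s_def[symmetric] t_def[symmetric]
      by (simp add: algebra_simps exp_add[symmetric])
  qed
  have "(\<integral>z. weight (norm (z :: complex2)) * profile a (q * norm (fst z)) \<partial>lborel)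
     = 4 * (pi\<^sup>2 / ((1 + 4 * r) * 1)) - pi\<^sup>2 / ((1 + r) * 1) - 4 * (pi\<^sup>2 / ((4 + 4 * r) * 4)) + pi\<^sup>2 / ((4 + r) * 4)"
    unfolding eq using r by (simp add: E del: mult_1_right)
  also have "\<dots> = pi\<^sup>2 * (4 / (1 + 4 * r) - 1 / (1 + r) - 1 / (4 + 4 * r) + 1 / ((4 + r) * 4))"
  proof -
    have "4 * (P / ((4 + 4 * r) * 4)) = P / (4 + 4 * r)" for P using r by (simp add: divide_simps)
    then show ?thesis by (simp only:) (simp add: algebra_simps)
  qed
  also have "4 / (1 + 4 * r) - 1 / (1 + r) - 1 / (4 + 4 * r) + 1 / ((4 + r) * 4) = radial_kernel r"
  proof -
    define A B C where "A = 1 + 4 * r" and "B = 1 + r" and "C = 4 + r"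
    have nz: "A \<noteq> 0" "B \<noteq> 0" "C \<noteq> 0" using r by (auto simp: A_def B_def C_def)
    have B4: "4 + 4 * r = 4 * B" by (simp add: B_def)
    have "4 / A - 1 / B - 1 / (4 * B) + 1 / (C * 4) = (16 * C * B + A * B - 5 * (A * C)) / (4 * (A * B * C))"
      using nz by (simp add: field_simps)
    also have "16 * C * B + A * B - 5 * (A * C) = 45"
      by (simp add: A_def B_def C_def algebra_simps)
    finally show ?thesis unfolding radial_kernel_def B4 A_def B_def C_def .
  qed
  finally show ?thesis by (simp add: r_def)
qed

lemma weight_measurable[measurable]: "weight \<in> borel_measurable borel"
  unfolding weight_def[abs_def] by measurable

lemma profile_measurable[measurable]: "profile a \<in> borel_measurable borel"
  unfolding profile_def[abs_def] by measurable

lemma kernel_bounds: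
  assumes r: "0 \<le> r"
  shows "0 < radial_kernel r" "radial_kernel r \<le> 45 / 4 * (1 / (1 + r) ^ 3)"
proof -
  show "0 < radial_kernel r" unfolding radial_kernel_def using r by (intro divide_pos_pos mult_pos_pos) auto
  have "(1 + r) * (1 + r) * (1 + r) \<le> (1 + 4 * r) * (1 + r) * (4 + r)"
    using r by (intro mult_mono) auto
  then have "45 / (4 * ((1 + 4 * r) * (1 + r) * (4 + r))) \<le> 45 / (4 * ((1 + r) * (1 + r) * (1 + r)))"
    using r by (intro divide_left_mono mult_pos_pos) auto
  then show "radial_kernel r \<le> 45 / 4 * (1 / (1 + r) ^ 3)" unfolding radial_kernel_def power3_eq_cube by simp
qed

lemma kernel_measurable[measurable]: "radial_kernel \<in> borel_measurable borel"
  unfolding radial_kernel_def[abs_def] by measurable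

text \<open>With \<open>c = 1 + (norm z)\<^sup>2\<close> the integrand on the right is a Gaussian in \<open>z\<close>, so \<open>1 / c ^ 3\<close> can be integrated
over \<open>z\<close> by exchanging the two integrals.\<close>
lemma inverse_cube_as_Laplace:
  fixes c :: real
  assumes c: "c > 0"
  shows "ennreal (2 / c ^ 3) = (\<integral>\<^sup>+s. ennreal (s\<^sup>2 * exp (- s * c)) * indicator {0..} s \<partial>lborel)"
proof -
  have "ennreal 2 = (\<integral>\<^sup>+x. ennreal (x\<^sup>2 * exp (- x)) * indicator {0..} x \<partial>lborel)"
    using nn_intergal_power_times_exp_Ici[of 2] by (simp add: numeral_2_eq_2)
  also have "\<dots> = ennreal \<bar>c\<bar> * (\<integral>\<^sup>+s. ennreal ((0 + c * s)\<^sup>2 * exp (- (0 + c * s))) * indicator {0..} (0 + c * s) \<partial>lborel)"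
    by (rule nn_integral_real_affine) (use c in auto)
  also have "\<dots> = (\<integral>\<^sup>+s. ennreal (c ^ 3) * (ennreal (s\<^sup>2 * exp (- s * c)) * indicator {0..} s) \<partial>lborel)"
    using c by (subst nn_integral_cmult[symmetric])
      (auto simp: indicator_def zero_le_mult_iff power2_eq_square power3_eq_cube ennreal_mult'[symmetric] mult_ac intro!: nn_integral_cong)
  also have "\<dots> = ennreal (c ^ 3) * (\<integral>\<^sup>+s. ennreal (s\<^sup>2 * exp (- s * c)) * indicator {0..} s \<partial>lborel)"
    by (rule nn_integral_cmult) auto
  finally have "ennreal (1 / c ^ 3) * ennreal 2 = (ennreal (1 / c ^ 3) * ennreal (c ^ 3)) * (\<integral>\<^sup>+s. ennreal (s\<^sup>2 * exp (- s * c)) * indicator {0..} s \<partial>lborel)"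
    by (simp add: mult.assoc)
  moreover have "ennreal (1 / c ^ 3) * ennreal 2 = ennreal (2 / c ^ 3)" "ennreal (1 / c ^ 3) * ennreal (c ^ 3) = 1"
    using c by (subst ennreal_mult[symmetric], auto)+
  ultimately show ?thesis by simp
qed

lemma inverse_cube_integral_finite:
  "(\<integral>\<^sup>+z. ennreal (2 / (1 + (norm (z :: complex2))\<^sup>2) ^ 3) \<partial>lborel) < \<infinity>"
proof -
  have pos: "1 + (norm (z :: complex2))\<^sup>2 > 0" for z by (simp add: add_pos_nonneg)
  have "(\<integral>\<^sup>+z. ennreal (2 / (1 + (norm (z :: complex2))\<^sup>2) ^ 3) \<partial>lborel)
    = (\<integral>\<^sup>+z. (\<integral>\<^sup>+s. ennreal (s\<^sup>2 * exp (- s * (1 + (norm (z :: complex2))\<^sup>2))) * indicator {0..} s \<partial>lborel) \<partial>lborel)"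
    unfolding inverse_cube_as_Laplace[OF pos] ..
  also have "\<dots> = (\<integral>\<^sup>+s. (\<integral>\<^sup>+z. ennreal (s\<^sup>2 * exp (- s * (1 + (norm (z :: complex2))\<^sup>2))) * indicator {0..} s \<partial>lborel) \<partial>lborel)"
    by (rule lborel_pair.Fubini'[symmetric]) measurable
  also have "\<dots> \<le> (\<integral>\<^sup>+s. ennreal (pi\<^sup>2) * (ennreal (s ^ 0 * exp (- s)) * indicator {0..} s) \<partial>lborel)"
  proof (rule nn_integral_mono)
    fix s :: real
    show "(\<integral>\<^sup>+z. ennreal (s\<^sup>2 * exp (- s * (1 + (norm (z :: complex2))\<^sup>2))) * indicator {0..} s \<partial>lborel) \<le> ennreal (pi\<^sup>2) * (ennreal (s ^ 0 * exp (- s)) * indicator {0..} s)"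
    proof (cases "s > 0")
      case True
      have "(\<integral>\<^sup>+z. ennreal (s\<^sup>2 * exp (- s * (1 + (norm (z :: complex2))\<^sup>2))) * indicator {0..} s \<partial>lborel)
        = (\<integral>\<^sup>+z. ennreal (s\<^sup>2 * exp (- s)) * ennreal (exp (- s * (norm (z :: complex2))\<^sup>2)) \<partial>lborel)"
        using True by (intro nn_integral_cong) (simp add: ennreal_mult'[symmetric] algebra_simps exp_add[symmetric])
      also have "\<dots> = ennreal (s\<^sup>2 * exp (- s)) * (\<integral>\<^sup>+z. ennreal (exp (- s * (norm (z :: complex2))\<^sup>2)) \<partial>lborel)"
        by (rule nn_integral_cmult) auto
      also have "(\<integral>\<^sup>+z. ennreal (exp (- s * (norm (z :: complex2))\<^sup>2)) \<partial>lborel) = ennreal ((pi / s)\<^sup>2)"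
      proof -
        have "sqrt (pi / s) ^ 4 = (pi / s)\<^sup>2" using True power_mult[of "sqrt (pi / s)" 2 2] by simp
        then show ?thesis
          using Gaussian_euclidean[OF True, where 'a = "complex2"] by (simp add: nn_integral_eq_integral)
      qed
      also have "ennreal (s\<^sup>2 * exp (- s)) * ennreal ((pi / s)\<^sup>2) = ennreal (pi\<^sup>2) * (ennreal (s ^ 0 * exp (- s)) * indicator {0..} s)"
        using True by (simp add: ennreal_mult'[symmetric] power_divide mult_ac)
      finally show ?thesis by simp
    next
      case False
      then have "s = 0 \<or> s < 0" by auto
      then show ?thesis by auto
    qed
  qed
  also have "\<dots> = ennreal (pi\<^sup>2) * (\<integral>\<^sup>+s. ennreal (s ^ 0 * exp (- s)) * indicator {0..} s \<partial>lborel)"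
    by (rule nn_integral_cmult) auto
  also have "\<dots> < \<infinity>"
    unfolding nn_intergal_power_times_exp_Ici by (simp add: ennreal_mult_less_top)
  finally show ?thesis .
qed

definition kernel_mass :: real where
  "kernel_mass = (\<integral>z. radial_kernel ((norm (z :: complex2))\<^sup>2) \<partial>lborel)"

lemma kernel_integrable: "integrable lborel (\<lambda>z :: complex2. radial_kernel ((norm z)\<^sup>2))"
proof (rule Bochner_Integration.integrable_bound)
  show "integrable lborel (\<lambda>z :: complex2. 6 * (2 / (1 + (norm z)\<^sup>2) ^ 3))"
    using inverse_cube_integral_finite by (intro integrable_mult_right integrableI_nonneg) auto
  have bound: "\<bar>radial_kernel r\<bar> \<le> 6 * (2 / (1 + r) ^ 3)" if "0 \<le> r" for r
  proof -
    have "45 / 4 * (1 / (1 + r) ^ 3) \<le> 12 * (1 / (1 + r) ^ 3)" using that by (intro mult_right_mono) auto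
    then show ?thesis using kernel_bounds[OF that] by simp
  qed
  show "AE z in lborel. norm (radial_kernel ((norm (z :: complex2))\<^sup>2)) \<le> norm (6 * (2 / (1 + (norm z)\<^sup>2) ^ 3))"
    unfolding real_norm_def by (intro always_eventually allI order_trans[OF bound abs_ge_self] zero_le_power2)
qed measurable

lemma kernel_mass_pos: "kernel_mass > 0"
proof -
  have "kernel_mass \<noteq> 0"
  proof
    assume "kernel_mass = 0"
    then have "AE z in lborel. radial_kernel ((norm (z :: complex2))\<^sup>2) = 0"
      unfolding kernel_mass_def
      by (subst (asm) integral_nonneg_eq_0_iff_AE[OF kernel_integrable]) (simp_all add: less_imp_le[OF kernel_bounds(1)[OF zero_le_power2]])
    then have "AE z :: complex2 in lborel. False"
    proof (rule eventually_mono)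
      fix z :: "complex2" assume "radial_kernel ((norm z)\<^sup>2) = 0"
      then show False using kernel_bounds(1)[of "(norm z)\<^sup>2"] by simp
    qed
    then show False
      using AE_iff_null[of "lborel :: complex2 measure" "\<lambda>_. False"] by (simp add: null_sets_def)
  qed
  moreover have "kernel_mass \<ge> 0" unfolding kernel_mass_def
    by (intro Bochner_Integration.integral_nonneg less_imp_le[OF kernel_bounds(1)[OF zero_le_power2]])
  ultimately show ?thesis by simp
qed

section \<open>Complex structures on a six-dimensional space\<close>

lemma linear_isometry_inner:
  assumes "linear T" and "\<And>x. norm (T x) = norm x"
  shows "T x \<bullet> T y = x \<bullet> y"
  by (simp add: dot_norm assms linear_add[OF assms(1), symmetric])

text \<open>A real model of \<open>\<complex>\<^sup>3\<close>: multiplication by the imaginary unit is an isometry \<open>J\<close> that moves every vector to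
an orthogonal one. That \<open>J\<close> squares to minus the identity follows (\<open>J_J\<close>).\<close>
locale unitary_structure =
  fixes J :: "'e::euclidean_space \<Rightarrow> 'e"
  assumes linJ: "linear J" and normJ: "\<And>x. norm (J x) = norm x" and skewJ: "\<And>x. x \<bullet> J x = 0"
    and dim6: "DIM('e) = 6"
begin

lemma inner_J_J: "J x \<bullet> J y = x \<bullet> y"
  by (rule linear_isometry_inner[OF linJ normJ])

lemma inner_J_left: "J x \<bullet> y = - (x \<bullet> J y)"
proof -
  have "(x + y) \<bullet> J (x + y) = 0" by (rule skewJ)
  then have "x \<bullet> J y + y \<bullet> J x = 0" by (simp add: linear_add[OF linJ] inner_add skewJ)
  then show ?thesis by (simp add: inner_commute)
qed

lemma inner_J_self[simp]: "x \<bullet> J x = 0" "J x \<bullet> x = 0"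
  using skewJ[of x] by (simp_all add: inner_commute)

lemma J_J: "J (J x) = - x"
proof (rule vector_eq_rdot[THEN iffD1], rule allI)
  fix y show "J (J x) \<bullet> y = (- x) \<bullet> y" using inner_J_left[of "J x" y] inner_J_J[of x y] by simp
qed

definition cscale :: "complex \<Rightarrow> 'e \<Rightarrow> 'e" where
  "cscale c x = Re c *\<^sub>R x + Im c *\<^sub>R J x"

lemma linear_cscale: "linear (\<lambda>c. cscale c x)"
  by (rule linearI) (simp_all add: cscale_def algebra_simps)

lemma J_cscale: "J (cscale c x) = cscale (\<i> * c) x"
  by (simp add: cscale_def linear_add[OF linJ] linear_scale[OF linJ] J_J)

lemma norm_cscale: "norm (cscale c x) = norm c * norm x"
proof -
  have "(norm (cscale c x))\<^sup>2 = (norm c * norm x)\<^sup>2"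
    unfolding power_mult_distrib cmod_power2 cscale_def power2_norm_eq_inner
    by (simp add: inner_add inner_J_J power2_eq_square algebra_simps)
  then show ?thesis by (simp add: power2_eq_iff_nonneg)
qed

text \<open>The modulus of the Hermitian product whose real part is the given inner product.\<close>
definition herm :: "'e \<Rightarrow> 'e \<Rightarrow> real" where
  "herm x y = sqrt ((x \<bullet> y)\<^sup>2 + (x \<bullet> J y)\<^sup>2)"

lemma herm_commute: "herm x y = herm y x"
  unfolding herm_def using inner_J_left[of x y] by (simp add: inner_commute)

lemma herm_measurable[measurable]:
  "(\<lambda>(x, y). herm x y) \<in> borel_measurable (borel \<Otimes>\<^sub>M borel)"
proof -
  have "continuous_on UNIV J" using linJ by (rule linear_continuous)
  then have [measurable]: "J \<in> borel_measurable borel" by (rule borel_measurable_continuous_onI)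
  show ?thesis unfolding herm_def split_beta' by measurable
qed

text \<open>Complex-linear isometries from \<open>\<complex>\<^sup>3\<close>, that is, Hermitian orthonormal coordinates. Complex linearity is
stated through multiplication by \<open>\<i>\<close> only, since \<open>T\<close> is real linear.\<close>
definition frame :: "(complex3 \<Rightarrow> 'e) \<Rightarrow> bool" where
  "frame T \<longleftrightarrow> linear T \<and> (\<forall>z. norm (T z) = norm z) \<and>
     (\<forall>u v w. T (\<i> * u, \<i> * v, \<i> * w) = J (T (u, v, w)))"

lemma herm_frame:
  assumes "frame T"
  shows "herm (T (a, b, c)) (T (u, v, w)) = cmod (cnj a * u + cnj b * v + cnj c * w)"
proof -
  have T: "linear T" "\<And>z. norm (T z) = norm z" "\<And>u v w. T (\<i> * u, \<i> * v, \<i> * w) = J (T (u, v, w))"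
    using assms by (auto simp: frame_def)
  let ?z = "cnj a * u + cnj b * v + cnj c * w"
  have 1: "T (a, b, c) \<bullet> T (u, v, w) = Re ?z"
    unfolding linear_isometry_inner[OF T(1,2)] by (simp add: inner_complex_def)
  have 2: "T (a, b, c) \<bullet> J (T (u, v, w)) = - Im ?z"
    unfolding T(3)[symmetric] linear_isometry_inner[OF T(1,2)] by (simp add: inner_complex_def)
  show ?thesis unfolding herm_def 1 2 cmod_def by (simp only: power2_minus)
qed

lemma unit_orthogonal_exists:
  fixes X :: "'e set"
  assumes "finite X" "card X < 6"
  obtains e where "norm e = 1" "\<And>x. x \<in> X \<Longrightarrow> e \<bullet> x = 0"
proof -
  have "dim X < DIM('e)" using dim_le_card'[OF assms(1)] assms(2) dim6 by linarith
  then obtain x where x: "x \<noteq> 0" "\<And>y. y \<in> span X \<Longrightarrow> orthogonal x y"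
    by (rule orthogonal_to_subspace_exists) blast
  show ?thesis
    by (rule that[of "x /\<^sub>R norm x"]) (use x span_base in \<open>auto simp: orthogonal_def\<close>)
qed

lemma frame_of_orthonormal:
  assumes n: "norm e1 = 1" "norm e2 = 1" "norm e3 = 1"
    and o: "e2 \<bullet> e1 = 0" "e2 \<bullet> J e1 = 0" "e3 \<bullet> e1 = 0" "e3 \<bullet> J e1 = 0" "e3 \<bullet> e2 = 0" "e3 \<bullet> J e2 = 0"
  shows "frame (\<lambda>(u, v, w). cscale u e1 + cscale v e2 + cscale w e3)"
proof -
  have orth: "cscale a x \<bullet> cscale b y = 0" if "y \<bullet> x = 0" "y \<bullet> J x = 0" for a b x y
  proof -
    have "x \<bullet> y = 0" "J x \<bullet> y = 0" "x \<bullet> J y = 0" "J x \<bullet> J y = 0"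
      using that inner_J_left[of x y] by (simp_all add: inner_commute inner_J_J)
    then show ?thesis by (simp add: cscale_def inner_add)
  qed
  have "norm (cscale u e1 + cscale v e2 + cscale w e3) = norm (u, v, w)" for u v w
  proof -
    have "(norm (cscale u e1 + cscale v e2 + cscale w e3))\<^sup>2 = (norm (cscale u e1))\<^sup>2 + (norm (cscale v e2))\<^sup>2 + (norm (cscale w e3))\<^sup>2"
      using orth[of e2 e1 u v] orth[of e3 e1 u w] orth[of e3 e2 v w] o
      by (simp add: power2_norm_eq_inner inner_add inner_commute)
    also have "\<dots> = (norm (u, v, w))\<^sup>2"
      by (simp add: norm_cscale n norm_Pair)
    finally show ?thesis by (simp add: power2_eq_iff_nonneg)
  qed
  moreover have "linear (\<lambda>(u, v, w). cscale u e1 + cscale v e2 + cscale w e3)"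
    by (rule linearI) (auto simp: linear_add[OF linear_cscale] linear_scale[OF linear_cscale] algebra_simps)
  ultimately show ?thesis
    by (auto simp: frame_def J_cscale linear_add[OF linJ])
qed

text \<open>Coordinates adapted to two vectors: \<open>y\<close> spans the first complex axis, and \<open>x\<close> lies in the first two. All
integrals over \<open>\<xi>\<close> for given \<open>x\<close> and \<open>y\<close> are computed in such coordinates.\<close>
lemma frame_exists:
  assumes y: "y \<noteq> 0"
  obtains T p1 p2 where "frame T" "T (complex_of_real (norm y), 0, 0) = y" "T (p1, p2, 0) = x"
proof -
  define e1 where "e1 = y /\<^sub>R norm y"
  have e1: "norm e1 = 1" and ye: "y = norm y *\<^sub>R e1" using y by (auto simp: e1_def)
  define p1 where "p1 = Complex (x \<bullet> e1) (x \<bullet> J e1)"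
  define x' where "x' = x - cscale p1 e1"
  have e11: "e1 \<bullet> e1 = 1" using e1 by (simp add: norm_eq_1)
  have x'o: "x' \<bullet> e1 = 0" "x' \<bullet> J e1 = 0"
    by (simp_all add: x'_def p1_def cscale_def inner_diff_left inner_add_left inner_J_J e11)
  \<comment> \<open>If \<open>x\<close> lies on the complex line through \<open>y\<close>, any second axis will do.\<close>
  have "\<exists>e2 p2. norm e2 = 1 \<and> e2 \<bullet> e1 = 0 \<and> e2 \<bullet> J e1 = 0 \<and> x' = cscale p2 e2"
  proof (cases "x' = 0")
    case True
    obtain e where "norm e = 1" "\<And>x. x \<in> {e1, J e1} \<Longrightarrow> e \<bullet> x = 0"
      by (rule unit_orthogonal_exists[of "{e1, J e1}"]) (auto simp: card_insert_if)
    then show ?thesis using True by (intro exI[of _ e] exI[of _ 0]) (auto simp: cscale_def)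
  next
    case False
    then show ?thesis using x'o
      by (intro exI[of _ "x' /\<^sub>R norm x'"] exI[of _ "complex_of_real (norm x')"]) (auto simp: cscale_def)
  qed
  then obtain e2 p2 where e2: "norm e2 = 1" "e2 \<bullet> e1 = 0" "e2 \<bullet> J e1 = 0" "x' = cscale p2 e2" by blast
  obtain e3 where e3: "norm e3 = 1" "\<And>x. x \<in> {e1, J e1, e2, J e2} \<Longrightarrow> e3 \<bullet> x = 0"
    by (rule unit_orthogonal_exists[of "{e1, J e1, e2, J e2}"]) (auto simp: card_insert_if)
  show ?thesis
  proof (rule that)
    show "frame (\<lambda>(u, v, w). cscale u e1 + cscale v e2 + cscale w e3)"
      by (rule frame_of_orthonormal) (use e1 e2 e3 in auto)
    show "(case (complex_of_real (norm y), 0, 0) of (u, v, w) \<Rightarrow> cscale u e1 + cscale v e2 + cscale w e3) = y"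
      using ye by (simp add: cscale_def)
    show "(case (p1, p2, 0) of (u, v, w) \<Rightarrow> cscale u e1 + cscale v e2 + cscale w e3) = x"
      using e2(4) by (simp add: x'_def) (simp add: cscale_def algebra_simps)
  qed
qed

section \<open>Sections by complex hyperplanes\<close>

definition complex_hyperplane :: "'e \<Rightarrow> 'e set" where
  "complex_hyperplane \<xi> = {y. \<xi> \<bullet> y = 0 \<and> J \<xi> \<bullet> y = 0}"

lemma subspace_complex_hyperplane: "subspace (complex_hyperplane \<xi>)"
  by (auto simp: complex_hyperplane_def subspace_def inner_add_right)

lemma dim_complex_hyperplane:
  assumes "\<xi> \<noteq> 0"
  shows "dim (complex_hyperplane \<xi>) = 4"
proof -
  have J0: "J \<xi> \<noteq> 0" using assms normJ[of \<xi>] by auto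
  have ne: "\<xi> \<noteq> J \<xi>" using assms skewJ[of \<xi>] by (metis inner_eq_zero_iff)
  have "independent {\<xi>, J \<xi>}"
    by (rule pairwise_orthogonal_independent) (use assms J0 in \<open>auto simp: pairwise_def orthogonal_def\<close>)
  then have d2: "dim (span {\<xi>, J \<xi>}) = 2" using ne by (simp add: dim_eq_card_independent)
  have eq: "complex_hyperplane \<xi> = {y \<in> UNIV. \<forall>x\<in>span {\<xi>, J \<xi>}. orthogonal x y}"
  proof -
    have "span {\<xi>, J \<xi>} \<subseteq> {x. orthogonal x y}" if "\<xi> \<bullet> y = 0" "J \<xi> \<bullet> y = 0" for y
      by (rule span_minimal) (use that in \<open>auto simp: orthogonal_def subspace_def inner_add_left\<close>)
    moreover have "\<xi> \<in> span {\<xi>, J \<xi>}" "J \<xi> \<in> span {\<xi>, J \<xi>}" by (auto intro: span_base)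
    ultimately show ?thesis by (fastforce simp: complex_hyperplane_def orthogonal_def)
  qed
  have "dim (complex_hyperplane \<xi>) + dim (span {\<xi>, J \<xi>}) = dim (UNIV :: 'e set)"
    unfolding eq by (rule dim_subspace_orthogonal_to_vectors) auto
  then show ?thesis using d2 dim6 by simp
qed

text \<open>Fubini's theorem along a complex hyperplane. A point is described by its complex height \<open>u\<close>, measured in
the direction of \<open>\<xi>\<close>, and by its position in the hyperplane; \<open>herm \<xi> x\<close> depends on the height only.\<close>
lemma slice_coordinates:
  assumes \<xi>: "\<xi> \<noteq> 0"
  obtains B and e :: "complex \<Rightarrow> 'e" where "finite B" "linear e" "\<And>u. norm (e u) = norm u"
    "\<And>K. K \<in> sets borel \<Longrightarrow>
       emeasure (subspace_lborel (complex_hyperplane \<xi>)) (K \<inter> complex_hyperplane \<xi>) = fiber_volume B K 0"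
    "\<And>K f. K \<in> sets borel \<Longrightarrow> f \<in> borel_measurable borel \<Longrightarrow>
       (\<integral>\<^sup>+x. f (herm \<xi> x) * indicator K x \<partial>lborel) = (\<integral>\<^sup>+u. f (norm \<xi> * norm u) * fiber_volume B K (e u) \<partial>lborel)"
proof -
  define S where "S = complex_hyperplane \<xi>"
  have sub: "subspace S" and dimS: "dim S = DIM(complex2)"
    using subspace_complex_hyperplane dim_complex_hyperplane \<xi> by (auto simp: S_def)
  obtain B and U :: "complex2 \<Rightarrow> 'e" where fin: "finite B" and linU: "linear U"
    and normU: "\<And>c. norm (U c) = norm c" and rangeU: "range U = S" and SU: "subspace_lborel S = distr lborel borel U"
    and fv: "\<And>K w. K \<in> sets borel \<Longrightarrow> fiber_volume B K w = (\<integral>\<^sup>+c. indicator K (w + U c) \<partial>lborel)"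
    by (rule subspace_lborel_coordinates[OF sub dimS]) (rule that)
  have US: "U c \<in> S" for c using rangeU by auto
  define \<eta> where "\<eta> = \<xi> /\<^sub>R norm \<xi>"
  have n\<eta>: "norm \<eta> = 1" and \<xi>\<eta>: "\<xi> = norm \<xi> *\<^sub>R \<eta>" using \<xi> by (auto simp: \<eta>_def)
  define e where "e = (\<lambda>u. cscale u \<eta>)"
  have line: "linear e" unfolding e_def by (rule linear_cscale)
  have norme: "norm (e u) = norm u" for u by (simp add: e_def norm_cscale n\<eta>)
  have \<eta>S: "\<eta> \<bullet> x = 0" "J \<eta> \<bullet> x = 0" if "x \<in> S" for x
  proof -
    have "J \<eta> = J \<xi> /\<^sub>R norm \<xi>" unfolding \<eta>_def by (rule linear_scale[OF linJ])
    then show "\<eta> \<bullet> x = 0" "J \<eta> \<bullet> x = 0"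
      using that by (auto simp: S_def complex_hyperplane_def \<eta>_def)
  qed
  define T where "T = (\<lambda>z. e (fst z) + U (snd z))"
  have linT: "linear T"
    unfolding T_def by (rule linearI) (simp_all add: linear_add[OF line] linear_add[OF linU] linear_scale[OF line] linear_scale[OF linU] scaleR_add_right)
  have normT: "norm (T z) = norm z" for z
  proof -
    have "e (fst z) \<bullet> U (snd z) = 0" using \<eta>S[OF US[of "snd z"]] by (simp add: e_def cscale_def inner_add_left)
    then have "(norm (T z))\<^sup>2 = (norm (e (fst z)))\<^sup>2 + (norm (U (snd z)))\<^sup>2"
      unfolding T_def by (simp add: power2_norm_eq_inner inner_add inner_commute)
    also have "\<dots> = (norm z)\<^sup>2" by (simp add: normU norme norm_prod_def)
    finally show ?thesis by (simp add: power2_eq_iff_nonneg)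
  qed
  have hermT: "herm \<xi> (T (u, c)) = norm \<xi> * norm u" for u c
  proof -
    have 11: "\<eta> \<bullet> \<eta> = 1" using n\<eta> by (simp add: norm_eq_1)
    have "\<eta> \<bullet> T (u, c) = Re u" "J \<eta> \<bullet> T (u, c) = Im u"
      using \<eta>S[OF US[of c]] by (simp_all add: T_def e_def cscale_def inner_add_right inner_J_J 11)
    then have "\<eta> \<bullet> T (u, c) = Re u" "\<eta> \<bullet> J (T (u, c)) = - Im u"
      using inner_J_left[of \<eta> "T (u, c)"] by simp_all
    then have "herm \<eta> (T (u, c)) = norm u"
      unfolding herm_def by (simp add: cmod_def)
    moreover have "herm (norm \<xi> *\<^sub>R \<eta>) x = norm \<xi> * herm \<eta> x" for x
      unfolding herm_def by (simp add: power_mult_distrib distrib_left[symmetric] real_sqrt_mult)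
    ultimately show ?thesis using \<xi>\<eta> by metis
  qed
  have [measurable]: "T \<in> borel_measurable borel" "e \<in> borel_measurable borel" "U \<in> borel_measurable borel"
    using linT line linU by (auto intro: linear_continuous)
  show ?thesis
  proof (rule that[of B e])
    fix K :: "'e set" assume K[measurable]: "K \<in> sets borel"
    have SC[measurable]: "S \<in> sets borel" using closed_subspace[OF sub] by simp
    have "emeasure (subspace_lborel S) (K \<inter> S) = (\<integral>\<^sup>+x. indicator (K \<inter> S) x \<partial>distr lborel borel U)"
      unfolding SU by simp
    also have "\<dots> = (\<integral>\<^sup>+c. indicator (K \<inter> S) (U c) \<partial>lborel)" by (subst nn_integral_distr) auto
    also have "\<dots> = fiber_volume B K 0" using US by (simp add: fv indicator_def)
    finally show "emeasure (subspace_lborel (complex_hyperplane \<xi>)) (K \<inter> complex_hyperplane \<xi>) = fiber_volume B K 0"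
      by (simp add: S_def)
    fix f :: "real \<Rightarrow> ennreal" assume f[measurable]: "f \<in> borel_measurable borel"
    have [measurable]: "(\<lambda>x. herm \<xi> x) \<in> borel_measurable borel" by measurable
    have "(\<integral>\<^sup>+x. f (herm \<xi> x) * indicator K x \<partial>lborel) = (\<integral>\<^sup>+z. f (herm \<xi> (T z)) * indicator K (T z) \<partial>lborel)"
      by (rule nn_integral_linear_isometry[OF linT normT]) (simp_all add: dim6)
    also have "\<dots> = (\<integral>\<^sup>+u. \<integral>\<^sup>+c. f (herm \<xi> (T (u, c))) * indicator K (T (u, c)) \<partial>lborel \<partial>lborel)"
      by (rule nn_integral_lborel_pair) measurable
    also have "\<dots> = (\<integral>\<^sup>+u. f (norm \<xi> * norm u) * fiber_volume B K (e u) \<partial>lborel)"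
      unfolding hermT fv[OF K] by (subst nn_integral_cmult) (auto simp: T_def)
    finally show "(\<integral>\<^sup>+x. f (herm \<xi> x) * indicator K x \<partial>lborel) = (\<integral>\<^sup>+u. f (norm \<xi> * norm u) * fiber_volume B K (e u) \<partial>lborel)" .
  qed (use fin line norme in auto)
qed

text \<open>In slice coordinates, writing the complex height on the right-hand side as \<open>u / 2\<close> turns that side into the
left-hand side with the section at height \<open>u / 2\<close> in place of the one at height \<open>u\<close>, and by Brunn's
theorem the section at \<open>u / 2\<close> is at least as large.\<close>
lemma Gaussian_slice_positivity:
  assumes K: "K \<in> sets borel" "convex K" "\<And>x. x \<in> K \<Longrightarrow> - x \<in> K"
  shows "(\<integral>\<^sup>+x. ennreal (exp (- a * (herm \<xi> x)\<^sup>2)) * indicator K x \<partial>lborel)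
     \<le> (\<integral>\<^sup>+x. ennreal (4 * exp (- 4 * a * (herm \<xi> x)\<^sup>2)) * indicator K x \<partial>lborel)"
proof (cases "\<xi> = 0")
  case True
  then show ?thesis by (intro nn_integral_mono) (simp add: herm_def indicator_def)
next
  case False
  obtain B and e :: "complex \<Rightarrow> 'e" where B: "finite B" and e: "linear e" and sl:
    "\<And>K f. K \<in> sets borel \<Longrightarrow> f \<in> borel_measurable borel \<Longrightarrow>
       (\<integral>\<^sup>+x. f (herm \<xi> x) * indicator K x \<partial>lborel) = (\<integral>\<^sup>+u. f (norm \<xi> * norm u) * fiber_volume B K (e u) \<partial>lborel)"
    by (rule slice_coordinates[OF False]) (rule that)
  have [measurable]: "e \<in> borel_measurable borel"
    using e by (auto intro: linear_continuous)
  note [measurable] = fiber_volume_measurable[OF B K(1)]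
  have "(\<integral>\<^sup>+x. ennreal (exp (- a * (herm \<xi> x)\<^sup>2)) * indicator K x \<partial>lborel)
     = (\<integral>\<^sup>+u. ennreal (exp (- a * (norm \<xi> * norm u)\<^sup>2)) * fiber_volume B K (e u) \<partial>lborel)"
    by (rule sl[OF K(1), of "\<lambda>t. ennreal (exp (- a * t\<^sup>2))"]) measurable
  also have "\<dots> \<le> (\<integral>\<^sup>+u. ennreal (exp (- a * (norm \<xi> * norm u)\<^sup>2)) * fiber_volume B K (e ((1/2) *\<^sub>R u)) \<partial>lborel)"
    by (intro nn_integral_mono mult_left_mono) (auto simp: linear_scale[OF e] intro: fiber_volume_halfway[OF B K])
  also have "\<dots> = ennreal (2 ^ DIM(complex)) * (\<integral>\<^sup>+u. ennreal (exp (- a * (norm \<xi> * norm (2 *\<^sub>R u))\<^sup>2)) * fiber_volume B K (e ((1/2) *\<^sub>R (2 *\<^sub>R u))) \<partial>lborel)"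
    by (rule nn_integral_lborel_scale) auto
  also have "\<dots> = (\<integral>\<^sup>+u. ennreal (4 * exp (- 4 * a * (norm \<xi> * norm u)\<^sup>2)) * fiber_volume B K (e u) \<partial>lborel)"
  proof -
    have "ennreal (2 ^ DIM(complex)) * (ennreal (exp (- a * (norm \<xi> * norm (2 *\<^sub>R u))\<^sup>2)) * fiber_volume B K (e ((1/2) *\<^sub>R (2 *\<^sub>R u))))
        = ennreal (4 * exp (- 4 * a * (norm \<xi> * norm u)\<^sup>2)) * fiber_volume B K (e u)" for u
    proof -
      have "- a * (norm \<xi> * norm (2 *\<^sub>R u))\<^sup>2 = - 4 * a * (norm \<xi> * norm u)\<^sup>2"
        by (simp add: power_mult_distrib)
      then show ?thesis by (simp only:) (simp add: ennreal_mult mult.assoc)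
    qed
    then show ?thesis by (subst nn_integral_cmult[symmetric]) simp_all
  qed
  also have "\<dots> = (\<integral>\<^sup>+x. ennreal (4 * exp (- 4 * a * (herm \<xi> x)\<^sup>2)) * indicator K x \<partial>lborel)"
    by (rule sl[OF K(1), symmetric, of "\<lambda>t. ennreal (4 * exp (- 4 * a * t\<^sup>2))"]) measurable
  finally show ?thesis .
qed

text \<open>Sections of \<open>K\<close> parallel to the hyperplane are at most as large as the central one, which is at most as
large as the central section of \<open>L\<close>; and a translate of the latter by a vector of length at most \<open>r\<close> fits
into \<open>L'\<close>. The margin makes an estimate of exact central sections into one for slabs of positive width.\<close>
lemma thin_slab_comparison:
  assumes K: "K \<in> sets borel" "convex K" "\<And>x. x \<in> K \<Longrightarrow> - x \<in> K" and L[measurable]: "L \<in> sets borel" "L' \<in> sets borel"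
    and sec: "emeasure (subspace_lborel (complex_hyperplane \<xi>)) (K \<inter> complex_hyperplane \<xi>)
      \<le> emeasure (subspace_lborel (complex_hyperplane \<xi>)) (L \<inter> complex_hyperplane \<xi>)"
    and margin: "\<And>x y. x \<in> L \<Longrightarrow> norm y \<le> r \<Longrightarrow> x + y \<in> L'"
    and \<xi>: "\<xi> \<noteq> 0" and \<delta>: "\<delta> \<le> r * norm \<xi>"
  shows "(\<integral>\<^sup>+x. indicator {..\<delta>} (herm \<xi> x) * indicator K x \<partial>lborel) \<le> (\<integral>\<^sup>+x. indicator {..\<delta>} (herm \<xi> x) * indicator L' x \<partial>lborel)"
proof -
  obtain B and e :: "complex \<Rightarrow> 'e" where B: "finite B" and e: "linear e" "\<And>u. norm (e u) = norm u" and
    z: "\<And>K. K \<in> sets borel \<Longrightarrow>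
       emeasure (subspace_lborel (complex_hyperplane \<xi>)) (K \<inter> complex_hyperplane \<xi>) = fiber_volume B K 0"
    and sl: "\<And>K f. K \<in> sets borel \<Longrightarrow> f \<in> borel_measurable borel \<Longrightarrow>
       (\<integral>\<^sup>+x. f (herm \<xi> x) * indicator K x \<partial>lborel) = (\<integral>\<^sup>+u. f (norm \<xi> * norm u) * fiber_volume B K (e u) \<partial>lborel)"
    by (rule slice_coordinates[OF \<xi>]) (rule that)
  have "fiber_volume B K (e u) \<le> fiber_volume B L' (e u)" if "norm \<xi> * norm u \<le> \<delta>" for u
  proof -
    have "norm \<xi> * norm u \<le> norm \<xi> * r" using that \<delta> by (simp add: mult.commute)
    then have u: "norm (e u) \<le> r" using \<xi> e by simp
    have "fiber_volume B K (e u) \<le> fiber_volume B K 0" by (rule fiber_volume_central_max[OF B K])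
    also have "\<dots> \<le> fiber_volume B L 0" using sec z[OF K(1)] z[OF L(1)] by simp
    also have "\<dots> \<le> fiber_volume B L' (e u)"
    proof -
      have "e u + x \<in> L'" if "x \<in> L" for x using margin[OF that u] by (simp add: add.commute)
      then show ?thesis unfolding fiber_volume_def
        by (intro nn_integral_mono) (auto simp: indicator_def)
    qed
    finally show ?thesis .
  qed
  then show ?thesis
    unfolding sl[OF K(1), of "indicator {..\<delta>}", simplified] sl[OF L(2), of "indicator {..\<delta>}", simplified]
    by (intro nn_integral_mono) (auto simp: indicator_def)
qed

section \<open>Averaging over all complex hyperplanes\<close>

text \<open>The squared distance of \<open>x\<close> from the complex line through \<open>y\<close>, for \<open>y \<noteq> 0\<close>.\<close>
definition line_dist2 :: "'e \<Rightarrow> 'e \<Rightarrow> real" where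
  "line_dist2 y x = (norm x)\<^sup>2 - (herm y x)\<^sup>2 / (norm y)\<^sup>2"

lemma frame_D:
  assumes "frame T"
  shows "linear T" "norm (T z) = norm z" "T (\<i> * u, \<i> * v, \<i> * w) = J (T (u, v, w))"
  using assms unfolding frame_def by blast+

lemma frame_measurable: "frame T \<Longrightarrow> T \<in> borel_measurable borel"
  by (auto intro: linear_continuous simp: frame_def)

lemma line_dist2_frame:
  assumes T: "frame T" and y: "y \<noteq> 0" "T (complex_of_real (norm y), 0, 0) = y"
  shows "line_dist2 y (T (u, v, w)) = (norm (v, w))\<^sup>2"
proof -
  have "herm y (T (u, v, w)) = norm y * norm u"
    using herm_frame[OF T, of "complex_of_real (norm y)" 0 0 u v w] y(2) by (simp add: norm_mult)
  then show ?thesis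
    using y(1) by (simp add: line_dist2_def frame_D(2)[OF T] norm_Pair power_mult_distrib)
qed

text \<open>The result of integrating over \<open>\<xi>\<close> first. The cut-off \<open>\<delta> \<le> r * norm \<xi>\<close> keeps only those \<open>\<xi>\<close> for which
slabs of half-width \<open>\<delta>\<close> can be compared; it disappears as \<open>\<delta>\<close> tends to zero.\<close>
definition slab_kernel :: "real \<Rightarrow> real \<Rightarrow> real \<Rightarrow> 'e \<Rightarrow> 'e \<Rightarrow> real" where
  "slab_kernel r a \<delta> x y = (\<integral>\<xi>. indicator {\<delta>..} (r * norm \<xi>) * weight (norm \<xi>) * profile a (herm \<xi> x) * indicator {..\<delta>} (herm \<xi> y) \<partial>lborel)"

text \<open>In coordinates adapted to \<open>y\<close> and \<open>x\<close> the slab condition bounds the first coordinate of \<open>\<xi>\<close> by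
\<open>\<delta> / norm y\<close>. Rescaling that coordinate by \<open>\<delta>\<close> produces the factor \<open>\<delta>\<^sup>2\<close>, and in the limit the first
coordinate separates: it contributes the area of a disc of radius \<open>1 / norm y\<close>, and the other two contribute
\<open>kernel_integral\<close> with \<open>q\<close> the distance of \<open>x\<close> from the complex line through \<open>y\<close>.\<close>
lemma slab_kernel_limit:
  assumes y: "y \<noteq> 0" and a: "a > 0" and r: "r > 0"
  shows "\<And>\<delta>. \<delta> > 0 \<Longrightarrow> \<bar>slab_kernel r a \<delta> x y / \<delta>\<^sup>2\<bar> \<le> 5 * pi ^ 3 / (norm y)\<^sup>2"
    and "\<And>d. (\<And>k. d k > 0) \<Longrightarrow> d \<longlonglongrightarrow> 0 \<Longrightarrow>
       (\<lambda>k. slab_kernel r a (d k) x y / (d k)\<^sup>2) \<longlonglongrightarrow> pi ^ 3 / (norm y)\<^sup>2 * radial_kernel (a * line_dist2 y x)"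
proof -
  obtain T p1 p2 where T: "frame T" and Ty: "T (complex_of_real (norm y), 0, 0) = y" and Tx: "T (p1, p2, 0) = x"
    using frame_exists[OF y] by metis
  note [measurable] = frame_measurable[OF T]
  have hx: "herm (T (u, v, w)) x = norm (cnj p1 * u + cnj p2 * v)" for u v w
    using herm_frame[OF T, of p1 p2 0 u v w] Tx by (simp add: herm_commute)
  have hy: "herm (T (u, v, w)) y = norm y * norm u" for u v w
    using herm_frame[OF T, of "complex_of_real (norm y)" 0 0 u v w] Ty by (simp add: herm_commute norm_mult)
  have q: "line_dist2 y x = (norm p2)\<^sup>2"
    using line_dist2_frame[OF T y Ty, of p1 p2 0] Tx by (simp add: norm_Pair)
  define G where "G = (\<lambda>\<delta> (z :: complex3).
     indicator {\<delta>..} (r * norm (\<delta> *\<^sub>R fst z, snd z)) * weight (norm (\<delta> *\<^sub>R fst z, snd z))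
       * profile a (norm (cnj p1 * (\<delta> *\<^sub>R fst z) + cnj p2 * fst (snd z))) * indicator (cball 0 (1 / norm y)) (fst z) :: real)"
  define G0 where "G0 = (\<lambda>z :: complex3.
     indicator (cball 0 (1 / norm y)) (fst z) * (weight (norm (snd z)) * profile a (norm p2 * norm (fst (snd z)))) :: real)"
  define M where "M = (\<lambda>z :: complex3.
     (5 * indicator (cball 0 (1 / norm y)) (fst z)) * (exp (- 1 * (norm (fst (snd z)))\<^sup>2) * exp (- 1 * (norm (snd (snd z)))\<^sup>2)) :: real)"
  have Gm[measurable]: "G \<delta> \<in> borel_measurable lborel" for \<delta>
  proof -
    have b1: "(\<lambda>z :: complex3. norm (\<delta> *\<^sub>R fst z, snd z)) \<in> borel_measurable borel"
      and b2: "(\<lambda>z :: complex3. norm (cnj p1 * (\<delta> *\<^sub>R fst z) + cnj p2 * fst (snd z))) \<in> borel_measurable borel"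
      and b3: "(fst :: complex3 \<Rightarrow> complex) \<in> borel_measurable borel"
      by (intro borel_measurable_continuous_onI continuous_intros)+
    have "(\<lambda>z :: complex3. indicator {\<delta>..} (r * norm (\<delta> *\<^sub>R fst z, snd z)) :: real) \<in> borel_measurable borel"
      by (rule measurable_compose[OF b1]) measurable
    moreover have "(\<lambda>z :: complex3. weight (norm (\<delta> *\<^sub>R fst z, snd z))) \<in> borel_measurable borel"
      by (rule measurable_compose[OF b1]) measurable
    moreover have "(\<lambda>z :: complex3. profile a (norm (cnj p1 * (\<delta> *\<^sub>R fst z) + cnj p2 * fst (snd z)))) \<in> borel_measurable borel"
      by (rule measurable_compose[OF b2]) measurable
    moreover have "(\<lambda>z :: complex3. indicator (cball 0 (1 / norm y)) (fst z) :: real) \<in> borel_measurable borel"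
      by (rule measurable_compose[OF b3 borel_measurable_indicator]) simp
    ultimately have "G \<delta> \<in> borel_measurable borel" unfolding G_def by (intro borel_measurable_times)
    then show ?thesis by simp
  qed
  have scaled: "slab_kernel r a \<delta> x y = \<delta>\<^sup>2 * (\<integral>z. G \<delta> z \<partial>lborel)" if \<delta>: "\<delta> > 0" for \<delta>
  proof -
    have [measurable]: "(\<lambda>\<xi>. herm \<xi> x) \<in> borel_measurable borel" "(\<lambda>\<xi>. herm \<xi> y) \<in> borel_measurable borel"
      by measurable
    have "slab_kernel r a \<delta> x y = (\<integral>z. indicator {\<delta>..} (r * norm (T z)) * weight (norm (T z)) * profile a (herm (T z) x) * indicator {..\<delta>} (herm (T z) y) \<partial>lborel)"
      unfolding slab_kernel_def
      by (rule integral_linear_isometry[OF frame_D(1,2)[OF T]]) (simp_all add: dim6)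
    also have "\<dots> = \<delta> ^ DIM(complex) * (\<integral>z. indicator {\<delta>..} (r * norm (T (\<delta> *\<^sub>R fst z, snd z))) * weight (norm (T (\<delta> *\<^sub>R fst z, snd z)))
        * profile a (herm (T (\<delta> *\<^sub>R fst z, snd z)) x) * indicator {..\<delta>} (herm (T (\<delta> *\<^sub>R fst z, snd z)) y) \<partial>lborel)"
      by (rule integral_lborel_scale_fst[OF _ \<delta>]) measurable
    also have "\<dots> = \<delta>\<^sup>2 * (\<integral>z. G \<delta> z \<partial>lborel)"
    proof -
      have "indicator {..\<delta>} (herm (T (\<delta> *\<^sub>R fst z, snd z)) y) = (indicator (cball 0 (1 / norm y)) (fst z) :: real)" for z
        using y \<delta> by (cases z) (auto simp: hy indicator_def field_simps)
      moreover have "herm (T (\<delta> *\<^sub>R fst z, snd z)) x = norm (cnj p1 * (\<delta> *\<^sub>R fst z) + cnj p2 * fst (snd z))" for z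
        by (cases z) (simp add: hx)
      ultimately show ?thesis by (simp add: G_def frame_D(2)[OF T])
    qed
    finally show ?thesis .
  qed
  have M: "integrable lborel M" "(\<integral>z. M z \<partial>lborel) = 5 * pi ^ 3 / (norm y)\<^sup>2"
  proof -
    have 1: "integrable lborel (\<lambda>u::complex. 5 * indicator (cball 0 (1 / norm y)) u :: real)"
      by (intro integrable_mult_right integrable_indicator_cball)
    have 2: "(\<integral>u. 5 * indicator (cball 0 (1 / norm y)) (u :: complex) \<partial>lborel) = 5 * (pi / (norm y)\<^sup>2)"
      by (simp add: measure_cball_complex power_divide)
    have 3: "integrable lborel (\<lambda>z :: complex2. exp (- 1 * (norm (fst z))\<^sup>2) * exp (- 1 * (norm (snd z))\<^sup>2))"
      "(\<integral>z. exp (- 1 * (norm (fst (z :: complex2)))\<^sup>2) * exp (- 1 * (norm (snd z))\<^sup>2) \<partial>lborel) = pi * pi"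
      using integrable_lborel_product[OF Gaussian_complex(1)[of 1] Gaussian_complex(1)[of 1]] Gaussian_complex(2)[of 1] by simp_all
    show "integrable lborel M" "(\<integral>z. M z \<partial>lborel) = 5 * pi ^ 3 / (norm y)\<^sup>2"
      unfolding M_def using integrable_lborel_product[OF 1 3(1)] unfolding 2 3(2)
      by (simp_all add: power3_eq_cube)
  qed
  have GM: "\<bar>G \<delta> z\<bar> \<le> M z" if \<delta>: "\<delta> > 0" for \<delta> z
  proof -
    let ?W = "weight (norm (\<delta> *\<^sub>R fst z, snd z))" and ?P = "profile a (norm (cnj p1 * (\<delta> *\<^sub>R fst z) + cnj p2 * fst (snd z)))"
    let ?I = "indicator (cball 0 (1 / norm y)) (fst z) :: real"
    have e: "exp (- 1 * (norm (fst (snd z)))\<^sup>2) * exp (- 1 * (norm (snd (snd z)))\<^sup>2) = exp (- (norm (snd z))\<^sup>2)"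
      by (simp add: norm_prod_def exp_add[symmetric])
    have "?W \<le> exp (- (norm (\<delta> *\<^sub>R fst z, snd z))\<^sup>2)" by (rule weight_bounds)
    also have "\<dots> \<le> exp (- (norm (snd z))\<^sup>2)" by (simp add: norm_Pair)
    finally have W: "\<bar>?W\<bar> \<le> exp (- (norm (snd z))\<^sup>2)" using weight_bounds(1)[of "norm (\<delta> *\<^sub>R fst z, snd z)"] by linarith
    have "\<bar>G \<delta> z\<bar> = \<bar>indicator {\<delta>..} (r * norm (\<delta> *\<^sub>R fst z, snd z))\<bar> * \<bar>?W\<bar> * \<bar>?P\<bar> * ?I"
      by (simp add: G_def abs_mult)
    also have "\<dots> \<le> 1 * exp (- (norm (snd z))\<^sup>2) * 5 * ?I"
      using W profile_bound[of a] a by (intro mult_mono) (auto simp: indicator_def)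
    also have "\<dots> = M z" unfolding M_def e by simp
    finally show ?thesis .
  qed
  show "\<bar>slab_kernel r a \<delta> x y / \<delta>\<^sup>2\<bar> \<le> 5 * pi ^ 3 / (norm y)\<^sup>2" if \<delta>: "\<delta> > 0" for \<delta>
  proof -
    have "\<bar>\<integral>z. G \<delta> z \<partial>lborel\<bar> \<le> (\<integral>z. M z \<partial>lborel)"
    proof -
      have "integrable lborel (G \<delta>)"
      proof (rule Bochner_Integration.integrable_bound[OF M(1) Gm])
        show "AE z in lborel. norm (G \<delta> z) \<le> norm (M z)" using GM[OF \<delta>] by (intro always_eventually allI) (metis abs_ge_self order_trans real_norm_def)
      qed
      then have "(\<integral>z. norm (G \<delta> z) \<partial>lborel) \<le> (\<integral>z. M z \<partial>lborel)"
        using M(1) GM[OF \<delta>] by (intro integral_mono) auto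
      moreover have "norm (\<integral>z. G \<delta> z \<partial>lborel) \<le> (\<integral>z. norm (G \<delta> z) \<partial>lborel)" by (rule integral_norm_bound)
      ultimately show ?thesis unfolding real_norm_def by linarith
    qed
    then show ?thesis using \<delta> M(2) by (simp add: scaled)
  qed
  fix d :: "nat \<Rightarrow> real" assume d: "\<And>k. d k > 0" and d0: "d \<longlonglongrightarrow> 0"
  have pointwise: "(\<lambda>k. G (d k) z) \<longlonglongrightarrow> G0 z" for z
  proof -
    obtain u c where z: "z = (u, c)" by (cases z)
    have N: "(\<lambda>k. norm (d k *\<^sub>R u, c)) \<longlonglongrightarrow> norm c"
      by (rule tendsto_eq_intros d0 refl)+ (simp add: norm_Pair)
    have W: "(\<lambda>k. weight (norm (d k *\<^sub>R u, c))) \<longlonglongrightarrow> weight (norm c)"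
      unfolding weight_def by (intro tendsto_intros N)
    \<comment> \<open>The cut-off tends to one unless \<open>c = 0\<close>, and there the weight itself tends to zero.\<close>
    have W': "(\<lambda>k. indicator {d k..} (r * norm (d k *\<^sub>R u, c)) * weight (norm (d k *\<^sub>R u, c))) \<longlonglongrightarrow> weight (norm c)"
    proof (cases "c = 0")
      case True
      have "(\<lambda>k. indicator {d k..} (r * norm (d k *\<^sub>R u, c)) * weight (norm (d k *\<^sub>R u, c))) \<longlonglongrightarrow> 0"
      proof (rule Lim_null_comparison)
        show "(\<lambda>k. weight (norm (d k *\<^sub>R u, c))) \<longlonglongrightarrow> 0" using W True by (simp add: weight_def)
        show "\<forall>\<^sub>F k in sequentially. norm (indicator {d k..} (r * norm (d k *\<^sub>R u, c)) * weight (norm (d k *\<^sub>R u, c))) \<le> weight (norm (d k *\<^sub>R u, c))"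
          using weight_bounds(1) by (intro always_eventually) (auto simp: indicator_def)
      qed
      then show ?thesis using True by (simp add: weight_def)
    next
      case False
      then have "r * norm c > 0" using r by simp
      then have "\<forall>\<^sub>F k in sequentially. d k < r * norm c" using order_tendstoD(2)[OF d0] by simp
      then have "\<forall>\<^sub>F k in sequentially. weight (norm (d k *\<^sub>R u, c)) = indicator {d k..} (r * norm (d k *\<^sub>R u, c)) * weight (norm (d k *\<^sub>R u, c))"
      proof (rule eventually_mono)
        fix k assume "d k < r * norm c"
        moreover have "norm c \<le> norm (d k *\<^sub>R u, c)" by (simp add: norm_Pair real_le_rsqrt)
        then have "r * norm c \<le> r * norm (d k *\<^sub>R u, c)" using r by simp
        ultimately show "weight (norm (d k *\<^sub>R u, c)) = indicator {d k..} (r * norm (d k *\<^sub>R u, c)) * weight (norm (d k *\<^sub>R u, c))"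
          by (simp add: indicator_def)
      qed
      from Lim_transform_eventually[OF W this] show ?thesis .
    qed
    have "(\<lambda>k. norm (cnj p1 * (d k *\<^sub>R u) + cnj p2 * fst c)) \<longlonglongrightarrow> norm p2 * norm (fst c)"
      by (rule tendsto_eq_intros d0 refl)+ (simp add: norm_mult)
    then have "(\<lambda>k. profile a (norm (cnj p1 * (d k *\<^sub>R u) + cnj p2 * fst c))) \<longlonglongrightarrow> profile a (norm p2 * norm (fst c))"
      unfolding profile_def by (intro tendsto_intros)
    from tendsto_mult[OF tendsto_mult[OF W' this] tendsto_const[of "indicator (cball 0 (1 / norm y)) u :: real"]]
    show ?thesis by (simp add: G_def G0_def z mult_ac)
  qed
  have G0m[measurable]: "G0 \<in> borel_measurable lborel"
    by (rule borel_measurable_LIMSEQ_real[OF pointwise]) measurable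
  have lim: "(\<lambda>k. \<integral>z. G (d k) z \<partial>lborel) \<longlonglongrightarrow> (\<integral>z. G0 z \<partial>lborel)"
    by (rule integral_dominated_convergence[OF G0m Gm M(1)]) (use pointwise GM d in auto)
  have "(\<integral>z. G0 z \<partial>lborel) = pi / (norm y)\<^sup>2 * (pi\<^sup>2 * radial_kernel (a * line_dist2 y x))"
  proof -
    have m: "(\<lambda>z :: complex2. weight (norm z) * profile a (norm p2 * norm (fst z))) \<in> borel_measurable borel"
    proof -
      have [measurable]: "(\<lambda>z :: complex2. norm p2 * norm (fst z)) \<in> borel_measurable borel"
        by (intro borel_measurable_continuous_onI continuous_intros)
      show ?thesis by measurable
    qed
    have int: "integrable lborel (\<lambda>z :: complex2. weight (norm z) * profile a (norm p2 * norm (fst z)))"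
    proof (rule Bochner_Integration.integrable_bound)
      show "integrable lborel (\<lambda>z :: complex2. 5 * (exp (- 1 * (norm (fst z))\<^sup>2) * exp (- 1 * (norm (snd z))\<^sup>2)))"
        by (intro integrable_mult_right integrable_lborel_product Gaussian_complex(1)) auto
      have "\<bar>weight (norm z) * profile a (norm p2 * norm (fst z))\<bar> \<le> 5 * (exp (- 1 * (norm (fst z))\<^sup>2) * exp (- 1 * (norm (snd z))\<^sup>2))" for z :: "complex2"
      proof -
        have "exp (- 1 * (norm (fst z))\<^sup>2) * exp (- 1 * (norm (snd z))\<^sup>2) = exp (- (norm z)\<^sup>2)"
          by (simp add: norm_prod_def exp_add[symmetric])
        then show ?thesis
          using mult_mono[OF weight_bounds(2)[of "norm z"] profile_bound[of a "norm p2 * norm (fst z)"]] a weight_bounds(1)[of "norm z"]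
          by (simp add: abs_mult)
      qed
      then show "AE z in lborel. norm (weight (norm z) * profile a (norm p2 * norm (fst (z :: complex2)))) \<le> norm (5 * (exp (- 1 * (norm (fst z))\<^sup>2) * exp (- 1 * (norm (snd z :: complex))\<^sup>2)))"
        by (intro always_eventually allI) (simp add: abs_mult)
    qed (use m in simp)
    have "(\<integral>z. G0 z \<partial>lborel) = (\<integral>u. indicator (cball 0 (1 / norm y)) (u :: complex) \<partial>lborel) *
        (\<integral>z. weight (norm (z :: complex2)) * profile a (norm p2 * norm (fst z)) \<partial>lborel)"
      unfolding G0_def by (rule integrable_lborel_product(2)[OF integrable_indicator_cball int])
    also have "(\<integral>u. indicator (cball 0 (1 / norm y)) (u :: complex) \<partial>lborel) = pi / (norm y)\<^sup>2"
      by (simp add: measure_cball_complex power_divide)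
    finally show ?thesis by (simp add: kernel_integral[OF a] q)
  qed
  then have "(\<integral>z. G0 z \<partial>lborel) = pi ^ 3 / (norm y)\<^sup>2 * radial_kernel (a * line_dist2 y x)"
    by (simp add: power2_eq_square power3_eq_cube)
  moreover have "slab_kernel r a (d k) x y / (d k)\<^sup>2 = (\<integral>z. G (d k) z \<partial>lborel)" for k
    using scaled[OF d[of k]] d[of k] by simp
  ultimately show "(\<lambda>k. slab_kernel r a (d k) x y / (d k)\<^sup>2) \<longlonglongrightarrow> pi ^ 3 / (norm y)\<^sup>2 * radial_kernel (a * line_dist2 y x)"
    using lim by simp
qed

lemma herm_measurable1[measurable]: "(\<lambda>x. herm \<xi> x) \<in> borel_measurable borel"
  by measurable

lemma Gaussian_slice_integral_nonneg:
  assumes K: "K \<in> sets borel" "convex K" "\<And>x. x \<in> K \<Longrightarrow> - x \<in> K" and b: "bounded K" and a: "a > 0"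
  shows "0 \<le> (\<integral>x. indicator K x * profile a (herm \<xi> x) \<partial>lborel)"
proof -
  have i1: "integrable lborel (\<lambda>x. indicator K x * (4 * exp (- 4 * a * (herm \<xi> x)\<^sup>2)))"
    by (rule integrable_indicator_bounded[OF K(1) b, where c = 4]) (use a in auto)
  have i2: "integrable lborel (\<lambda>x. indicator K x * exp (- a * (herm \<xi> x)\<^sup>2))"
    by (rule integrable_indicator_bounded[OF K(1) b, where c = 1]) (use a in auto)
  have "(\<integral>x. indicator K x * exp (- a * (herm \<xi> x)\<^sup>2) \<partial>lborel) \<le> (\<integral>x. indicator K x * (4 * exp (- 4 * a * (herm \<xi> x)\<^sup>2)) \<partial>lborel)"
  proof (rule integral_le_of_nn_integral_le[OF i2 i1])
    have e: "ennreal (indicator K x * t) = ennreal t * indicator K x" for x t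
      by (simp add: indicator_def)
    show "(\<integral>\<^sup>+x. ennreal (indicator K x * exp (- a * (herm \<xi> x)\<^sup>2)) \<partial>lborel) \<le> (\<integral>\<^sup>+x. ennreal (indicator K x * (4 * exp (- 4 * a * (herm \<xi> x)\<^sup>2))) \<partial>lborel)"
      unfolding e by (rule Gaussian_slice_positivity[OF K])
  qed auto
  moreover have "(\<integral>x. indicator K x * profile a (herm \<xi> x) \<partial>lborel) = (\<integral>x. indicator K x * (4 * exp (- 4 * a * (herm \<xi> x)\<^sup>2)) \<partial>lborel) - (\<integral>x. indicator K x * exp (- a * (herm \<xi> x)\<^sup>2) \<partial>lborel)"
    unfolding profile_def right_diff_distrib by (rule Bochner_Integration.integral_diff[OF i1 i2])
  ultimately show ?thesis by simp
qed

text \<open>For fixed \<open>\<xi>\<close> the integral over \<open>x\<close> and \<open>y\<close> is a product of the two quantities that are nonnegative by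
\<open>Gaussian_slice_integral_nonneg\<close> and by the comparison of slabs. Integrating over \<open>\<xi>\<close> first instead gives
the \<open>slab_kernel\<close>.\<close>
lemma slab_pairing_nonneg:
  assumes K[measurable]: "K \<in> sets borel" and Kc: "convex K" "\<And>x. x \<in> K \<Longrightarrow> - x \<in> K" and bK: "bounded K"
    and L[measurable]: "L \<in> sets borel" and bL: "bounded L" and a: "a > 0" and \<delta>: "\<delta> > 0"
    and slab: "\<And>\<xi>. \<xi> \<noteq> 0 \<Longrightarrow> \<delta> \<le> r * norm \<xi> \<Longrightarrow>
      (\<integral>\<^sup>+x. indicator {..\<delta>} (herm \<xi> x) * indicator K x \<partial>lborel) \<le> (\<integral>\<^sup>+x. indicator {..\<delta>} (herm \<xi> x) * indicator L x \<partial>lborel)"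
  shows "integrable lborel (\<lambda>p. indicator K (fst p) * (indicator L (snd p) - indicator K (snd p)) * slab_kernel r a \<delta> (fst p) (snd p))"
    and "0 \<le> (\<integral>p. indicator K (fst p) * (indicator L (snd p) - indicator K (snd p)) * slab_kernel r a \<delta> (fst p) (snd p) \<partial>lborel)"
proof -
  define g where "g = (\<lambda>p :: 'e \<times> 'e. indicator K (fst p) * (indicator L (snd p) - indicator K (snd p)) :: real)"
  define S where "S = (\<lambda>\<xi> (p :: 'e \<times> 'e). indicator {\<delta>..} (r * norm \<xi>) * weight (norm \<xi>) * profile a (herm \<xi> (fst p)) * indicator {..\<delta>} (herm \<xi> (snd p)) :: real)"
  have ind_int: "integrable lborel (indicator K :: 'e \<Rightarrow> real)" "integrable lborel (indicator L :: 'e \<Rightarrow> real)"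
    using emeasure_bounded_finite[OF bK] emeasure_bounded_finite[OF bL] by (auto intro!: integrable_real_indicator)
  have g_int: "integrable lborel g"
    unfolding g_def by (intro integrable_lborel_product ind_int Bochner_Integration.integrable_diff)
  have gm[measurable]: "g \<in> borel_measurable (borel \<Otimes>\<^sub>M borel)" unfolding g_def by measurable
  have Sm[measurable]: "(\<lambda>z. S (snd z) (fst z)) \<in> borel_measurable ((borel \<Otimes>\<^sub>M borel) \<Otimes>\<^sub>M borel)"
    unfolding S_def by measurable
  have Q_int: "integrable lborel (\<lambda>z :: ('e \<times> 'e) \<times> 'e. g (fst z) * S (snd z) (fst z))"
  proof (rule Bochner_Integration.integrable_bound)
    show "integrable lborel (\<lambda>z :: ('e \<times> 'e) \<times> 'e. (5 * g (fst z)) * exp (- 1 * (norm (snd z))\<^sup>2))"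
      using g_int by (intro integrable_lborel_product integrable_mult_right Gaussian_euclidean) auto
    have "(\<lambda>z :: ('e \<times> 'e) \<times> 'e. g (fst z) * S (snd z) (fst z)) \<in> borel_measurable ((borel \<Otimes>\<^sub>M borel) \<Otimes>\<^sub>M borel)"
      by measurable
    then show "(\<lambda>z :: ('e \<times> 'e) \<times> 'e. g (fst z) * S (snd z) (fst z)) \<in> borel_measurable lborel"
      by (simp add: borel_prod)
    have S_bound: "\<bar>S \<xi> p\<bar> \<le> 5 * exp (- 1 * (norm \<xi>)\<^sup>2)" for \<xi> p
    proof -
      have "\<bar>S \<xi> p\<bar> = indicator {\<delta>..} (r * norm \<xi>) * weight (norm \<xi>) * \<bar>profile a (herm \<xi> (fst p))\<bar> * indicator {..\<delta>} (herm \<xi> (snd p))"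
        using weight_bounds(1) by (simp add: S_def abs_mult)
      also have "\<dots> \<le> 1 * exp (- (norm \<xi>)\<^sup>2) * 5 * 1"
        using weight_bounds profile_bound[of a] a by (intro mult_mono) (auto simp: indicator_def)
      finally show ?thesis by simp
    qed
    show "AE z in lborel. norm (g (fst z) * S (snd z) (fst z)) \<le> norm (5 * g (fst z) * exp (- 1 * (norm (snd z))\<^sup>2))"
    proof (intro always_eventually allI)
      fix z :: "('e \<times> 'e) \<times> 'e"
      have "\<bar>g (fst z)\<bar> * \<bar>S (snd z) (fst z)\<bar> \<le> \<bar>g (fst z)\<bar> * (5 * exp (- 1 * (norm (snd z))\<^sup>2))"
        by (rule mult_left_mono) (use S_bound in simp_all)
      then show "norm (g (fst z) * S (snd z) (fst z)) \<le> norm (5 * g (fst z) * exp (- 1 * (norm (snd z))\<^sup>2))"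
        by (simp add: abs_mult)
    qed
  qed
  then have Q_int': "integrable (lborel \<Otimes>\<^sub>M lborel) (\<lambda>(p, \<xi>). g p * S \<xi> p)"
    by (simp add: lborel_prod split_beta')
  have inner: "(\<integral>\<xi>. g p * S \<xi> p \<partial>lborel) = g p * slab_kernel r a \<delta> (fst p) (snd p)" for p
    by (simp add: S_def slab_kernel_def)
  show "integrable lborel (\<lambda>p. indicator K (fst p) * (indicator L (snd p) - indicator K (snd p)) * slab_kernel r a \<delta> (fst p) (snd p))"
    using lborel_pair.integrable_fst[OF Q_int'] unfolding prod.case inner by (simp only: g_def)
  have "(\<integral>p. g p * slab_kernel r a \<delta> (fst p) (snd p) \<partial>lborel) = (\<integral>\<xi>. (\<integral>p. g p * S \<xi> p \<partial>lborel) \<partial>lborel)"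
    using lborel_pair.Fubini_integral[OF Q_int'] unfolding prod.case inner by simp
  also have "\<dots> \<ge> 0"
  proof (rule Bochner_Integration.integral_nonneg)
    fix \<xi> :: 'e
    define W where "W = indicator {\<delta>..} (r * norm \<xi>) * weight (norm \<xi>)"
    define F where "F = (\<lambda>x. indicator K x * profile a (herm \<xi> x))"
    define H where "H = (\<lambda>y. (indicator L y - indicator K y) * indicator {..\<delta>} (herm \<xi> y) :: real)"
    have F_int: "integrable lborel F"
      unfolding F_def using profile_bound[of a] a by (intro integrable_indicator_bounded[OF K bK, where c = 5]) auto
    have h1: "integrable lborel (\<lambda>y. indicator K y * indicator {..\<delta>} (herm \<xi> y) :: real)"
      by (intro integrable_indicator_bounded[OF K bK, where c = 1]) (auto simp: indicator_def)
    have h2: "integrable lborel (\<lambda>y. indicator L y * indicator {..\<delta>} (herm \<xi> y) :: real)"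
      by (intro integrable_indicator_bounded[OF L bL, where c = 1]) (auto simp: indicator_def)
    have H_int: "integrable lborel H"
      unfolding H_def left_diff_distrib by (rule Bochner_Integration.integrable_diff[OF h2 h1])
    have "(\<integral>p. g p * S \<xi> p \<partial>lborel) = (\<integral>p. W * (F (fst p) * H (snd p)) \<partial>lborel)"
      by (simp add: g_def S_def W_def F_def H_def mult_ac)
    also have "\<dots> = W * ((\<integral>x. F x \<partial>lborel) * (\<integral>y. H y \<partial>lborel))"
      by (simp add: integrable_lborel_product[OF F_int H_int])
    also have "\<dots> \<ge> 0"
    proof (cases "\<delta> \<le> r * norm \<xi>")
      case True
      then have \<xi>: "\<xi> \<noteq> 0" using \<delta> by auto
      have e: "ennreal (indicator A x * indicator {..\<delta>} t) = indicator {..\<delta>} t * indicator A x" for A and x :: 'e and t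
        by (simp add: indicator_def)
      have "(\<integral>y. indicat_real K y * indicator {..\<delta>} (herm \<xi> y) \<partial>lborel) \<le> (\<integral>y. indicat_real L y * indicator {..\<delta>} (herm \<xi> y) \<partial>lborel)"
        by (rule integral_le_of_nn_integral_le[OF h1 h2]) (use slab[OF \<xi> True] in \<open>simp_all add: e\<close>)
      then have "0 \<le> (\<integral>y. H y \<partial>lborel)"
        unfolding H_def left_diff_distrib by (simp add: Bochner_Integration.integral_diff[OF h2 h1])
      moreover have "0 \<le> (\<integral>x. F x \<partial>lborel)" unfolding F_def by (rule Gaussian_slice_integral_nonneg[OF K Kc bK a])
      moreover have "0 \<le> W" using weight_bounds(1) by (simp add: W_def)
      ultimately show ?thesis by simp
    qed (simp add: W_def)
    finally show "0 \<le> (\<integral>p. g p * S \<xi> p \<partial>lborel)" .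
  qed
  finally show "0 \<le> (\<integral>p. indicator K (fst p) * (indicator L (snd p) - indicator K (snd p)) * slab_kernel r a \<delta> (fst p) (snd p) \<partial>lborel)"
    by (simp add: g_def)
qed

definition pairing_integrand :: "real \<Rightarrow> 'e set \<Rightarrow> 'e set \<Rightarrow> 'e \<times> 'e \<Rightarrow> real" where
  "pairing_integrand a K L p = indicator K (fst p) * (indicator L (snd p) - indicator K (snd p))
     * (radial_kernel (a * line_dist2 (snd p) (fst p)) / (norm (snd p))\<^sup>2)"

text \<open>The limit of \<open>slab_pairing_nonneg\<close> as \<open>\<delta>\<close> tends to zero. The singularity of the kernel at \<open>y = 0\<close> does no
harm, because the difference of the two indicators vanishes on a ball about the origin.\<close>
lemma kernel_pairing_nonneg:
  assumes K[measurable]: "K \<in> sets borel" and Kc: "convex K" "\<And>x. x \<in> K \<Longrightarrow> - x \<in> K" and bK: "bounded K"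
    and L[measurable]: "L \<in> sets borel" and bL: "bounded L" and a: "a > 0" and r: "r > 0"
    and \<rho>: "\<rho> > 0" "ball 0 \<rho> \<subseteq> K" "ball 0 \<rho> \<subseteq> L"
    and slab: "\<And>\<xi> \<delta>. \<xi> \<noteq> 0 \<Longrightarrow> \<delta> \<le> r * norm \<xi> \<Longrightarrow>
      (\<integral>\<^sup>+x. indicator {..\<delta>} (herm \<xi> x) * indicator K x \<partial>lborel) \<le> (\<integral>\<^sup>+x. indicator {..\<delta>} (herm \<xi> x) * indicator L x \<partial>lborel)"
  shows "integrable lborel (pairing_integrand a K L)" and "0 \<le> (\<integral>p. pairing_integrand a K L p \<partial>lborel)"
proof -
  define g where "g = (\<lambda>p :: 'e \<times> 'e. indicator K (fst p) * (indicator L (snd p) - indicator K (snd p)) :: real)"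
  define d where "d = (\<lambda>k. inverse (real (Suc k)))"
  have d: "d k > 0" "d \<longlonglongrightarrow> 0" for k unfolding d_def by (simp, rule LIMSEQ_inverse_real_of_nat)
  define Q where "Q = (\<lambda>k p. g p * (slab_kernel r a (d k) (fst p) (snd p) / (d k)\<^sup>2))"
  note nn = slab_pairing_nonneg[OF K Kc bK L bL a d(1) slab]
  have Qint: "integrable lborel (Q k)" for k
    using integrable_mult_left[OF nn(1), of "1 / (d k)\<^sup>2" k] by (simp add: Q_def g_def)
  have Q0: "0 \<le> (\<integral>p. Q k p \<partial>lborel)" for k
  proof -
    have "(\<integral>p. Q k p \<partial>lborel) = (\<integral>p. g p * slab_kernel r a (d k) (fst p) (snd p) \<partial>lborel) / (d k)\<^sup>2"
      unfolding Q_def times_divide_eq_right by simp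
    then show ?thesis using nn(2)[of k] by (simp add: g_def)
  qed
  have g0: "g p = 0" if "norm (snd p) < \<rho>" for p
    using \<rho> that by (force simp: g_def indicator_def)
  have lim: "(\<lambda>k. Q k p) \<longlonglongrightarrow> pi ^ 3 * pairing_integrand a K L p" for p
  proof (cases "norm (snd p) < \<rho>")
    case True
    have "pairing_integrand a K L p = g p * (radial_kernel (a * line_dist2 (snd p) (fst p)) / (norm (snd p))\<^sup>2)"
      by (simp add: pairing_integrand_def g_def)
    then show ?thesis using g0[OF True] by (simp add: Q_def)
  next
    case False
    then have y: "snd p \<noteq> 0" using \<rho> by auto
    show ?thesis
      using tendsto_mult_left[OF slab_kernel_limit(2)[OF y a r d], of "g p" "fst p"]
      by (simp add: Q_def pairing_integrand_def g_def mult_ac)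
  qed
  define c where "c = 5 * pi ^ 3 / \<rho>\<^sup>2"
  have bound: "\<bar>Q k p\<bar> \<le> \<bar>g p\<bar> * c" for k p
  proof (cases "norm (snd p) < \<rho>")
    case True
    then show ?thesis using g0[OF True] by (simp add: Q_def)
  next
    case False
    then have y: "snd p \<noteq> 0" and "\<rho>\<^sup>2 \<le> (norm (snd p))\<^sup>2" using \<rho> by (auto intro!: power_mono)
    then have "5 * pi ^ 3 / (norm (snd p))\<^sup>2 \<le> c" unfolding c_def using \<rho> by (intro divide_left_mono) auto
    then have "\<bar>slab_kernel r a (d k) (fst p) (snd p) / (d k)\<^sup>2\<bar> \<le> c"
      using slab_kernel_limit(1)[OF y a r d(1)[of k], of "fst p"] by linarith
    then show ?thesis unfolding Q_def abs_mult by (intro mult_left_mono) auto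
  qed
  have ind_int: "integrable lborel (indicator K :: 'e \<Rightarrow> real)" "integrable lborel (indicator L :: 'e \<Rightarrow> real)"
    using emeasure_bounded_finite[OF bK] emeasure_bounded_finite[OF bL] by (auto intro!: integrable_real_indicator)
  have "integrable lborel g"
    unfolding g_def by (intro integrable_lborel_product ind_int Bochner_Integration.integrable_diff)
  then have gi: "integrable lborel (\<lambda>p. \<bar>g p\<bar> * c)" by simp
  have Qm: "Q k \<in> borel_measurable lborel" for k using Qint[of k] by simp
  have m: "(\<lambda>p. pi ^ 3 * pairing_integrand a K L p) \<in> borel_measurable lborel"
    by (rule borel_measurable_LIMSEQ_real[OF lim Qm])
  have AE1: "AE p in lborel. (\<lambda>k. Q k p) \<longlonglongrightarrow> pi ^ 3 * pairing_integrand a K L p" using lim by simp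
  have AE2: "AE p in lborel. norm (Q k p) \<le> \<bar>g p\<bar> * c" for k using bound by simp
  have "integrable lborel (\<lambda>p. pi ^ 3 * pairing_integrand a K L p)"
    by (rule integrable_dominated_convergence[OF m Qm gi AE1 AE2])
  then show "integrable lborel (pairing_integrand a K L)" by (simp add: integrable_mult_left_iff)
  have "(\<lambda>k. \<integral>p. Q k p \<partial>lborel) \<longlonglongrightarrow> (\<integral>p. pi ^ 3 * pairing_integrand a K L p \<partial>lborel)"
    by (rule integral_dominated_convergence[OF m Qm gi AE1 AE2])
  then have "0 \<le> (\<integral>p. pi ^ 3 * pairing_integrand a K L p \<partial>lborel)"
    by (rule LIMSEQ_le_const) (use Q0 in auto)
  then show "0 \<le> (\<integral>p. pairing_integrand a K L p \<partial>lborel)"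
    using mult_le_cancel_left_pos[of "pi ^ 3" 0 "\<integral>p. pairing_integrand a K L p \<partial>lborel"] by simp
qed

section \<open>Concentration on complex lines\<close>

lemma cscale_cscale: "cscale a (cscale b x) = cscale (a * b) x"
  by (simp add: cscale_def linear_add[OF linJ] linear_scale[OF linJ] J_J algebra_simps)

lemma cscale_1[simp]: "cscale 1 x = x" by (simp add: cscale_def)

lemma frame_cscale:
  assumes "frame T"
  shows "T (c * u, c * v, c * w) = cscale c (T (u, v, w))"
proof -
  have eq: "(c * u, c * v, c * w) = Re c *\<^sub>R (u, v, w) + Im c *\<^sub>R (\<i> * u, \<i> * v, \<i> * w)"
    by (auto simp: complex_eq_iff)
  note lin = frame_D(1)[OF assms]
  show ?thesis
    unfolding eq linear_add[OF lin] linear_scale[OF lin] frame_D(3)[OF assms] cscale_def ..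
qed

text \<open>The complex analogue of a set that is symmetric and star-shaped about the origin.\<close>
definition balanced :: "'e set \<Rightarrow> bool" where
  "balanced K \<longleftrightarrow> (\<forall>c. norm c \<le> 1 \<longrightarrow> (\<forall>x\<in>K. cscale c x \<in> K))"

lemma balancedD: "balanced K \<Longrightarrow> norm c \<le> 1 \<Longrightarrow> x \<in> K \<Longrightarrow> cscale c x \<in> K"
  by (auto simp: balanced_def)

text \<open>In coordinates with \<open>y\<close> on the first complex axis, rescaling the other two coordinates by \<open>1 / sqrt (a k)\<close>
makes the kernel independent of \<open>k\<close> and flattens \<open>K\<close> onto the first axis. So the limit is the mass of the
kernel times the area \<open>\<Gamma>\<close> of the intersection of \<open>K\<close> with the complex line through \<open>y\<close>. As \<open>K\<close> is
\<open>balanced\<close>, this intersection contains the disc with \<open>y\<close> on its boundary if \<open>y \<in> K\<close>, and is contained in it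
otherwise.\<close>
lemma tube_limit:
  assumes K: "compact K" "convex K" and ball: "0 \<in> interior K"
    and inv: "balanced K" and R: "K \<subseteq> cball 0 R" "R \<ge> 0" and y: "y \<noteq> 0"
    and a: "\<And>k::nat. a k > 0" "filterlim a at_top sequentially"
  obtains \<Gamma> where
    "(\<lambda>k. (a k)\<^sup>2 * (\<integral>x. indicator K x * radial_kernel (a k * line_dist2 y x) \<partial>lborel)) \<longlonglongrightarrow> kernel_mass * \<Gamma>"
    "y \<in> K \<Longrightarrow> pi * (norm y)\<^sup>2 \<le> \<Gamma>" "y \<notin> K \<Longrightarrow> \<Gamma> \<le> pi * (norm y)\<^sup>2"
    "\<And>k. \<bar>(a k)\<^sup>2 * (\<integral>x. indicator K x * radial_kernel (a k * line_dist2 y x) \<partial>lborel)\<bar> \<le> kernel_mass * (pi * R\<^sup>2)"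
proof -
  have Kcl: "closed K" using K by (simp add: compact_imp_closed)
  then have [measurable]: "K \<in> sets borel" by simp
  obtain T where T: "frame T" and Ty: "T (complex_of_real (norm y), 0, 0) = y"
    using frame_exists[OF y] by metis
  note lin = frame_D(1)[OF T] and nT = frame_D(2)[OF T]
  have Tcont: "continuous_on A T" for A using lin by (rule linear_continuous)
  note [measurable] = frame_measurable[OF T]
  define t0 where "t0 = (\<lambda>u. T (u, 0, 0))"
  have lint0: "linear t0" unfolding t0_def
    using linear_compose[of "\<lambda>u. (u, 0, 0)" T] lin by (simp add: o_def linear_iff)
  have t0cont: "continuous_on A t0" for A using lint0 by (rule linear_continuous)
  define C where "C = {u. t0 u \<in> K}"
  have Cconv: "convex C" unfolding C_def using convex_linear_vimage[OF lint0 K(2)] by (simp add: vimage_def)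
  have Ccl: "closed C" unfolding C_def using closed_vimage[OF Kcl t0cont] by (simp add: vimage_def)
  have [measurable]: "C \<in> sets borel" using Ccl by simp
  have CR: "C \<subseteq> cball 0 R"
    using R nT by (force simp: C_def t0_def norm_Pair)
  have "compact C" using Ccl bounded_subset[OF bounded_cball CR] by (simp add: compact_eq_bounded_closed)
  then have Cfm: "C \<in> fmeasurable lborel" by (rule fmeasurable_compact)
  have null: "frontier C \<in> null_sets lborel"
    using negligible_convex_frontier[OF Cconv] frontier_closed[of C] unfolding negligible_iff_null_sets
    by (simp add: null_sets_completion_iff)
  \<comment> \<open>The indicators below converge away from the boundary of the planar section, which is a null set.\<close>
  have AEfr: "AE z in lborel. fst (z :: complex3) \<notin> frontier C"
  proof (rule AE_I')
    let ?N = "{z :: complex3. fst z \<in> frontier C}"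
    have cl: "closed ?N"
    proof -
      have "continuous_on UNIV (fst :: complex3 \<Rightarrow> complex)" by (intro continuous_intros)
      from closed_vimage[OF frontier_closed[of C] this] show ?thesis by (simp add: vimage_def)
    qed
    have "emeasure lborel ?N = (\<integral>\<^sup>+z. indicator ?N z \<partial>lborel)" using cl by simp
    also have "\<dots> = (\<integral>\<^sup>+u. \<integral>\<^sup>+w. indicator ?N (u, w) \<partial>lborel \<partial>lborel)"
      by (rule nn_integral_lborel_pair) (use cl in simp)
    also have "\<dots> = (\<integral>\<^sup>+u. \<infinity> * indicator (frontier C) u \<partial>lborel)"
      by (intro nn_integral_cong) (auto simp: indicator_def)
    also have "\<dots> = 0" using null by (subst nn_integral_cmult) auto
    finally show "?N \<in> null_sets lborel" using cl by (auto simp: null_sets_def)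
  qed auto
  \<comment> \<open>A point slightly further out on the ray through \<open>u\<close> still lies in \<open>K\<close>, and \<open>K\<close> contains a ball about \<open>0\<close>.\<close>
  have interior: "t0 u \<in> interior K" if "u \<in> interior C" for u
  proof -
    have "\<exists>e>0. cball u e \<subseteq> C" using that by (simp only: mem_interior_cball)
    then obtain e where e: "e > 0" "cball u e \<subseteq> C" by (elim exE conjE)
    define s where "s = 1 + e / (norm u + 1)"
    have s: "s > 1" using e by (simp add: s_def add_nonneg_pos)
    have "norm (u - s *\<^sub>R u) = e / (norm u + 1) * norm u"
      using e by (simp add: s_def algebra_simps)
    also have "\<dots> \<le> e" using e by (simp add: divide_simps add_nonneg_pos)
    finally have "s *\<^sub>R u \<in> C" using e(2) by (auto simp: dist_norm)
    then have "s *\<^sub>R t0 u \<in> K" by (simp add: C_def linear_scale[OF lint0])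
    from mem_interior_convex_shrink[OF K(2) ball this, of "1 - 1 / s"]
    show ?thesis using s by (simp add: algebra_simps)
  qed
  define F where "F = (\<lambda>c (z :: complex3). indicator K (T (fst z, c *\<^sub>R snd z)) * radial_kernel ((norm (snd z))\<^sup>2) :: real)"
  define F0 where "F0 = (\<lambda>z :: complex3. indicator C (fst z) * radial_kernel ((norm (snd z))\<^sup>2) :: real)"
  define M where "M = (\<lambda>z :: complex3. indicator (cball 0 R) (fst z) * radial_kernel ((norm (snd z))\<^sup>2) :: real)"
  have Fm[measurable]: "F c \<in> borel_measurable lborel" for c
  proof -
    have b1: "(\<lambda>z :: complex3. T (fst z, c *\<^sub>R snd z)) \<in> borel_measurable borel"
      by (intro borel_measurable_continuous_onI continuous_on_compose2[OF Tcont[of UNIV]] continuous_intros) auto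
    have b2: "(\<lambda>z :: complex3. (norm (snd z))\<^sup>2) \<in> borel_measurable borel"
      by (intro borel_measurable_continuous_onI continuous_intros)
    have "(\<lambda>z. indicator K (T (fst z, c *\<^sub>R snd z)) :: real) \<in> borel_measurable borel"
      by (rule measurable_compose[OF b1 borel_measurable_indicator]) simp
    moreover have "(\<lambda>z :: complex3. radial_kernel ((norm (snd z))\<^sup>2)) \<in> borel_measurable borel"
      by (rule measurable_compose[OF b2]) measurable
    ultimately have "F c \<in> borel_measurable borel" unfolding F_def by (intro borel_measurable_times)
    then show ?thesis by simp
  qed
  have scaled: "a\<^sup>2 * (\<integral>x. indicator K x * radial_kernel (a * line_dist2 y x) \<partial>lborel) = (\<integral>z. F (1 / sqrt a) z \<partial>lborel)" if a: "a > 0" for a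
  proof -
    have [measurable]: "(\<lambda>x. line_dist2 y x) \<in> borel_measurable borel" unfolding line_dist2_def by measurable
    let ?c = "1 / sqrt a"
    have c: "?c > 0" using a by simp
    have c4: "a\<^sup>2 * ?c ^ 4 = 1"
      using a power_mult[of "sqrt a" 2 2] by (simp add: power_divide)
    have c2: "a * (norm (?c *\<^sub>R w))\<^sup>2 = (norm w)\<^sup>2" for w :: "complex2"
      using a by (simp add: power_mult_distrib power_divide)
    have ld: "line_dist2 y (T z) = (norm (snd z))\<^sup>2" for z
      using line_dist2_frame[OF T y Ty, of "fst z" "fst (snd z)" "snd (snd z)"] by simp
    have "(\<integral>x. indicator K x * radial_kernel (a * line_dist2 y x) \<partial>lborel) = (\<integral>z. indicator K (T z) * radial_kernel (a * line_dist2 y (T z)) \<partial>lborel)"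
      by (rule integral_linear_isometry[OF lin nT]) (simp_all add: dim6)
    also have "\<dots> = ?c ^ DIM(complex2) * (\<integral>z. indicator K (T (fst z, ?c *\<^sub>R snd z)) * radial_kernel (a * line_dist2 y (T (fst z, ?c *\<^sub>R snd z))) \<partial>lborel)"
      by (rule integral_lborel_scale_snd[OF _ c]) measurable
    also have "\<dots> = ?c ^ 4 * (\<integral>z. F ?c z \<partial>lborel)"
      unfolding ld snd_conv c2 F_def by simp
    finally show ?thesis using c4 by (simp add: mult.assoc[symmetric])
  qed
  have M: "integrable lborel M" "(\<integral>z. M z \<partial>lborel) = kernel_mass * (pi * R\<^sup>2)"
    unfolding M_def using integrable_lborel_product[OF integrable_indicator_cball[of R, where 'a = complex] kernel_integrable] R
    by (simp_all add: measure_cball_complex kernel_mass_def)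
  have kp: "0 \<le> radial_kernel ((norm w)\<^sup>2)" for w :: "complex2" using kernel_bounds(1)[of "(norm w)\<^sup>2"] by simp
  have FM: "\<bar>F c z\<bar> \<le> M z" for c z
  proof -
    have "norm (fst z) \<le> R" if "T (fst z, c *\<^sub>R snd z) \<in> K"
    proof -
      have "norm (fst z) \<le> norm (fst z, c *\<^sub>R snd z)" by (simp add: norm_Pair real_le_rsqrt)
      also have "\<dots> \<le> R" using that R nT[of "(fst z, c *\<^sub>R snd z)"] by auto
      finally show ?thesis .
    qed
    then show ?thesis using kp[of "snd z"] by (auto simp: F_def M_def indicator_def)
  qed
  have pointwise: "(\<lambda>k. F (c k) z) \<longlonglongrightarrow> F0 z" if c: "c \<longlonglongrightarrow> 0" and z: "fst z \<notin> frontier C" for c :: "nat \<Rightarrow> real" and z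
  proof -
    have lim: "(\<lambda>k. T (fst z, c k *\<^sub>R snd z)) \<longlonglongrightarrow> t0 (fst z)"
    proof -
      have "(\<lambda>k. (fst z, c k *\<^sub>R snd z)) \<longlonglongrightarrow> (fst z, 0 *\<^sub>R snd z)" by (intro tendsto_intros c)
      from continuous_on_tendsto_compose[OF Tcont[of UNIV] this] show ?thesis by (simp add: t0_def zero_prod_def)
    qed
    have "\<forall>\<^sub>F k in sequentially. indicator K (T (fst z, c k *\<^sub>R snd z)) = (indicator C (fst z) :: real)"
    proof (cases "fst z \<in> C")
      case True
      then have "fst z \<in> interior C" using z Ccl by (simp add: frontier_def closure_closed)
      then have "t0 (fst z) \<in> interior K" by (rule interior)
      then have "\<forall>\<^sub>F k in sequentially. T (fst z, c k *\<^sub>R snd z) \<in> interior K"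
        using topological_tendstoD[OF lim open_interior] by simp
      then show ?thesis by (rule eventually_mono) (use True interior_subset in \<open>auto simp: indicator_def\<close>)
    next
      case False
      then have "t0 (fst z) \<in> - K" by (simp add: C_def)
      then have "\<forall>\<^sub>F k in sequentially. T (fst z, c k *\<^sub>R snd z) \<in> - K"
        using topological_tendstoD[OF lim open_Compl[OF Kcl]] by simp
      then show ?thesis by (rule eventually_mono) (use False in \<open>auto simp: indicator_def\<close>)
    qed
    then show ?thesis unfolding F_def F0_def
      by (intro tendsto_eventually) (auto elim: eventually_mono)
  qed
  have F0_int: "(\<integral>z. F0 z \<partial>lborel) = kernel_mass * measure lborel C" and F0m: "F0 \<in> borel_measurable lborel"
  proof -
    have "emeasure lborel C < \<infinity>" using CR bounded_subset[OF bounded_cball] by (intro emeasure_bounded_finite) blast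
    then have iC: "integrable lborel (indicator C :: complex \<Rightarrow> real)" by (intro integrable_real_indicator) auto
    show "(\<integral>z. F0 z \<partial>lborel) = kernel_mass * measure lborel C"
      unfolding F0_def using integrable_lborel_product(2)[OF iC kernel_integrable] by (simp add: kernel_mass_def)
    show "F0 \<in> borel_measurable lborel"
      unfolding F0_def using integrable_lborel_product(1)[OF iC kernel_integrable] by simp
  qed
  show ?thesis
  proof (rule that[of "measure lborel C"])
    define c where "c = (\<lambda>k. 1 / sqrt (a k))"
    have c0: "c \<longlonglongrightarrow> 0" unfolding c_def
      by (intro tendsto_divide_0[OF tendsto_const] filterlim_at_top_imp_at_infinity filterlim_compose[OF sqrt_at_top a(2)])
    have "(\<lambda>k. \<integral>z. F (c k) z \<partial>lborel) \<longlonglongrightarrow> (\<integral>z. F0 z \<partial>lborel)"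
    proof (rule integral_dominated_convergence[OF F0m Fm M(1)])
      show "AE z in lborel. (\<lambda>k. F (c k) z) \<longlonglongrightarrow> F0 z"
        using AEfr by (rule eventually_mono) (rule pointwise[OF c0])
    qed (use FM in auto)
    then show "(\<lambda>k. (a k)\<^sup>2 * (\<integral>x. indicator K x * radial_kernel (a k * line_dist2 y x) \<partial>lborel)) \<longlonglongrightarrow> kernel_mass * measure lborel C"
      unfolding scaled[OF a(1)] F0_int c_def .
  next
    fix k
    have "integrable lborel (F (1 / sqrt (a k)))"
      by (rule Bochner_Integration.integrable_bound[OF M(1) Fm]) (use FM in \<open>auto intro: order_trans[OF FM abs_ge_self]\<close>)
    then have "(\<integral>z. norm (F (1 / sqrt (a k)) z) \<partial>lborel) \<le> (\<integral>z. M z \<partial>lborel)"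
      using M(1) FM by (intro integral_mono) auto
    moreover have "norm (\<integral>z. F (1 / sqrt (a k)) z \<partial>lborel) \<le> (\<integral>z. norm (F (1 / sqrt (a k)) z) \<partial>lborel)" by (rule integral_norm_bound)
    ultimately show "\<bar>(a k)\<^sup>2 * (\<integral>x. indicator K x * radial_kernel (a k * line_dist2 y x) \<partial>lborel)\<bar> \<le> kernel_mass * (pi * R\<^sup>2)"
      unfolding scaled[OF a(1)] M(2) real_norm_def by linarith
  next
    have t0s: "t0 (c * complex_of_real (norm y)) = cscale c y" for c
      unfolding t0_def using frame_cscale[OF T, of c "complex_of_real (norm y)" 0 0] Ty by simp
    have un: "u = (u / complex_of_real (norm y)) * complex_of_real (norm y)" for u using y by simp
    {
      assume yK: "y \<in> K"
      have "cball 0 (norm y) \<subseteq> C"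
      proof
        fix u :: complex assume "u \<in> cball 0 (norm y)"
        then have "norm (u / complex_of_real (norm y)) \<le> 1" using y by (simp add: norm_divide divide_simps)
        then show "u \<in> C" using balancedD[OF inv _ yK] t0s un[of u] by (metis C_def mem_Collect_eq)
      qed
      then have "measure lborel (cball (0::complex) (norm y)) \<le> measure lborel C"
        by (intro measure_mono_fmeasurable Cfm) auto
      then show "pi * (norm y)\<^sup>2 \<le> measure lborel C" by (simp add: measure_cball_complex)
    }
    {
      assume yK: "y \<notin> K"
      have "C \<subseteq> cball 0 (norm y)"
      proof (rule ccontr)
        assume "\<not> C \<subseteq> cball 0 (norm y)"
        then obtain u where u: "u \<in> C" "norm u > norm y" by (auto simp: subset_iff not_le)
        define c where "c = u / complex_of_real (norm y)"
        have c1: "norm c > 1" using u y by (simp add: c_def norm_divide)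
        then have "norm (1 / c) \<le> 1" by (auto simp: norm_divide divide_le_eq_1)
        moreover have "cscale c y \<in> K" using u(1) t0s un[of u] by (metis C_def c_def mem_Collect_eq)
        ultimately have "cscale (1 / c) (cscale c y) \<in> K" by (rule balancedD[OF inv])
        moreover have "1 / c * c = 1" using c1 by auto
        ultimately show False using yK by (simp add: cscale_cscale)
      qed
      then have "measure lborel C \<le> measure lborel (cball (0::complex) (norm y))"
        by (intro measure_mono_fmeasurable fmeasurable_compact compact_cball) auto
      then show "measure lborel C \<le> pi * (norm y)\<^sup>2" by (simp add: measure_cball_complex)
    }
  qed
qed

end

text \<open>The point is \<open>1 + t\<close> times a convex combination of \<open>x\<close> and \<open>y / t\<close>.\<close>
lemma dilation_margin:
  fixes L :: "'a::euclidean_space set"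
  assumes L: "convex L" and \<rho>: "ball 0 \<rho> \<subseteq> L" and t: "t > 0" and x: "x \<in> L" and y: "norm y < t * \<rho>"
  shows "x + y \<in> (*\<^sub>R) (1 + t) ` L"
proof -
  have "(1 / t) *\<^sub>R y \<in> L" using \<rho> y t by (auto simp: divide_simps mult.commute)
  then have "(1 / (1 + t)) *\<^sub>R x + (t / (1 + t)) *\<^sub>R ((1 / t) *\<^sub>R y) \<in> L"
    using t x by (intro convexD[OF L]) (auto simp: add_divide_distrib[symmetric])
  then have "(1 + t) *\<^sub>R ((1 / (1 + t)) *\<^sub>R x + (t / (1 + t)) *\<^sub>R ((1 / t) *\<^sub>R y)) \<in> (*\<^sub>R) (1 + t) ` L" by blast
  then show ?thesis using t by (simp add: scaleR_add_right)
qed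

context unitary_structure
begin

text \<open>Let the Gaussian parameter tend to infinity in \<open>kernel_pairing_nonneg\<close>. The limit integrand \<open>\<Phi>\<close> is
bounded above by a multiple of the difference of the indicators of \<open>L\<close> and \<open>K\<close>, since the area found in
\<open>tube_limit\<close> is large on \<open>K\<close> and small off \<open>K\<close>.\<close>
lemma measure_le_of_slabs:
  assumes K: "compact K" "convex K"
    and inv: "balanced K"
    and L: "compact L" and r: "r > 0"
    and \<rho>: "\<rho> > 0" "ball 0 \<rho> \<subseteq> K" "ball 0 \<rho> \<subseteq> L"
    and slab: "\<And>\<xi> \<delta>. \<xi> \<noteq> 0 \<Longrightarrow> \<delta> \<le> r * norm \<xi> \<Longrightarrow>
      (\<integral>\<^sup>+x. indicator {..\<delta>} (herm \<xi> x) * indicator K x \<partial>lborel) \<le> (\<integral>\<^sup>+x. indicator {..\<delta>} (herm \<xi> x) * indicator L x \<partial>lborel)"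
  shows "measure lborel K \<le> measure lborel L"
proof -
  have sym: "- x \<in> K" if "x \<in> K" for x
    using balancedD[OF inv, of "- 1" x] that by (simp add: cscale_def)
  have Kb: "K \<in> sets borel" and Lb: "L \<in> sets borel" using K L by (auto simp: borel_compact)
  have bK: "bounded K" and bL: "bounded L" using K L by (auto simp: compact_imp_bounded)
  obtain R where R: "K \<subseteq> cball 0 R" "R \<ge> 0"
    using bK unfolding bounded_pos by (metis less_imp_le mem_cball_0 subsetI)
  have int0: "0 \<in> interior K" using \<rho> by (auto intro!: interiorI[of "ball 0 \<rho>"])
  define h where "h = (\<lambda>y. indicator L y - indicator K y :: real)"
  define N where "N = (\<lambda>k y. (real (Suc k))\<^sup>2 * (\<integral>x. indicator K x * radial_kernel (real (Suc k) * line_dist2 y x) \<partial>lborel))"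
  define P where "P = (\<lambda>k y. h y / (norm y)\<^sup>2 * N k y)"
  have P_int: "integrable lborel (P k)" and P_nonneg: "0 \<le> (\<integral>y. P k y \<partial>lborel)" for k
  proof -
    define a where "a = real (Suc k)"
    have a: "a > 0" by (simp add: a_def)
    note pair = kernel_pairing_nonneg[OF Kb K(2) sym bK Lb bL a r \<rho> slab]
    have int: "integrable (lborel \<Otimes>\<^sub>M lborel) (\<lambda>(x, y). pairing_integrand a K L (x, y))"
      using pair(1) by (simp add: lborel_prod split_beta')
    have inner: "(\<integral>x. pairing_integrand a K L (x, y) \<partial>lborel) = P k y / a\<^sup>2" for y
    proof -
      have "(\<integral>x. pairing_integrand a K L (x, y) \<partial>lborel) = (\<integral>x. (h y / (norm y)\<^sup>2) * (indicator K x * radial_kernel (a * line_dist2 y x)) \<partial>lborel)"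
        by (intro Bochner_Integration.integral_cong) (simp_all add: pairing_integrand_def h_def)
      also have "\<dots> = (h y / (norm y)\<^sup>2) * (\<integral>x. indicator K x * radial_kernel (a * line_dist2 y x) \<partial>lborel)" by simp
      also have "\<dots> = P k y / a\<^sup>2"
      proof -
        have "N k y = a\<^sup>2 * (\<integral>x. indicator K x * radial_kernel (a * line_dist2 y x) \<partial>lborel)"
          unfolding N_def a_def ..
        then show ?thesis using a by (simp add: P_def)
      qed
      finally show ?thesis .
    qed
    have "integrable lborel (\<lambda>y. P k y / a\<^sup>2)"
      using lborel_pair.integrable_snd[OF int] unfolding inner .
    from integrable_mult_left[OF this, of "a\<^sup>2"] show "integrable lborel (P k)" using a by simp
    have "(\<integral>y. P k y / a\<^sup>2 \<partial>lborel) = (\<integral>p. pairing_integrand a K L p \<partial>lborel)"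
      using lborel_pair.integral_snd[OF int] unfolding inner by (simp add: lborel_prod)
    then have "0 \<le> (\<integral>y. P k y \<partial>lborel) / a\<^sup>2" using pair(2) by simp
    then show "0 \<le> (\<integral>y. P k y \<partial>lborel)" using a by (simp add: zero_le_divide_iff)
  qed
  have h0: "h y = 0" if "norm y < \<rho>" for y
    using \<rho> that by (force simp: h_def indicator_def)
  define B where "B = kernel_mass * (pi * R\<^sup>2) / \<rho>\<^sup>2"
  have ex: "\<exists>v. (\<lambda>k. P k y) \<longlonglongrightarrow> v \<and> v \<le> kernel_mass * pi * h y \<and> (\<forall>k. \<bar>P k y\<bar> \<le> \<bar>h y\<bar> * B)" for y
  proof (cases "norm y < \<rho>")
    case True
    then show ?thesis using h0[OF True] by (intro exI[of _ 0]) (simp add: P_def)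
  next
    case False
    then have y: "y \<noteq> 0" and y\<rho>: "\<rho>\<^sup>2 \<le> (norm y)\<^sup>2" using \<rho> by (auto intro!: power_mono)
    have "filterlim (\<lambda>k. real (Suc k)) at_top sequentially"
      by (rule filterlim_compose[OF filterlim_real_sequentially filterlim_Suc])
    then obtain \<Gamma> where lim: "(\<lambda>k. N k y) \<longlonglongrightarrow> kernel_mass * \<Gamma>"
      and \<Gamma>: "y \<in> K \<Longrightarrow> pi * (norm y)\<^sup>2 \<le> \<Gamma>" "y \<notin> K \<Longrightarrow> \<Gamma> \<le> pi * (norm y)\<^sup>2"
      and bd: "\<And>k. \<bar>N k y\<bar> \<le> kernel_mass * (pi * R\<^sup>2)"
      by (rule tube_limit[OF K int0 inv R y of_nat_0_less_iff[THEN iffD2, OF zero_less_Suc]]) (rule that[unfolded N_def])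
    from lim have 1: "(\<lambda>k. P k y) \<longlonglongrightarrow> h y / (norm y)\<^sup>2 * (kernel_mass * \<Gamma>)"
      unfolding P_def by (intro tendsto_intros)
    \<comment> \<open>If \<open>h y\<close> is positive then \<open>y \<notin> K\<close>, and if it is negative then \<open>y \<in> K\<close>.\<close>
    have "h y * \<Gamma> \<le> h y * (pi * (norm y)\<^sup>2)"
      using \<Gamma> by (auto simp: h_def indicator_def)
    then have "kernel_mass / (norm y)\<^sup>2 * (h y * \<Gamma>) \<le> kernel_mass / (norm y)\<^sup>2 * (h y * (pi * (norm y)\<^sup>2))"
      by (rule mult_left_mono) (use kernel_mass_pos in auto)
    then have 2: "h y / (norm y)\<^sup>2 * (kernel_mass * \<Gamma>) \<le> kernel_mass * pi * h y"
      using y by (simp add: mult_ac)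
    have "\<bar>P k y\<bar> \<le> \<bar>h y\<bar> * B" for k
    proof -
      have "\<bar>N k y\<bar> / (norm y)\<^sup>2 \<le> kernel_mass * (pi * R\<^sup>2) / \<rho>\<^sup>2"
        using bd[of k] y\<rho> \<rho> by (intro frac_le) auto
      then have "\<bar>h y\<bar> * (\<bar>N k y\<bar> / (norm y)\<^sup>2) \<le> \<bar>h y\<bar> * B"
        unfolding B_def by (intro mult_left_mono) auto
      then show ?thesis by (simp add: P_def abs_mult)
    qed
    with 1 2 show ?thesis by blast
  qed
  define \<Phi> where "\<Phi> = (\<lambda>y. lim (\<lambda>k. P k y))"
  have \<Phi>: "(\<lambda>k. P k y) \<longlonglongrightarrow> \<Phi> y" "\<Phi> y \<le> kernel_mass * pi * h y" and P_bound: "\<bar>P k y\<bar> \<le> \<bar>h y\<bar> * B" for k y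
    using ex[of y] unfolding \<Phi>_def by (auto dest: limI)
  have ind_int: "integrable lborel (indicator K :: 'e \<Rightarrow> real)" "integrable lborel (indicator L :: 'e \<Rightarrow> real)"
    using emeasure_bounded_finite[OF bK] emeasure_bounded_finite[OF bL] Kb Lb by (auto intro!: integrable_real_indicator)
  have h_int: "integrable lborel h" unfolding h_def by (intro Bochner_Integration.integrable_diff ind_int)
  then have hB: "integrable lborel (\<lambda>y. \<bar>h y\<bar> * B)" by simp
  have Pm: "P k \<in> borel_measurable lborel" for k using P_int[of k] by simp
  have \<Phi>m: "\<Phi> \<in> borel_measurable lborel" by (rule borel_measurable_LIMSEQ_real[OF \<Phi>(1) Pm])
  have AE1: "AE y in lborel. (\<lambda>k. P k y) \<longlonglongrightarrow> \<Phi> y" using \<Phi>(1) by simp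
  have AE2: "AE y in lborel. norm (P k y) \<le> \<bar>h y\<bar> * B" for k using P_bound by simp
  have \<Phi>_int: "integrable lborel \<Phi>" by (rule integrable_dominated_convergence[OF \<Phi>m Pm hB AE1 AE2])
  have "(\<lambda>k. \<integral>y. P k y \<partial>lborel) \<longlonglongrightarrow> (\<integral>y. \<Phi> y \<partial>lborel)"
    by (rule integral_dominated_convergence[OF \<Phi>m Pm hB AE1 AE2])
  then have "0 \<le> (\<integral>y. \<Phi> y \<partial>lborel)"
    by (rule LIMSEQ_le_const) (use P_nonneg in auto)
  also have "\<dots> \<le> (\<integral>y. kernel_mass * pi * h y \<partial>lborel)"
    using \<Phi>_int h_int \<Phi>(2) by (intro integral_mono) auto
  also have "\<dots> = kernel_mass * pi * (measure lborel L - measure lborel K)"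
    using ind_int Kb Lb by (simp add: h_def)
  finally have "0 \<le> (kernel_mass * pi) * (measure lborel L - measure lborel K)" .
  moreover have "kernel_mass * pi > 0" using kernel_mass_pos by simp
  ultimately show ?thesis by (metis diff_ge_0_iff_ge mult_le_cancel_left_pos mult_zero_right)
qed

text \<open>Replacing \<open>L\<close> by \<open>(1 + t) L\<close> provides the margin required to compare slabs; afterwards \<open>t\<close> tends to zero.\<close>
theorem complex_hyperplane_sections_determine_volume_order:
  assumes K: "compact K" "convex K"
    and invK: "balanced K"
    and L: "compact L" "convex L"
    and \<rho>: "\<rho> > 0" "ball 0 \<rho> \<subseteq> K" "ball 0 \<rho> \<subseteq> L"
    and sec: "\<And>\<xi>. \<xi> \<noteq> 0 \<Longrightarrow> emeasure (subspace_lborel (complex_hyperplane \<xi>)) (K \<inter> complex_hyperplane \<xi>)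
      \<le> emeasure (subspace_lborel (complex_hyperplane \<xi>)) (L \<inter> complex_hyperplane \<xi>)"
  shows "measure lborel K \<le> measure lborel L"
proof -
  have sym: "- x \<in> K" if "x \<in> K" for x
    using balancedD[OF invK, of "- 1" x] that by (simp add: cscale_def)
  have le: "measure lborel K \<le> (1 + t) ^ DIM('e) * measure lborel L" if t: "t > 0" for t :: real
  proof -
    define L' where "L' = (*\<^sub>R) (1 + t) ` L"
    have cL': "compact L'" unfolding L'_def using L(1) by (rule compact_scaling)
    have Kb: "K \<in> sets borel" and Lb: "L \<in> sets borel" and L'b: "L' \<in> sets borel"
      using K L cL' by (auto simp: borel_compact)
    have margin: "x + y \<in> L'" if "x \<in> L" "norm y \<le> t * \<rho> / 2" for x y
    proof -
      have "norm y < t * \<rho>" using that t \<rho> by (smt (verit) half_gt_zero_iff mult_pos_pos field_sum_of_halves)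
      then show ?thesis unfolding L'_def by (rule dilation_margin[OF L(2) \<rho>(3) t that(1)])
    qed
    have ballL': "ball 0 \<rho> \<subseteq> L'"
    proof
      fix x :: 'e assume x: "x \<in> ball 0 \<rho>"
      have "norm ((1 / (1 + t)) *\<^sub>R x) \<le> norm x" using t by (simp add: divide_simps mult_le_cancel_left1 mult_left_le)
      then have "(1 / (1 + t)) *\<^sub>R x \<in> L" using \<rho>(3) x by (auto simp: subset_iff)
      then have "(1 + t) *\<^sub>R ((1 / (1 + t)) *\<^sub>R x) \<in> L'" unfolding L'_def by blast
      then show "x \<in> L'" using t by simp
    qed
    have "measure lborel K \<le> measure lborel L'"
    proof (rule measure_le_of_slabs[OF K invK cL' _ \<rho>(1,2) ballL'])
      show "0 < t * \<rho> / 2" using t \<rho> by simp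
      fix \<xi> \<delta> assume "\<xi> \<noteq> (0::'e)" "\<delta> \<le> t * \<rho> / 2 * norm \<xi>"
      then show "(\<integral>\<^sup>+x. indicator {..\<delta>} (herm \<xi> x) * indicator K x \<partial>lborel) \<le> (\<integral>\<^sup>+x. indicator {..\<delta>} (herm \<xi> x) * indicator L' x \<partial>lborel)"
        using thin_slab_comparison[where L = L and L' = L' and r = "t * \<rho> / 2" and \<xi> = \<xi> and \<delta> = \<delta>, OF Kb K(2) sym Lb L'b sec]
          margin by blast
    qed
    also have "measure lborel L' = (1 + t) ^ DIM('e) * measure lborel L"
    proof -
      have "emeasure lborel L' = (\<integral>\<^sup>+x. indicator L' x \<partial>lborel)" using L'b by simp
      also have "\<dots> = ennreal ((1 + t) ^ DIM('e)) * (\<integral>\<^sup>+x. indicator L' ((1 + t) *\<^sub>R x) \<partial>lborel)"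
        by (rule nn_integral_lborel_scale) (use L'b t in auto)
      also have "(\<integral>\<^sup>+x. indicator L' ((1 + t) *\<^sub>R x) \<partial>lborel) = (\<integral>\<^sup>+x. indicator L x \<partial>lborel)"
        using t by (intro nn_integral_cong) (auto simp: L'_def indicator_def)
      also have "\<dots> = emeasure lborel L" using Lb by simp
      finally show ?thesis using t by (simp add: measure_def enn2real_mult)
    qed
    finally show ?thesis .
  qed
  have "(\<lambda>n. (1 + inverse (real (Suc n))) ^ DIM('e) * measure lborel L) \<longlonglongrightarrow> (1 + 0) ^ DIM('e) * measure lborel L"
    by (intro tendsto_intros LIMSEQ_inverse_real_of_nat)
  then have lim: "(\<lambda>n. (1 + inverse (real (Suc n))) ^ DIM('e) * measure lborel L) \<longlonglongrightarrow> measure lborel L" by simp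
  show ?thesis
  proof (rule LIMSEQ_le_const[OF lim], intro exI allI impI)
    fix n show "measure lborel K \<le> (1 + inverse (real (Suc n))) ^ DIM('e) * measure lborel L" by (rule le) simp
  qed
qed

end

section \<open>Bodies invariant under a complete tangent system\<close>

text \<open>By compactness the part of \<open>L\<close> in \<open>S\<close> lies in a ball of radius strictly less than \<open>r\<close>, while \<open>K\<close> contains
the full ball of radius \<open>r\<close> in \<open>S\<close>.\<close>
lemma section_volume_less:
  fixes K L :: "'e::euclidean_space set"
  assumes K: "compact K" and L: "compact L" and sub: "subspace S" and dimS: "dim S = CARD('d::finite)"
    and r: "r > 0" and inK: "\<And>z. z \<in> S \<Longrightarrow> norm z \<le> r \<Longrightarrow> z \<in> K" and inL: "\<And>z. z \<in> S \<Longrightarrow> z \<in> L \<Longrightarrow> norm z < r"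
  shows "measure (subspace_lborel S) (L \<inter> S) < measure (subspace_lborel S) (K \<inter> S)"
proof -
  have "dim S = DIM(real^'d)" using dimS by simp
  then obtain U :: "real^'d \<Rightarrow> 'e" where U: "linear U" "\<And>c. norm (U c) = norm c" "range U = S" "subspace_lborel S = distr lborel borel U"
    by (rule subspace_lborel_coordinates[OF sub]) (rule that)
  note cpt = section_of_compact(1)[OF U]
  have vol: "measure (subspace_lborel S) (X \<inter> S) = measure lborel {c. U c \<in> X}" if "compact X" for X
    using section_of_compact(2)[OF U that] by (simp add: measure_def)
  obtain s where s: "0 \<le> s" "s < r" "{c. U c \<in> L} \<subseteq> cball 0 s"
  proof (cases "{c. U c \<in> L} = {}")
    case True
    then show ?thesis using r that[of 0] by auto
  next
    case False
    obtain c where c: "U c \<in> L" "\<And>c'. U c' \<in> L \<Longrightarrow> norm c' \<le> norm c"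
      using continuous_attains_sup[OF cpt[OF L] False continuous_on_norm_id] by auto
    have "U c \<in> S" using U(3) by auto
    then have "norm c < r" using inL[of "U c"] c(1) U(2) by simp
    moreover have "{c. U c \<in> L} \<subseteq> cball 0 (norm c)" using c(2) by auto
    ultimately show ?thesis using that[of "norm c"] by simp
  qed
  have "measure lborel {c. U c \<in> L} \<le> measure lborel (cball (0::real^'d) s)"
    using s cpt[OF L] by (intro measure_mono_fmeasurable fmeasurable_compact compact_cball) (auto intro: borel_compact)
  also have "\<dots> < measure lborel (cball (0::real^'d) r)"
    using s r by (simp add: content_cball power_strict_mono unit_ball_vol_pos)
  also have "\<dots> \<le> measure lborel {c. U c \<in> K}"
    using inK U(2,3) cpt[OF K] by (intro measure_mono_fmeasurable fmeasurable_compact cpt[OF K]) auto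
  finally show ?thesis using vol K L by simp
qed

lemma linear_matrix_apply: "linear (\<lambda>M :: real^'n^'m. M *v x)"
  by (rule linearI) (simp_all add: matrix_vector_mult_add_rdistrib scaleR_matrix_vector_assoc)

definition block :: "real^('n::finite \<times> 'd::finite) \<Rightarrow> 'n \<Rightarrow> real^'d" where
  "block x a = (\<chi> b. x $ (a, b))"

lemma inner_blocks: "x \<bullet> y = (\<Sum>a\<in>UNIV. block x a \<bullet> block y a)"
  by (simp add: inner_vec_def block_def sum.cartesian_product split_beta' UNIV_Times_UNIV[symmetric] del: UNIV_Times_UNIV)

lemma block_block_diag: "block (block_diag M *v x) a = M *v block x a"
proof -
  have "(\<Sum>q\<in>UNIV. block_diag M $ (a, b) $ q * x $ q) = (\<Sum>c\<in>UNIV. M $ b $ c * x $ (a, c))" for b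
  proof -
    have "(\<Sum>q\<in>UNIV. block_diag M $ (a, b) $ q * x $ q)
        = (\<Sum>e\<in>UNIV. \<Sum>c\<in>UNIV. block_diag M $ (a, b) $ (e, c) * x $ (e, c))"
      by (simp add: sum.cartesian_product split_beta' UNIV_Times_UNIV[symmetric] del: UNIV_Times_UNIV)
    also have "\<dots> = (\<Sum>e\<in>UNIV. if a = e then (\<Sum>c\<in>UNIV. M $ b $ c * x $ (e, c)) else 0)"
      by (intro sum.cong) (auto simp: block_diag_def)
    also have "\<dots> = (\<Sum>c\<in>UNIV. M $ b $ c * x $ (a, c))" by simp
    finally show ?thesis .
  qed
  then show ?thesis by (simp add: vec_eq_iff block_def matrix_vector_mult_def)
qed

locale tangent_system =
  fixes A :: "nat \<Rightarrow> real^'d^'d"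
  assumes system: "complete_tangent_system A"
begin

text \<open>The action on the block vector \<open>x\<close> of the matrix with coefficients \<open>c\<close>; it belongs to the tangent group
when the squares of the coefficients add up to \<open>1\<close>.\<close>
definition orbit_map :: "(nat \<Rightarrow> real) \<Rightarrow> real^('n::finite \<times> 'd) \<Rightarrow> real^('n \<times> 'd)" where
  "orbit_map c x = (\<Sum>j<CARD('d). c j *\<^sub>R (block_diag (A j) *v x))"

lemma inner_A:
  assumes "j < CARD('d)" "k < CARD('d)"
  shows "(A j *v \<sigma>) \<bullet> (A k *v \<sigma>) = (if j = k then (norm \<sigma>)\<^sup>2 else 0)"
proof (cases "\<sigma> = 0")
  case False
  define u where "u = \<sigma> /\<^sub>R norm \<sigma>"
  have "u \<in> sphere 0 1" and \<sigma>: "\<sigma> = norm \<sigma> *\<^sub>R u" using False by (auto simp: u_def)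
  then have "(A j *v u) \<bullet> (A k *v u) = (if j = k then 1 else 0)"
    using system assms by (auto simp: complete_tangent_system_def)
  moreover have "A i *v \<sigma> = norm \<sigma> *\<^sub>R (A i *v u)" for i
    using \<sigma> by (metis matrix_vector_mult_scaleR)
  ultimately show ?thesis by (simp add: power2_eq_square)
qed simp

text \<open>The orthonormality of the tangent system passes to all block vectors, because inner products add up over the
blocks.\<close>
lemma inner_block_A:
  fixes x :: "real^('n::finite \<times> 'd)"
  assumes "j < CARD('d)" "k < CARD('d)"
  shows "(block_diag (A j) *v x) \<bullet> (block_diag (A k) *v x) = (if j = k then (norm x)\<^sup>2 else 0)"
proof -
  have "(norm x)\<^sup>2 = (\<Sum>a\<in>UNIV. (norm (block x a))\<^sup>2)"
    unfolding power2_norm_eq_inner by (rule inner_blocks)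
  then show ?thesis
    unfolding inner_blocks block_block_diag inner_A[OF assms] by simp
qed

lemma norm_orbit_map: "(norm (orbit_map c x))\<^sup>2 = (\<Sum>j<CARD('d). (c j)\<^sup>2) * (norm x)\<^sup>2"
proof -
  have "pairwise (\<lambda>i j. orthogonal (c i *\<^sub>R (block_diag (A i) *v x)) (c j *\<^sub>R (block_diag (A j) *v x))) {..<CARD('d)}"
    by (auto simp: pairwise_def orthogonal_def inner_block_A)
  then have "(norm (orbit_map c x))\<^sup>2 = (\<Sum>j<CARD('d). (norm (c j *\<^sub>R (block_diag (A j) *v x)))\<^sup>2)"
    unfolding orbit_map_def by (rule norm_sum_Pythagorean[OF finite_lessThan])
  also have "\<dots> = (\<Sum>j<CARD('d). (c j)\<^sup>2 * (norm x)\<^sup>2)"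
    by (intro sum.cong) (auto simp: power_mult_distrib power2_norm_eq_inner inner_block_A)
  finally show ?thesis by (simp add: sum_distrib_right)
qed

lemma linear_orbit_map: "linear (orbit_map c)"
  unfolding orbit_map_def
  by (intro linear_compose_sum ballI linear_compose_scale_right matrix_vector_mul_linear)

lemma orbit_map_scale: "orbit_map (\<lambda>j. t * c j) x = t *\<^sub>R orbit_map c x"
  by (simp add: orbit_map_def scaleR_sum_right)

lemma orbit_map_image:
  assumes "invariant_under (tangent_group A) K" and "(\<Sum>j<CARD('d). (c j)\<^sup>2) = 1"
  shows "orbit_map c ` K = K"
proof -
  have "(\<Sum>j<CARD('d). c j *\<^sub>R block_diag (A j)) *v x = orbit_map c x" for x :: "real^('n::finite \<times> 'd)"
    using linear_sum[OF linear_matrix_apply[of x], of "\<lambda>j. c j *\<^sub>R block_diag (A j)" "{..<CARD('d)}"]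
    by (simp add: orbit_map_def scaleR_matrix_vector_assoc)
  moreover have "(\<Sum>j<CARD('d). c j *\<^sub>R block_diag (A j)) \<in> tangent_group A"
    using assms(2) by (auto simp: tangent_group_def)
  ultimately show ?thesis using assms(1) unfolding invariant_under_def by (metis (no_types, lifting) image_cong)
qed

lemma block_diag_mat_1: "block_diag (mat 1) *v x = x"
proof -
  have "block (block_diag (mat 1) *v x) a = block x a" for a by (simp add: block_block_diag)
  then show ?thesis by (simp add: vec_eq_iff block_def)
qed

lemma invariant_uminus:
  assumes "invariant_under (tangent_group A) K" and "x \<in> K"
  shows "- x \<in> K"
proof -
  define c where "c = (\<lambda>j::nat. if j = 0 then - 1 else 0 :: real)"
  have A0: "A 0 = mat 1" using system by (simp add: complete_tangent_system_def)
  have "(\<Sum>j<CARD('d). (c j)\<^sup>2) = (\<Sum>j<CARD('d). if j = 0 then 1 else 0)"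
    by (intro sum.cong) (auto simp: c_def)
  then have "(\<Sum>j<CARD('d). (c j)\<^sup>2) = 1" by simp
  then have "orbit_map c ` K = K" by (rule orbit_map_image[OF assms(1)])
  then have "orbit_map c x \<in> K" using assms(2) by blast
  moreover have "orbit_map c x = (\<Sum>j<CARD('d). if j = 0 then - x else 0)"
    unfolding orbit_map_def by (intro sum.cong) (auto simp: c_def A0 block_diag_mat_1)
  ultimately show ?thesis by simp
qed

lemma zero_in_interior:
  assumes "convex_body K" "invariant_under (tangent_group A) K"
  shows "0 \<in> interior K"
proof -
  obtain p where p: "p \<in> interior K" using assms(1) by (auto simp: convex_body_def)
  then have "- p \<in> K" using invariant_uminus[OF assms(2)] interior_subset by blast
  from mem_interior_convex_shrink[OF _ p this, of "1/2"] assms(1)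
  show ?thesis by (simp add: convex_body_def scaleR_2[symmetric])
qed

text \<open>An invariant convex body is closed under the orbit maps with coefficient vector of norm at most one: scale
the image under a group element towards the origin.\<close>
lemma invariant_contraction:
  assumes K: "convex_body K" "invariant_under (tangent_group A) K"
    and c: "(\<Sum>j<CARD('d). (c j)\<^sup>2) \<le> 1" and x: "x \<in> K"
  shows "orbit_map c x \<in> K"
proof (cases "(\<Sum>j<CARD('d). (c j)\<^sup>2) = 0")
  case True
  have "(norm (orbit_map c x))\<^sup>2 = 0" using True by (simp add: norm_orbit_map)
  then show ?thesis using zero_in_interior[OF K] interior_subset by auto
next
  case False
  define t where "t = sqrt (\<Sum>j<CARD('d). (c j)\<^sup>2)"
  have t: "0 < t" "t \<le> 1" using False c by (auto simp: t_def sum_nonneg order_less_le)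
  have t2: "t\<^sup>2 = (\<Sum>j<CARD('d). (c j)\<^sup>2)" by (simp add: t_def sum_nonneg)
  have "(\<Sum>j<CARD('d). (1 / t * c j)\<^sup>2) = (1 / t)\<^sup>2 * t\<^sup>2"
    by (simp only: power_mult_distrib sum_distrib_left t2)
  also have "\<dots> = 1" using t by (simp add: power_divide)
  finally have "orbit_map (\<lambda>j. 1 / t * c j) ` K = K" by (rule orbit_map_image[OF K(2)])
  then have "orbit_map (\<lambda>j. 1 / t * c j) x \<in> K" using x by blast
  moreover have "0 \<in> K" using zero_in_interior[OF K] interior_subset by auto
  ultimately have "t *\<^sub>R orbit_map (\<lambda>j. 1 / t * c j) x + (1 - t) *\<^sub>R 0 \<in> K"
    using K(1) t by (intro convexD[of K]) (auto simp: convex_body_def)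
  moreover have "t *\<^sub>R orbit_map (\<lambda>j. 1 / t * c j) x = orbit_map c x"
    unfolding orbit_map_scale using t by simp
  ultimately show ?thesis by simp
qed

text \<open>For \<open>x\<close> in \<open>K\<close> but not in \<open>L\<close>, consider the \<open>d\<close>-dimensional subspace spanned by the vectors \<open>A j x\<close>. Each
of its points is an orbit map applied to \<open>x\<close>. Hence it meets \<open>K\<close> in a set containing the ball of
radius \<open>norm x\<close>, and \<open>L\<close> only in points of smaller norm.\<close>
lemma section_comparison_imp_subset:
  fixes K L :: "(real^('n::finite \<times> 'd)) set"
  assumes K: "convex_body K" "invariant_under (tangent_group A) K"
    and L: "convex_body L" "invariant_under (tangent_group A) L"
    and sec: "\<And>\<xi> :: (real^('n \<times> 'd)) set. subspace \<xi> \<Longrightarrow> dim \<xi> = CARD('d) \<Longrightarrow>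
      measure (subspace_lborel \<xi>) (K \<inter> \<xi>) \<le> measure (subspace_lborel \<xi>) (L \<inter> \<xi>)"
  shows "K \<subseteq> L"
proof (rule ccontr)
  assume "\<not> K \<subseteq> L"
  then obtain x where x: "x \<in> K" "x \<notin> L" by blast
  have 0: "0 \<in> L" using zero_in_interior[OF L] interior_subset by auto
  then have nx: "norm x > 0" using x by auto
  define V where "V = (\<lambda>j. block_diag (A j) *v x) ` {..<CARD('d)}"
  define S where "S = span V"
  have injV: "inj_on (\<lambda>j. block_diag (A j) *v x) {..<CARD('d)}"
  proof (rule inj_onI)
    fix j k assume jk: "j \<in> {..<CARD('d)}" "k \<in> {..<CARD('d)}" "block_diag (A j) *v x = block_diag (A k) *v x"
    then show "j = k" using inner_block_A[of j j x] inner_block_A[of j k x] nx by (auto split: if_splits)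
  qed
  have "independent V"
  proof (rule pairwise_orthogonal_independent)
    show "pairwise orthogonal V" by (auto simp: V_def pairwise_def orthogonal_def inner_block_A)
    show "0 \<notin> V" using inner_block_A[of _ _ x] nx by (force simp: V_def)
  qed
  then have dimS: "dim S = CARD('d)"
    unfolding S_def dim_span by (simp add: dim_eq_card_independent V_def card_image[OF injV])
  have S_orbit: "\<exists>c. z = orbit_map c x" if "z \<in> S" for z
  proof -
    have "z \<in> range (\<lambda>u. \<Sum>v\<in>V. u v *\<^sub>R v)" using that span_finite[of V] by (simp add: S_def V_def)
    then obtain u where "z = (\<Sum>v\<in>V. u v *\<^sub>R v)" by blast
    then have "z = orbit_map (\<lambda>j. u (block_diag (A j) *v x)) x"
      unfolding V_def orbit_map_def by (simp add: sum.reindex[OF injV])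
    then show ?thesis by blast
  qed
  have "measure (subspace_lborel S) (L \<inter> S) < measure (subspace_lborel S) (K \<inter> S)"
  proof (rule section_volume_less[OF _ _ _ dimS nx])
    show "compact K" "compact L" using K L by (auto simp: convex_body_def)
    show "subspace S" by (simp add: S_def)
    fix z assume "z \<in> S"
    then obtain c where z: "z = orbit_map c x" using S_orbit by blast
    have nz: "(norm z)\<^sup>2 = (\<Sum>j<CARD('d). (c j)\<^sup>2) * (norm x)\<^sup>2" using norm_orbit_map z by simp
    show "z \<in> K" if "norm z \<le> norm x"
    proof -
      have "(norm z)\<^sup>2 \<le> 1 * (norm x)\<^sup>2" using that by (simp add: power_mono)
      then have "(\<Sum>j<CARD('d). (c j)\<^sup>2) \<le> 1" unfolding nz using nx by (simp add: mult_le_cancel_right)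
      then show ?thesis unfolding z by (rule invariant_contraction[OF K _ x(1)])
    qed
    show "norm z < norm x" if "z \<in> L"
    proof (rule ccontr)
      assume "\<not> norm z < norm x"
      then have ge: "norm x \<le> norm z" by simp
      define t where "t = norm x / norm z"
      have zp: "norm z > 0" using ge nx by linarith
      then have t: "0 < t" "t \<le> 1" using ge nx unfolding t_def by (auto simp: divide_le_eq_1)
      have "t\<^sup>2 * (\<Sum>j<CARD('d). (c j)\<^sup>2) = 1"
      proof -
        have "(\<Sum>j<CARD('d). (c j)\<^sup>2) = (norm z)\<^sup>2 / (norm x)\<^sup>2" using nz nx by simp
        then show ?thesis using nx zp by (simp add: t_def power_divide)
      qed
      then have c1: "(\<Sum>j<CARD('d). (t * c j)\<^sup>2) = 1"
        by (simp add: power_mult_distrib sum_distrib_left)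
      \<comment> \<open>The orbit map with coefficients \<open>t * c j\<close> is an isometry of \<open>L\<close> onto \<open>L\<close> that sends \<open>x\<close> into \<open>L\<close>.\<close>
      \<comment> \<open>Hence \<open>x \<in> L\<close>, against the choice of \<open>x\<close>.\<close>
      have "t *\<^sub>R z + (1 - t) *\<^sub>R 0 \<in> L"
        using L(1) t that 0 by (intro convexD[of L]) (auto simp: convex_body_def)
      then have "orbit_map (\<lambda>j. t * c j) x \<in> orbit_map (\<lambda>j. t * c j) ` L"
        using orbit_map_image[OF L(2) c1] z by (simp add: orbit_map_scale)
      then obtain l where l: "l \<in> L" "orbit_map (\<lambda>j. t * c j) l = orbit_map (\<lambda>j. t * c j) x" by auto
      then have "orbit_map (\<lambda>j. t * c j) (l - x) = 0" by (simp add: linear_diff[OF linear_orbit_map])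
      then have "(norm (l - x))\<^sup>2 = 0" using norm_orbit_map[of "\<lambda>j. t * c j" "l - x"] c1 by simp
      then show False using l x by simp
    qed
  qed
  then show False using sec[of S] dimS by (simp add: S_def)
qed

lemma unitary_structure_block_diag:
  assumes "CARD('n::finite) = 3" and d2: "CARD('d) = 2"
  shows "unitary_structure (\<lambda>x :: real^('n \<times> 'd). block_diag (A 1) *v x)"
proof (rule unitary_structure.intro)
  have A0: "A 0 = mat 1" using system by (simp add: complete_tangent_system_def)
  show "linear (\<lambda>x :: real^('n \<times> 'd). block_diag (A 1) *v x)" by (rule matrix_vector_mul_linear)
  show "norm (block_diag (A 1) *v x) = norm x" for x :: "real^('n \<times> 'd)"
    using inner_block_A[of 1 1 x] d2 by (simp add: norm_eq_sqrt_inner)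
  show "x \<bullet> (block_diag (A 1) *v x) = 0" for x :: "real^('n \<times> 'd)"
    using inner_block_A[of 0 1 x] d2 by (simp add: A0 block_diag_mat_1)
  show "DIM(real^('n \<times> 'd)) = 6" using assms by (simp add: card_prod)
qed

text \<open>With \<open>d = 2\<close> the orbit maps are exactly the multiplications by complex numbers, with \<open>A 1\<close> as the imaginary
unit, so invariant convex bodies are \<open>balanced\<close>.\<close>
lemma complex_three_space_comparison:
  fixes K L :: "(real^('n::finite \<times> 'd)) set"
  assumes n3: "CARD('n) = 3" and d2: "CARD('d) = 2"
    and K: "convex_body K" "invariant_under (tangent_group A) K"
    and L: "convex_body L" "invariant_under (tangent_group A) L"
    and sec: "\<And>\<xi> :: (real^('n \<times> 'd)) set. subspace \<xi> \<Longrightarrow> dim \<xi> = 4 \<Longrightarrow>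
      measure (subspace_lborel \<xi>) (K \<inter> \<xi>) \<le> measure (subspace_lborel \<xi>) (L \<inter> \<xi>)"
  shows "measure lborel K \<le> measure lborel L"
proof -
  interpret unitary_structure "\<lambda>x :: real^('n \<times> 'd). block_diag (A 1) *v x"
    by (rule unitary_structure_block_diag[OF n3 d2])
  have A0: "A 0 = mat 1" using system by (simp add: complete_tangent_system_def)
  have Kc: "compact K" "convex K" and Lc: "compact L" "convex L" using K L by (auto simp: convex_body_def)
  have "balanced K"
    unfolding balanced_def
  proof (intro allI impI ballI)
    fix c :: complex and x assume c: "norm c \<le> 1" and x: "x \<in> K"
    define k where "k = (\<lambda>j::nat. if j = 0 then Re c else Im c)"
    have "(\<Sum>j<CARD('d). (k j)\<^sup>2) = (norm c)\<^sup>2"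
      by (simp add: d2 numeral_2_eq_2 lessThan_Suc k_def cmod_def)
    then have "orbit_map k x \<in> K" using c by (intro invariant_contraction[OF K _ x]) (simp add: power_le_one)
    moreover have "orbit_map k x = cscale c x"
      unfolding cscale_def by (simp add: orbit_map_def d2 numeral_2_eq_2 lessThan_Suc k_def A0 block_diag_mat_1 add.commute)
    ultimately show "cscale c x \<in> K" by simp
  qed
  moreover have "0 \<in> interior K \<inter> interior L" using zero_in_interior K L by blast
  then obtain \<rho> where \<rho>: "\<rho> > 0" "ball 0 \<rho> \<subseteq> interior K \<inter> interior L"
    using open_contains_ball[of "interior K \<inter> interior L"] by blast
  then have "ball 0 \<rho> \<subseteq> K" "ball 0 \<rho> \<subseteq> L" using interior_subset by blast+
  moreover have "emeasure (subspace_lborel (complex_hyperplane \<xi>)) (K \<inter> complex_hyperplane \<xi>)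
      \<le> emeasure (subspace_lborel (complex_hyperplane \<xi>)) (L \<inter> complex_hyperplane \<xi>)" if "\<xi> \<noteq> 0" for \<xi>
  proof -
    let ?S = "complex_hyperplane \<xi>"
    have sub: "subspace ?S" and dim: "dim ?S = 4"
      using subspace_complex_hyperplane dim_complex_hyperplane[OF that] by auto
    then have "dim ?S = DIM(complex2)" by simp
    then obtain U :: "complex2 \<Rightarrow> real^('n \<times> 'd)" where U: "linear U" "\<And>c. norm (U c) = norm c"
        "range U = ?S" "subspace_lborel ?S = distr lborel borel U"
      by (rule subspace_lborel_coordinates[OF sub]) (rule that)
    have "emeasure (subspace_lborel ?S) (X \<inter> ?S) \<noteq> \<infinity>" if "compact X" for X
      unfolding section_of_compact(2)[OF U that]
      using emeasure_compact_finite[OF section_of_compact(1)[OF U that]] by simp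
    then show ?thesis
      using sec[OF sub dim] Kc Lc by (simp add: emeasure_eq_ennreal_measure ennreal_leI)
  qed
  ultimately show ?thesis
    using complex_hyperplane_sections_determine_volume_order[OF Kc _ Lc \<rho>(1)] by blast
qed

end

theorem corollary5p7:
  fixes A :: "nat \<Rightarrow> real^'d^'d"
    and K L :: "(real^('n::finite \<times> 'd)) set"
    and d n N i :: nat
  assumes "d = CARD('d)" and "n = CARD('n)"
    and "d \<in> {2, 4, 8}" and "n > 1" and "N = d * n" and "i = N - d"
    and "(N = 4 \<and> d = 2 \<and> i = 2) \<or> (N = 6 \<and> d = 2 \<and> i = 4) \<or>
         (N = 8 \<and> d = 4 \<and> i = 4) \<or> (N = 16 \<and> d = 8 \<and> i = 8)"
    and "complete_tangent_system A"
    and "convex_body K" and "invariant_under (tangent_group A) K"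
    and "convex_body L" and "invariant_under (tangent_group A) L"
    and "\<And>\<xi> :: (real^('n \<times> 'd)) set. subspace \<xi> \<Longrightarrow> dim \<xi> = i \<Longrightarrow>
           measure (subspace_lborel \<xi>) (K \<inter> \<xi>) \<le> measure (subspace_lborel \<xi>) (L \<inter> \<xi>)"
  shows "measure lborel K \<le> measure lborel L"
proof -
  interpret tangent_system A by standard (rule assms(8))
  have cpt: "compact K" "compact L" using assms(9,11) by (auto simp: convex_body_def)
  consider "i = d" | "N = 6" "d = 2" "i = 4" using assms(7) by blast
  then show ?thesis
  proof cases
    case 1
    have "K \<subseteq> L"
      by (rule section_comparison_imp_subset[OF assms(9-12)]) (use assms(1,13) 1 in simp)
    then show ?thesis using cpt by (intro measure_mono_fmeasurable fmeasurable_compact) (auto intro: borel_compact)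
  next
    case 2
    have "CARD('n) = 3" "CARD('d) = 2" using 2 assms(1,2,5) by auto
    then show ?thesis
      by (rule complex_three_space_comparison[OF _ _ assms(9-12)]) (use assms(13) 2 in simp)
  qed
qed

end
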